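(* Assume that $f\in L^\infty(\Omega)$ and $u\in H^2(\Omega)$. Then for all sufficiently large $N$, namely for all $N\ge N_0$ with $N_0$ the integer defined in the context, there exists at least one equidistributing mesh with $N$ elements, i.e. a mesh $0=x_0<x_1<\dots<x_N=1$ such that $$\rho_ih_i=\frac{\sigma_h}{N},\qquad i=1,\dots,N,$$ where $\rho_i$ and $\sigma_h$ are computed from the linear finite element solution $u_h$ on that same mesh.
   Context: Let $\Omega=(0,1)$. The functions $a,b\in W^{1,\infty}(\Omega)$, $c\in L^\infty(\Omega)$, $f\in L^2(\Omega)$ satisfy $a(x)\ge a_0>0$ and $c(x)-\frac12 b'(x)\ge 0$ a.e. in $\Omega$ for some constant $a_0$; $f$ is not a.e. zero. Put $B(w,v)=\int_\Omega(aw'v'+bw'v+cwv)\,dx$ and $(f,v)=\int_\Omega fv\,dx$. $u\in V=H_0^1(\Omega)$ is the solution of $B(u,v)=(f,v)$ for all $v\in V$ (weak form of $-(au')'+bu'+cu=f$, $u(0)=u(1)=0$). A mesh with $N$ elements is $0=x_0<x_1<\dots<x_N=1$, with $h_i=x_i-x_{i-1}$ and $K_i=(x_{i-1},x_i)$; it is identified with $X=(x_1,\dots,x_{N-1})^\top$. $V_h$ is the space of continuous functions on $[0,1]$ that are linear on each $K_i$ and vanish at $0$ and $1$; $u_h\in V_h$ is the finite element solution: $B(u_h,v_h)=(f,v_h)$ for all $v_h\in V_h$. $r=f+a'u'-bu'-cu$ and $r_h=f+a'u_h'-bu_h'-cu_h$ (with $u_h'$ taken elementwise). Further $\langle r_h\rangle_i=\big(\frac1{h_i}\int_{K_i}|r_h|^2dx\big)^{1/2}$,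 $\alpha_h=\big[\sum_{i=1}^N h_i\langle r_h\rangle_i^{2/3}\big]^3$, $\rho_i=\big(1+\frac1{\alpha_h}\langle r_h\rangle_i^2\big)^{1/3}$, and $\sigma_h=\sum_{i=1}^N\rho_ih_i$. Define $$\rho_0=\Big[1+\gamma\Big(\frac{\|r\|_{L^\infty(\Omega)}}{\|r\|_{L^{2/3}(\Omega)}}\Big)^{2/3}\Big]^2,\qquad S_N=\Big\{X\in\mathbb R^{N-1}:\ 0=x_0<x_1<\dots<x_N=1,\ \frac1{\rho_0N}\le h_i\le\frac2N,\ i=1,\dots,N\Big\}.$$ Here $\gamma=2(1+C_1+C_2)^{2/3}$, where $C_1,C_2>0$ are fixed constants depending only on $a,b,c$ such that, for every $N\ge1$, every $s\ge1$, every right-hand side $f\in L^2(\Omega)$ (with corresponding $u$, $r$) and every mesh with $\frac1{sN}\le h_i\le\frac2N$ for all $i$: $\|b-a'\|_{L^\infty(\Omega)}\|(u-u_h)'\|_{L^\infty(\Omega)}\le C_1\sqrt{s+1}\,\|r\|_\Omega/\sqrt N$ and $\|c\|_{L^\infty(\Omega)}\|u-u_h\|_{L^\infty(\Omega)}\le C_2\|r\|_\Omega/N$. $N_0$ is a positive integer (it exists and depends only on $a,b,c,f,u$, not on the mesh or the finite element approximation) such that for every $N\ge N_0$ and every $X\in S_N$: $\frac12\|r\|_{L^{2/3}(\Omega)}^{2/3}\le\alpha_h^{1/3}\le\frac32\|r\|_{L^{2/3}(\Omega)}^{2/3}$. $\|\cdot\|_\Omega$ is the $L^2(\Omega)$ norm;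 $\|v\|_{L^p(\Omega)}=(\int_\Omega|v|^pdx)^{1/p}$ also for $0<p<1$. *)

theory Defs
  imports "HOL-Analysis.Analysis" "HOL-Probability.Essential_Supremum"
begin

abbreviation \<Omega> :: "real set" where "\<Omega> \<equiv> {0<..<1}"

abbreviation leb\<Omega> :: "real measure" where "leb\<Omega> \<equiv> lebesgue_on \<Omega>"

text \<open>Elements of the Lebesgue and Sobolev spaces are represented by functions
  \<^typ>\<open>real \<Rightarrow> real\<close>, of which only the values on \<open>\<Omega>\<close>, up to null sets, matter.\<close>

definition Lp :: "real \<Rightarrow> (real \<Rightarrow> real) set" where
  "Lp p = {v. v \<in> borel_measurable leb\<Omega> \<and> integrable leb\<Omega> (\<lambda>x. \<bar>v x\<bar> powr p)}"

definition Linf :: "(real \<Rightarrow> real) set" where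
  "Linf = {v. v \<in> borel_measurable leb\<Omega> \<and> (\<exists>C. AE x in leb\<Omega>. \<bar>v x\<bar> \<le> C)}"

definition Lp_norm :: "real \<Rightarrow> (real \<Rightarrow> real) \<Rightarrow> real" where
  "Lp_norm p v = (LINT x|leb\<Omega>. \<bar>v x\<bar> powr p) powr (1 / p)"

text \<open>Meaningful on \<open>Linf\<close> only: \<^const>\<open>real_of_ereal\<close> sends an infinite essential supremum
  to 0. Below it is applied to elements of \<open>Linf\<close> only; for \<open>wderiv (u - uh)\<close> this holds because
  a weak solution with right-hand side in \<open>Lp 2\<close> lies in \<open>H2\<close>, as \<open>a\<close> is Lipschitz and bounded
  away from 0.\<close>

definition Linf_norm :: "(real \<Rightarrow> real) \<Rightarrow> real" where
  "Linf_norm v = real_of_ereal (esssup leb\<Omega> (\<lambda>x. ereal \<bar>v x\<bar>))"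

definition locally_integrable :: "(real \<Rightarrow> real) \<Rightarrow> bool" where
  "locally_integrable v \<longleftrightarrow> (\<forall>K. compact K \<and> K \<subseteq> \<Omega> \<longrightarrow> integrable (lebesgue_on K) v)"

text \<open>The space of smooth functions with compact support in \<open>\<Omega>\<close>.\<close>

definition test_functions :: "(real \<Rightarrow> real) set" where
  "test_functions = {\<phi>. (\<forall>n x. (deriv ^^ n) \<phi> differentiable (at x)) \<and>
     (\<exists>K. compact K \<and> K \<subseteq> \<Omega> \<and> (\<forall>x. x \<notin> K \<longrightarrow> \<phi> x = 0))}"

definition has_weak_deriv :: "(real \<Rightarrow> real) \<Rightarrow> (real \<Rightarrow> real) \<Rightarrow> bool" where
  "has_weak_deriv v g \<longleftrightarrow> locally_integrable v \<and> locally_integrable g \<and>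
     (\<forall>\<phi>\<in>test_functions. (LINT x|leb\<Omega>. v x * deriv \<phi> x) = - (LINT x|leb\<Omega>. g x * \<phi> x))"

text \<open>A representative of the weak derivative, which is unique up to null sets.\<close>

definition wderiv :: "(real \<Rightarrow> real) \<Rightarrow> real \<Rightarrow> real" where
  "wderiv v = (SOME g. has_weak_deriv v g)"

definition W1inf :: "(real \<Rightarrow> real) set" where
  "W1inf = {v \<in> Linf. \<exists>g \<in> Linf. has_weak_deriv v g}"

definition H1 :: "(real \<Rightarrow> real) set" where
  "H1 = {v \<in> Lp 2. \<exists>g \<in> Lp 2. has_weak_deriv v g}"

definition H2 :: "(real \<Rightarrow> real) set" where
  "H2 = {v \<in> H1. wderiv v \<in> H1}"

definition H1_norm :: "(real \<Rightarrow> real) \<Rightarrow> real" where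
  "H1_norm v = sqrt ((Lp_norm 2 v)\<^sup>2 + (Lp_norm 2 (wderiv v))\<^sup>2)"

text \<open>The closure of the test functions in \<open>H1\<close>.\<close>

definition H1_0 :: "(real \<Rightarrow> real) set" where
  "H1_0 = {v \<in> H1. \<exists>\<phi> :: nat \<Rightarrow> real \<Rightarrow> real. (\<forall>n. \<phi> n \<in> test_functions) \<and>
     (\<lambda>n. H1_norm (\<lambda>x. v x - \<phi> n x)) \<longlonglongrightarrow> 0}"

definition bilin ::
  "(real \<Rightarrow> real) \<Rightarrow> (real \<Rightarrow> real) \<Rightarrow> (real \<Rightarrow> real) \<Rightarrow> (real \<Rightarrow> real) \<Rightarrow> (real \<Rightarrow> real) \<Rightarrow> real" where
  "bilin a b c w v =
     (LINT x|leb\<Omega>. a x * wderiv w x * wderiv v x + b x * wderiv w x * v x + c x * w x * v x)"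

definition weak_solution ::
  "(real \<Rightarrow> real) \<Rightarrow> (real \<Rightarrow> real) \<Rightarrow> (real \<Rightarrow> real) \<Rightarrow> (real \<Rightarrow> real) \<Rightarrow> (real \<Rightarrow> real) \<Rightarrow> bool" where
  "weak_solution a b c f u \<longleftrightarrow>
     u \<in> H1_0 \<and> (\<forall>v\<in>H1_0. bilin a b c u v = (LINT x|leb\<Omega>. f x * v x))"

text \<open>Only the values \<open>x 0, \<dots>, x N\<close> of \<open>x\<close> matter.\<close>

definition mesh :: "nat \<Rightarrow> (nat \<Rightarrow> real) \<Rightarrow> bool" where
  "mesh N x \<longleftrightarrow> x 0 = 0 \<and> x N = 1 \<and> (\<forall>i<N. x i < x (Suc i))"

definition elem :: "(nat \<Rightarrow> real) \<Rightarrow> nat \<Rightarrow> real set" where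
  "elem x i = {x (i - 1)<..<x i}"

definition elem_len :: "(nat \<Rightarrow> real) \<Rightarrow> nat \<Rightarrow> real" where
  "elem_len x i = x i - x (i - 1)"

definition fe_space :: "nat \<Rightarrow> (nat \<Rightarrow> real) \<Rightarrow> (real \<Rightarrow> real) set" where
  "fe_space N x = {v. continuous_on {0..1} v \<and> v 0 = 0 \<and> v 1 = 0 \<and>
     (\<forall>i\<in>{1..N}. \<exists>p q. \<forall>t\<in>elem x i. v t = p * t + q)}"

definition fe_solution ::
  "(real \<Rightarrow> real) \<Rightarrow> (real \<Rightarrow> real) \<Rightarrow> (real \<Rightarrow> real) \<Rightarrow> (real \<Rightarrow> real) \<Rightarrow>
   nat \<Rightarrow> (nat \<Rightarrow> real) \<Rightarrow> (real \<Rightarrow> real) \<Rightarrow> bool" where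
  "fe_solution a b c f N x uh \<longleftrightarrow>
     uh \<in> fe_space N x \<and> (\<forall>v\<in>fe_space N x. bilin a b c uh v = (LINT t|leb\<Omega>. f t * v t))"

definition resid ::
  "(real \<Rightarrow> real) \<Rightarrow> (real \<Rightarrow> real) \<Rightarrow> (real \<Rightarrow> real) \<Rightarrow> (real \<Rightarrow> real) \<Rightarrow> (real \<Rightarrow> real) \<Rightarrow> real \<Rightarrow> real" where
  "resid a b c f u t = f t + wderiv a t * wderiv u t - b t * wderiv u t - c t * u t"

text \<open>\<^const>\<open>deriv\<close> is the classical derivative; on the open element \<open>elem x i\<close>, where \<open>uh\<close> is
  affine, it is the elementwise one.\<close>

definition fe_resid ::
  "(real \<Rightarrow> real) \<Rightarrow> (real \<Rightarrow> real) \<Rightarrow> (real \<Rightarrow> real) \<Rightarrow> (real \<Rightarrow> real) \<Rightarrow> (real \<Rightarrow> real) \<Rightarrow> real \<Rightarrow> real" where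
  "fe_resid a b c f uh t = f t + wderiv a t * deriv uh t - b t * deriv uh t - c t * uh t"

definition elem_avg :: "(nat \<Rightarrow> real) \<Rightarrow> (real \<Rightarrow> real) \<Rightarrow> nat \<Rightarrow> real" where
  "elem_avg x rh i = sqrt (1 / elem_len x i * (LINT t|lebesgue_on (elem x i). \<bar>rh t\<bar>\<^sup>2))"

definition alpha_h :: "nat \<Rightarrow> (nat \<Rightarrow> real) \<Rightarrow> (real \<Rightarrow> real) \<Rightarrow> real" where
  "alpha_h N x rh = (\<Sum>i=1..N. elem_len x i * elem_avg x rh i powr (2/3)) ^ 3"

definition rho :: "nat \<Rightarrow> (nat \<Rightarrow> real) \<Rightarrow> (real \<Rightarrow> real) \<Rightarrow> nat \<Rightarrow> real" where
  "rho N x rh i = (1 + 1 / alpha_h N x rh * (elem_avg x rh i)\<^sup>2) powr (1/3)"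

definition sigma_h :: "nat \<Rightarrow> (nat \<Rightarrow> real) \<Rightarrow> (real \<Rightarrow> real) \<Rightarrow> real" where
  "sigma_h N x rh = (\<Sum>i=1..N. rho N x rh i * elem_len x i)"

text \<open>Positivity of \<open>alpha_h\<close> is what makes \<open>rho\<close> well defined; without it Isabelle's
  \<open>1 / 0 = 0\<close> would make every uniform mesh with vanishing residual equidistributing.\<close>

definition equidistributing :: "nat \<Rightarrow> (nat \<Rightarrow> real) \<Rightarrow> (real \<Rightarrow> real) \<Rightarrow> bool" where
  "equidistributing N x rh \<longleftrightarrow> 0 < alpha_h N x rh \<and>
     (\<forall>i\<in>{1..N}. rho N x rh i * elem_len x i = sigma_h N x rh / real N)"

definition error_constants ::
  "(real \<Rightarrow> real) \<Rightarrow> (real \<Rightarrow> real) \<Rightarrow> (real \<Rightarrow> real) \<Rightarrow> real \<Rightarrow> real \<Rightarrow> bool" where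
  "error_constants a b c C1 C2 \<longleftrightarrow> 0 < C1 \<and> 0 < C2 \<and>
     (\<forall>(N::nat) (s::real) f u x uh.
        1 \<le> N \<longrightarrow> 1 \<le> s \<longrightarrow> f \<in> Lp 2 \<longrightarrow> weak_solution a b c f u \<longrightarrow> mesh N x \<longrightarrow>
        (\<forall>i\<in>{1..N}. 1 / (s * real N) \<le> elem_len x i \<and> elem_len x i \<le> 2 / real N) \<longrightarrow>
        fe_solution a b c f N x uh \<longrightarrow>
          Linf_norm (\<lambda>t. b t - wderiv a t) * Linf_norm (wderiv (\<lambda>t. u t - uh t))
            \<le> C1 * sqrt (s + 1) * Lp_norm 2 (resid a b c f u) / sqrt (real N) \<and>
          Linf_norm c * Linf_norm (\<lambda>t. u t - uh t)
            \<le> C2 * Lp_norm 2 (resid a b c f u) / real N)"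

definition gamma_const :: "real \<Rightarrow> real \<Rightarrow> real" where
  "gamma_const C1 C2 = 2 * (1 + C1 + C2) powr (2/3)"

definition rho0 :: "real \<Rightarrow> real \<Rightarrow> (real \<Rightarrow> real) \<Rightarrow> real" where
  "rho0 C1 C2 r = (1 + gamma_const C1 C2 * (Linf_norm r / Lp_norm (2/3) r) powr (2/3))\<^sup>2"

definition S_mesh :: "real \<Rightarrow> nat \<Rightarrow> (nat \<Rightarrow> real) set" where
  "S_mesh R N = {x. mesh N x \<and>
     (\<forall>i\<in>{1..N}. 1 / (R * real N) \<le> elem_len x i \<and> elem_len x i \<le> 2 / real N)}"

end

theory Submission
  imports Defs
begin

text \<open>The mesh is found as a fixed point, but not of a map on meshes alone. Given element lengths
  \<open>h i\<close> and nodal values \<open>U\<close>, put \<open>F i = \<rho> i * h i - \<sigma> / N\<close>. These numbers have sum \<open>0\<close>, and as long as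
  \<open>1 \<le> \<rho> i \<le> R\<close> and \<open>\<sigma> \<le> 2\<close>, the map \<open>h \<mapsto> h - F / R\<close> sends \<open>S_mesh R N\<close> to itself; its fixed points
  equidistribute \<open>\<rho>\<close>. At the same time \<open>U\<close> is moved by the negative residual of the discrete
  equations and clipped to a box. Brouwer's theorem (\<open>brouwer_box\<close>) gives a fixed point of the joint
  map; coercivity of the bilinear form (\<open>galerkin_coercive\<close>) keeps it away from the clipping bounds, so
  that there \<open>U\<close> is the vector of nodal values of the finite element solution. Existence of that
  solution is thus obtained on the way, and neither its uniqueness nor its continuous dependence on
  the mesh is needed: only \<open>\<rho>\<close> and the discrete equations have to be continuous in \<open>(h, U)\<close>, which
  is bounded convergence. See \<open>S_mesh_fixed_point\<close>.

  For nodal values \<open>U\<close> that do not solve the discrete problem neither \<open>\<alpha>\<^sub>h > 0\<close> nor \<open>\<rho> \<le> R\<close> is known.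
  Therefore \<open>\<alpha>\<^sub>h\<close> is bounded below and \<open>\<rho>\<close> above by truncation; \<open>\<sigma> \<le> 2\<close> survives because the cube
  root is subadditive. At the fixed point the lower bound on \<open>\<alpha>\<^sub>h\<close> holds by the choice of \<open>N\<close>, and the
  error estimates bound the discrete residual by \<open>L * (1 + C1 * sqrt (R + 1) + C2)\<close>, where \<open>L\<close> is the
  maximum norm of \<open>r\<close>. The constant \<open>R = \<rho>\<^sub>0\<close> is chosen such that this gives \<open>\<rho> \<le> R\<close>
  (\<open>density_le_rho0\<close>), so that the truncations are inactive.

  All this requires that \<open>r\<close> does not vanish (\<open>resid_nonzero\<close>): otherwise \<open>a * u'' = 0\<close>, so \<open>u\<close> would be
  affine with zero boundary values, and \<open>f\<close> would vanish. This step and the coercivity rest on the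
  description of functions with integrable weak derivative as indefinite integrals
  (\<open>weak_deriv_primitive\<close>) and on the product rule for such functions (\<open>is_primitive_mult\<close>).\<close>

section \<open>Essentially bounded functions on the unit interval\<close>

lemma finite_measure_leb: "finite_measure leb\<Omega>"
  by (intro finite_measure_lebesgue_on) simp

lemma measure_leb [simp]: "measure leb\<Omega> \<Omega> = 1"
  by (simp add: measure_restrict_space)

lemma AE_leb_neq: "AE t in leb\<Omega>. t \<noteq> (s::real)"
proof -
  have "AE t in lebesgue. t \<noteq> s"
    using AE_completion[OF AE_lborel_singleton[of s]] by simp
  then show ?thesis by (subst AE_restrict_space_iff) (auto elim: eventually_mono)
qed

lemma AE_leb_in: "AE t in leb\<Omega>. t \<in> \<Omega>"
  by (rule AE_I2) simp

lemma borel_imp_leb: "f \<in> borel_measurable borel \<Longrightarrow> f \<in> borel_measurable leb\<Omega>"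
  by (intro measurable_restrict_space1 measurable_completion) simp

lemma Linf_measurable [dest]: "v \<in> Linf \<Longrightarrow> v \<in> borel_measurable leb\<Omega>"
  by (simp add: Linf_def)

lemma LinfI: "v \<in> borel_measurable leb\<Omega> \<Longrightarrow> AE x in leb\<Omega>. \<bar>v x\<bar> \<le> C \<Longrightarrow> v \<in> Linf"
  by (auto simp: Linf_def)

lemma LinfE:
  assumes "v \<in> Linf"
  obtains C where "0 \<le> C" "AE x in leb\<Omega>. \<bar>v x\<bar> \<le> C"
proof -
  from assms obtain C where C: "AE x in leb\<Omega>. \<bar>v x\<bar> \<le> C" by (auto simp: Linf_def)
  have "AE x in leb\<Omega>. \<bar>v x\<bar> \<le> max C 0" using C by eventually_elim auto
  then show ?thesis using that[of "max C 0"] by auto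
qed

lemma Linf_const [intro, simp]: "(\<lambda>x. k) \<in> Linf"
  by (rule LinfI[where C = "\<bar>k\<bar>"]) auto

lemma Linf_add [intro]:
  assumes "v \<in> Linf" "w \<in> Linf" shows "(\<lambda>x. v x + w x) \<in> Linf"
proof -
  obtain C where C: "AE x in leb\<Omega>. \<bar>v x\<bar> \<le> C" using assms(1) by (rule LinfE)
  obtain D where D: "AE x in leb\<Omega>. \<bar>w x\<bar> \<le> D" using assms(2) by (rule LinfE)
  show ?thesis
  proof (rule LinfI)
    show "AE x in leb\<Omega>. \<bar>v x + w x\<bar> \<le> C + D" using C D by eventually_elim auto
  qed (use assms in \<open>auto intro: borel_measurable_add\<close>)
qed

lemma Linf_mult [intro]:
  assumes "v \<in> Linf" "w \<in> Linf" shows "(\<lambda>x. v x * w x) \<in> Linf"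
proof -
  obtain C where C: "0 \<le> C" "AE x in leb\<Omega>. \<bar>v x\<bar> \<le> C" using assms(1) by (rule LinfE)
  obtain D where D: "0 \<le> D" "AE x in leb\<Omega>. \<bar>w x\<bar> \<le> D" using assms(2) by (rule LinfE)
  show ?thesis
  proof (rule LinfI)
    show "AE x in leb\<Omega>. \<bar>v x * w x\<bar> \<le> C * D"
      using C(2) D(2) by eventually_elim (auto simp: abs_mult intro!: mult_mono C(1))
  qed (use assms in \<open>auto intro: borel_measurable_times\<close>)
qed

lemma Linf_uminus [intro]: "v \<in> Linf \<Longrightarrow> (\<lambda>x. - v x) \<in> Linf"
  using Linf_mult[of "\<lambda>_. -1" v] by simp

lemma Linf_diff [intro]: "v \<in> Linf \<Longrightarrow> w \<in> Linf \<Longrightarrow> (\<lambda>x. v x - w x) \<in> Linf"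
  using Linf_add[of v "\<lambda>x. - w x"] by (auto)

lemma Linf_integrable: assumes "v \<in> Linf" shows "integrable leb\<Omega> v"
proof -
  obtain C where "AE x in leb\<Omega>. \<bar>v x\<bar> \<le> C" using assms by (rule LinfE)
  then show ?thesis using assms
    by (intro finite_measure.integrable_const_bound[OF finite_measure_leb]) auto
qed

lemma Linf_mult_integrable:
  assumes "v \<in> Linf" "integrable leb\<Omega> g" shows "integrable leb\<Omega> (\<lambda>x. v x * g x)"
proof -
  obtain C where C: "0 \<le> C" "AE x in leb\<Omega>. \<bar>v x\<bar> \<le> C" using assms(1) by (rule LinfE)
  show ?thesis
  proof (rule Bochner_Integration.integrable_bound)
    show "integrable leb\<Omega> (\<lambda>x. C * g x)" using assms by simp
    show "(\<lambda>x. v x * g x) \<in> borel_measurable leb\<Omega>"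
      using assms by (intro borel_measurable_times) auto
    show "AE x in leb\<Omega>. norm (v x * g x) \<le> norm (C * g x)"
      using C(2) by eventually_elim (use C(1) in \<open>auto simp: abs_mult intro!: mult_right_mono\<close>)
  qed
qed

lemma leb_measurable_AE:
  fixes f g :: "real \<Rightarrow> real"
  assumes "f \<in> borel_measurable leb\<Omega>" "AE x in leb\<Omega>. f x = g x"
  shows "g \<in> borel_measurable leb\<Omega>"
proof -
  have f: "(\<lambda>x. if x \<in> \<Omega> then f x else 0) \<in> borel_measurable lebesgue"
    by (rule borel_measurable_if_I[OF assms(1)]) simp
  have ae: "AE x in lebesgue. (if x \<in> \<Omega> then f x else 0) = (if x \<in> \<Omega> then g x else 0)"
    using assms(2) by (subst (asm) AE_restrict_space_iff) (auto elim: eventually_mono)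
  have "(\<lambda>x. if x \<in> \<Omega> then g x else 0) \<in> borel_measurable lebesgue"
  proof (rule measurableI)
    fix A :: "real set" assume A: "A \<in> sets borel"
    show "(\<lambda>x. if x \<in> \<Omega> then g x else 0) -` A \<inter> space lebesgue \<in> sets lebesgue"
    proof (rule completion.in_sets_AE)
      show "(\<lambda>x. if x \<in> \<Omega> then f x else 0) -` A \<inter> space lebesgue \<in> sets lebesgue"
        using f A by (rule measurable_sets)
      show "AE x in lebesgue. x \<in> (\<lambda>x. if x \<in> \<Omega> then f x else 0) -` A \<inter> space lebesgue
          \<longleftrightarrow> x \<in> (\<lambda>x. if x \<in> \<Omega> then g x else 0) -` A \<inter> space lebesgue"
        using ae by eventually_elim simp
    qed simp
  qed simp
  then show ?thesis by (rule borel_measurable_if_D)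
qed

lemma Linf_cong_AE:
  assumes "v \<in> Linf" "AE x in leb\<Omega>. v x = w x" shows "w \<in> Linf"
proof -
  obtain C where C: "AE x in leb\<Omega>. \<bar>v x\<bar> \<le> C" using assms(1) by (rule LinfE)
  show ?thesis
  proof (rule LinfI)
    show "w \<in> borel_measurable leb\<Omega>"
      by (rule leb_measurable_AE[OF Linf_measurable[OF assms(1)] assms(2)])
    show "AE x in leb\<Omega>. \<bar>w x\<bar> \<le> C" using C assms(2) by eventually_elim auto
  qed
qed

lemma leb_bounded_convergence:
  fixes s :: "nat \<Rightarrow> real \<Rightarrow> real"
  assumes "\<And>k. s k \<in> borel_measurable leb\<Omega>" "f \<in> borel_measurable leb\<Omega>"
    and "AE x in leb\<Omega>. (\<lambda>k. s k x) \<longlonglongrightarrow> f x"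
    and "\<And>k. AE x in leb\<Omega>. \<bar>s k x\<bar> \<le> C"
  shows "(\<lambda>k. LINT x|leb\<Omega>. s k x) \<longlonglongrightarrow> (LINT x|leb\<Omega>. f x)"
  by (rule integral_dominated_convergence[where w = "\<lambda>_. C"])
     (use assms in \<open>auto intro: finite_measure.integrable_const[OF finite_measure_leb]\<close>)

section \<open>Absolutely continuous functions\<close>

text \<open>The indefinite integral \<open>\<integral>\<^sub>0\<^sup>x f\<close> for \<open>x \<in> [0, 1]\<close>; the integrand is cut off by an
  indicator function, so that all integrals are over the one measure space \<open>leb\<Omega>\<close>.\<close>

definition prim :: "(real \<Rightarrow> real) \<Rightarrow> real \<Rightarrow> real" where
  "prim f x = (LINT t|leb\<Omega>. indicator {..<x} t * f t)"

text \<open>\<open>F\<close> is absolutely continuous on \<open>[0, 1]\<close> with almost everywhere derivative \<open>f\<close>, expressed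
  through the indefinite integral. Nothing is required of \<open>F\<close> outside \<open>[0, 1]\<close>.\<close>

definition is_primitive :: "(real \<Rightarrow> real) \<Rightarrow> (real \<Rightarrow> real) \<Rightarrow> bool" where
  "is_primitive F f \<longleftrightarrow> integrable leb\<Omega> f \<and> (\<forall>x\<in>{0..1}. F x = F 0 + prim f x)"

lemma indicator_Linf: "A \<in> sets borel \<Longrightarrow> indicator A \<in> Linf"
  by (rule LinfI[where C = 1, OF borel_imp_leb]) (auto simp: indicator_def)

lemma integrable_indicator_leb:
  fixes f :: "real \<Rightarrow> real"
  assumes "integrable leb\<Omega> f" "A \<in> sets borel"
  shows "integrable leb\<Omega> (\<lambda>t. indicator A t * f t)"
  by (rule Linf_mult_integrable[OF indicator_Linf[OF assms(2)] assms(1)])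

lemma pair_leb: "pair_sigma_finite leb\<Omega> leb\<Omega>"
  using finite_measure_leb by (simp add: pair_sigma_finite_def finite_measure_def)

lemma prim_0 [simp]: "prim f 0 = 0"
  unfolding prim_def by (rule integral_eq_zero_AE) (auto simp: indicator_def)

lemma prim_1: "prim f 1 = (LINT t|leb\<Omega>. f t)"
  unfolding prim_def by (rule Bochner_Integration.integral_cong) (auto simp: indicator_def)

lemma prim_measurable:
  assumes "integrable leb\<Omega> f" shows "prim f \<in> borel_measurable leb\<Omega>"
proof -
  interpret pair_sigma_finite "leb\<Omega>" "leb\<Omega>" by (rule pair_leb)
  have [measurable]: "f \<in> borel_measurable leb\<Omega>" using assms by auto
  have [measurable]: "(\<lambda>x. x) \<in> borel_measurable leb\<Omega>" by (rule borel_imp_leb) simp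
  have "(\<lambda>(x,t). if t < x then f t else 0) \<in> borel_measurable (leb\<Omega> \<Otimes>\<^sub>M leb\<Omega>)"
    by measurable
  then have "(\<lambda>x. LINT t|leb\<Omega>. (if t < x then f t else 0)) \<in> borel_measurable leb\<Omega>"
    by (rule sigma_finite_measure.borel_measurable_lebesgue_integral[OF M1.sigma_finite_measure_axioms])
  also have "(\<lambda>x. LINT t|leb\<Omega>. (if t < x then f t else 0)) = prim f"
    unfolding prim_def by (intro ext Bochner_Integration.integral_cong) (auto simp: indicator_def)
  finally show ?thesis .
qed

lemma prim_bound:
  assumes "integrable leb\<Omega> f" shows "\<bar>prim f x\<bar> \<le> (LINT t|leb\<Omega>. \<bar>f t\<bar>)"
proof -
  have "\<bar>prim f x\<bar> \<le> (LINT t|leb\<Omega>. \<bar>indicator {..<x} t * f t\<bar>)"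
    unfolding prim_def by (rule integral_abs_bound)
  also have "\<dots> \<le> (LINT t|leb\<Omega>. \<bar>f t\<bar>)"
    using assms integrable_indicator_leb[OF assms, of "{..<x}"]
    by (intro integral_mono) (auto simp: indicator_def)
  finally show ?thesis .
qed

lemma prim_Linf: "integrable leb\<Omega> f \<Longrightarrow> prim f \<in> Linf"
  by (rule LinfI[OF prim_measurable]) (use prim_bound in auto)

text \<open>Integration by parts: both sides are the integral of \<open>f s * g t\<close> over the unit square,
  which the diagonal splits into two triangles.\<close>

lemma prim_parts:
  assumes f: "integrable leb\<Omega> f" and g: "integrable leb\<Omega> g"
  shows "(LINT t|leb\<Omega>. prim f t * g t + f t * prim g t) = (LINT t|leb\<Omega>. f t) * (LINT t|leb\<Omega>. g t)"
proof -
  interpret pair_sigma_finite "leb\<Omega>" "leb\<Omega>" by (rule pair_leb)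
  have [measurable]: "f \<in> borel_measurable leb\<Omega>" "g \<in> borel_measurable leb\<Omega>" using f g by auto
  have [measurable]: "(\<lambda>x. x) \<in> borel_measurable leb\<Omega>" by (rule borel_imp_leb) simp
  define k where "k = (\<lambda>s t. (if s < t then f s * g t else 0))"
  have km[measurable]: "case_prod k \<in> borel_measurable (leb\<Omega> \<Otimes>\<^sub>M leb\<Omega>)"
    unfolding k_def by measurable
  have k_eq: "k s t = f s * (indicator {s<..} t * g t)" for s t by (auto simp: k_def indicator_def)
  have k_eq': "k s t = g t * (indicator {..<t} s * f s)" for s t by (auto simp: k_def indicator_def)
  have int1: "integrable leb\<Omega> (\<lambda>t. k s t)" for s
    unfolding k_eq by (intro integrable_mult_right integrable_indicator_leb g) simp
  have "integrable (leb\<Omega> \<Otimes>\<^sub>M leb\<Omega>) (case_prod k)"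
  proof (rule Fubini_integrable)
    show "integrable leb\<Omega> (\<lambda>x. LINT y|leb\<Omega>. norm (case_prod k (x, y)))"
    proof (rule Bochner_Integration.integrable_bound)
      show "integrable leb\<Omega> (\<lambda>x. \<bar>f x\<bar> * (LINT y|leb\<Omega>. \<bar>g y\<bar>))" using f by simp
      show "(\<lambda>x. LINT y|leb\<Omega>. norm (case_prod k (x, y))) \<in> borel_measurable leb\<Omega>"
        by measurable
      show "AE x in leb\<Omega>. norm (LINT y|leb\<Omega>. norm (case_prod k (x, y)))
          \<le> norm (\<bar>f x\<bar> * (LINT y|leb\<Omega>. \<bar>g y\<bar>))"
      proof (rule AE_I2)
        fix x
        have "(LINT y|leb\<Omega>. \<bar>k x y\<bar>) \<le> (LINT y|leb\<Omega>. \<bar>f x\<bar> * \<bar>g y\<bar>)"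
          using int1[of x] g by (intro integral_mono) (auto simp: k_def abs_mult)
        then show "norm (LINT y|leb\<Omega>. norm (case_prod k (x, y)))
          \<le> norm (\<bar>f x\<bar> * (LINT y|leb\<Omega>. \<bar>g y\<bar>))"
          by (simp add: abs_mult)
      qed
    qed
    show "AE x in leb\<Omega>. integrable leb\<Omega> (\<lambda>y. case_prod k (x, y))"
      using int1 by simp
  qed (rule km)
  then have swap: "(LINT t|leb\<Omega>. LINT s|leb\<Omega>. k s t) = (LINT s|leb\<Omega>. LINT t|leb\<Omega>. k s t)"
    using integral_fst[of k] integral_snd[of k] by simp
  have "(LINT t|leb\<Omega>. LINT s|leb\<Omega>. k s t) = (LINT t|leb\<Omega>. prim f t * g t)"
    unfolding k_eq' prim_def by (simp add: mult.commute)
  moreover have "(LINT t|leb\<Omega>. k s t) = f s * ((LINT t|leb\<Omega>. g t) - prim g s)" for s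
  proof -
    have "(LINT t|leb\<Omega>. indicator {s<..} t * g t) = (LINT t|leb\<Omega>. g t - indicator {..<s} t * g t)"
    proof (rule integral_cong_AE)
      show "AE t in leb\<Omega>. indicator {s<..} t * g t = g t - indicator {..<s} t * g t"
        using AE_leb_neq[of s] by eventually_elim (auto simp: indicator_def)
    qed (use g integrable_indicator_leb[OF g] in auto)
    also have "\<dots> = (LINT t|leb\<Omega>. g t) - prim g s"
      unfolding prim_def using g integrable_indicator_leb[OF g, of "{..<s}"]
      by (intro Bochner_Integration.integral_diff) auto
    finally show ?thesis unfolding k_eq by simp
  qed
  ultimately have eq: "(LINT t|leb\<Omega>. prim f t * g t) = (LINT s|leb\<Omega>. f s * ((LINT t|leb\<Omega>. g t) - prim g s))"
    using swap by simp
  have i1: "integrable leb\<Omega> (\<lambda>t. prim f t * g t)" "integrable leb\<Omega> (\<lambda>t. f t * prim g t)"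
    using Linf_mult_integrable[OF prim_Linf[OF f] g] Linf_mult_integrable[OF prim_Linf[OF g] f]
    by (auto simp: mult.commute)
  have "(LINT s|leb\<Omega>. f s * ((LINT t|leb\<Omega>. g t) - prim g s))
      = (LINT s|leb\<Omega>. f s * (LINT t|leb\<Omega>. g t)) - (LINT s|leb\<Omega>. f s * prim g s)"
    unfolding right_diff_distrib using f i1 by (intro Bochner_Integration.integral_diff) auto
  also have "\<dots> = (LINT t|leb\<Omega>. f t) * (LINT t|leb\<Omega>. g t) - (LINT s|leb\<Omega>. f s * prim g s)"
    by simp
  finally show ?thesis unfolding Bochner_Integration.integral_add[OF i1] eq by linarith
qed

lemma prim_cong_AE:
  assumes "f \<in> borel_measurable leb\<Omega>" "AE t in leb\<Omega>. f t = g t"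
  shows "prim f x = prim g x"
proof -
  have [measurable]: "f \<in> borel_measurable leb\<Omega>" "g \<in> borel_measurable leb\<Omega>"
    by (rule assms(1)) (rule leb_measurable_AE[OF assms])
  have [measurable]: "indicat_real {..<x} \<in> borel_measurable leb\<Omega>" by (rule borel_imp_leb) simp
  show ?thesis unfolding prim_def
    by (rule integral_cong_AE) (use assms in \<open>auto elim: eventually_mono\<close>)
qed

lemma is_primitiveD: "is_primitive F f \<Longrightarrow> x \<in> {0..1} \<Longrightarrow> F x = F 0 + prim f x"
  unfolding is_primitive_def by blast

lemma is_primitive_integrable: "is_primitive F f \<Longrightarrow> integrable leb\<Omega> f"
  unfolding is_primitive_def by blast

lemma is_primitiveD_AE:
  assumes "is_primitive F f" shows "AE t in leb\<Omega>. F t = F 0 + prim f t"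
  by (intro AE_I2 is_primitiveD[OF assms]) auto

lemma is_primitive_Linf: assumes "is_primitive F f" shows "F \<in> Linf"
proof -
  have "(\<lambda>t. F 0 + prim f t) \<in> Linf"
    by (intro Linf_add Linf_const prim_Linf is_primitive_integrable[OF assms])
  then show ?thesis
    by (rule Linf_cong_AE) (use is_primitiveD_AE[OF assms] in \<open>auto elim: eventually_mono\<close>)
qed

text \<open>The product rule, from integration by parts for \<open>f\<close> and \<open>g\<close> cut off at \<open>x\<close>.\<close>

lemma is_primitive_mult:
  assumes F: "is_primitive F f" and G: "is_primitive G g"
  shows "is_primitive (\<lambda>x. F x * G x) (\<lambda>x. f x * G x + F x * g x)"
  unfolding is_primitive_def
proof (intro conjI ballI)
  note f = is_primitive_integrable[OF F] and g = is_primitive_integrable[OF G]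
  have i: "integrable leb\<Omega> (\<lambda>x. f x * G x)" "integrable leb\<Omega> (\<lambda>x. F x * g x)"
    using Linf_mult_integrable[OF is_primitive_Linf[OF G] f]
      Linf_mult_integrable[OF is_primitive_Linf[OF F] g] by (auto simp: mult.commute)
  then show "integrable leb\<Omega> (\<lambda>x. f x * G x + F x * g x)" by simp
  fix x :: real assume x: "x \<in> {0..1}"
  define f1 g1 where "f1 = (\<lambda>t. indicator {..<x} t * f t)" and "g1 = (\<lambda>t. indicator {..<x} t * g t)"
  have fg1: "integrable leb\<Omega> f1" "integrable leb\<Omega> g1"
    unfolding f1_def g1_def by (intro integrable_indicator_leb f g; simp)+
  have tr: "prim (\<lambda>t. indicator {..<x} t * h t) t = prim h t" if "t < x" for h t
    unfolding prim_def by (rule Bochner_Integration.integral_cong) (use that in \<open>auto simp: indicator_def\<close>)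
  have "prim (\<lambda>x. f x * G x + F x * g x) x
      = (LINT t|leb\<Omega>. (prim f1 t * g1 t + f1 t * prim g1 t) + (G 0 * f1 t + F 0 * g1 t))"
    unfolding prim_def[of "(\<lambda>x. f x * G x + F x * g x)"]
  proof (rule Bochner_Integration.integral_cong)
    fix t assume "t \<in> space leb\<Omega>"
    then have t: "t \<in> {0..1}" by simp
    note FG = is_primitiveD[OF F t] is_primitiveD[OF G t]
    show "indicator {..<x} t * (f t * G t + F t * g t) =
       (prim f1 t * g1 t + f1 t * prim g1 t) + (G 0 * f1 t + F 0 * g1 t)"
      unfolding FG using tr[of t f] tr[of t g]
      by (cases "t < x") (auto simp: f1_def g1_def algebra_simps)
  qed simp
  also have "\<dots> = (LINT t|leb\<Omega>. prim f1 t * g1 t + f1 t * prim g1 t) + (LINT t|leb\<Omega>. G 0 * f1 t + F 0 * g1 t)"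
    using fg1 Linf_mult_integrable[OF prim_Linf[OF fg1(1)] fg1(2)]
      Linf_mult_integrable[OF prim_Linf[OF fg1(2)] fg1(1)]
    by (intro Bochner_Integration.integral_add Bochner_Integration.integrable_add) (auto simp: mult.commute)
  also have "\<dots> = prim f x * prim g x + (G 0 * prim f x + F 0 * prim g x)"
  proof -
    have "(LINT t|leb\<Omega>. f1 t) = prim f x" "(LINT t|leb\<Omega>. g1 t) = prim g x"
      by (simp_all add: prim_def f1_def g1_def)
    then show ?thesis using fg1 by (simp add: prim_parts)
  qed
  finally show "F x * G x = F 0 * G 0 + prim (\<lambda>x. f x * G x + F x * g x) x"
    unfolding is_primitiveD[OF F x] is_primitiveD[OF G x] by (simp add: algebra_simps)
qed

section \<open>Test functions\<close>

text \<open>Infinite differentiability, in the form used by \<^const>\<open>test_functions\<close>.\<close>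

definition smooth :: "(real \<Rightarrow> real) \<Rightarrow> bool" where
  "smooth \<phi> \<longleftrightarrow> (\<forall>n x. (deriv ^^ n) \<phi> differentiable (at x))"

lemma smooth_deriv: "smooth \<phi> \<Longrightarrow> ((deriv ^^ n) \<phi> has_real_derivative (deriv ^^ Suc n) \<phi> x) (at x)"
  using DERIV_deriv_iff_real_differentiable[of "(deriv ^^ n) \<phi>" x] by (simp add: smooth_def)

lemma smooth_coinduct:
  assumes closed: "\<And>F. F \<in> S \<Longrightarrow> \<exists>G\<in>S. \<forall>x. (F has_real_derivative G x) (at x)" and "F \<in> S"
  shows "smooth F"
proof -
  have deriv_in: "deriv F \<in> S" if F: "F \<in> S" for F
  proof -
    obtain G where G: "G \<in> S" "\<forall>x. (F has_real_derivative G x) (at x)" using closed[OF F] by blast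
    have "deriv F = G" by (rule ext) (rule DERIV_imp_deriv, use G in blast)
    then show ?thesis using G by simp
  qed
  have "(deriv ^^ n) F \<in> S" for n
    by (induction n) (use deriv_in \<open>F \<in> S\<close> in auto)
  then have "\<exists>G. \<forall>x. ((deriv ^^ n) F has_real_derivative G x) (at x)" for n
    using closed by blast
  then show ?thesis unfolding smooth_def real_differentiable_def by blast
qed

lemma smooth_lincomb:
  assumes "smooth f" "smooth g" shows "smooth (\<lambda>x. f x + c * g x)"
proof (rule smooth_coinduct)
  let ?S = "range (\<lambda>n x. (deriv ^^ n) f x + c * (deriv ^^ n) g x)"
  show "(\<lambda>x. f x + c * g x) \<in> ?S" by (rule range_eqI[of _ _ 0]) simp
  fix F assume "F \<in> ?S"
  then obtain n where F: "F = (\<lambda>x. (deriv ^^ n) f x + c * (deriv ^^ n) g x)" by blast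
  have "(F has_real_derivative (deriv ^^ Suc n) f x + c * (deriv ^^ Suc n) g x) (at x)" for x
    unfolding F by (intro DERIV_add DERIV_cmult smooth_deriv assms)
  then show "\<exists>G\<in>?S. \<forall>x. (F has_real_derivative G x) (at x)"
    by (intro bexI[of _ "\<lambda>x. (deriv ^^ Suc n) f x + c * (deriv ^^ Suc n) g x"] allI rangeI) blast
qed

lemma smooth_antiderivative:
  assumes "smooth f" "\<And>x. (F has_real_derivative f x) (at x)" shows "smooth F"
proof (rule smooth_coinduct)
  let ?S = "insert F (range (\<lambda>n. (deriv ^^ n) f))"
  show "F \<in> ?S" by simp
  fix G assume "G \<in> ?S"
  then consider "G = F" | n where "G = (deriv ^^ n) f" by blast
  then show "\<exists>H\<in>?S. \<forall>x. (G has_real_derivative H x) (at x)"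
  proof cases
    case 1
    have "f \<in> ?S" using range_eqI[of f "\<lambda>n. (deriv ^^ n) f" 0] by simp
    then show ?thesis using 1 assms(2) by blast
  next
    case 2
    have "(deriv ^^ Suc n) f \<in> ?S" by blast
    then show ?thesis using 2 smooth_deriv[OF assms(1)] by blast
  qed
qed

text \<open>The functions \<open>y powr (-j) * exp (-1/y)\<close>, extended by \<open>0\<close> to \<open>y \<le> 0\<close>. All their
  derivatives vanish at \<open>0\<close>, and their linear span is closed under differentiation.\<close>

definition flat :: "nat \<Rightarrow> real \<Rightarrow> real" where
  "flat j y = (if 0 < y then (1 / y) ^ j * exp (- (1 / y)) else 0)"

lemma flat_tendsto_0: "((flat j) \<longlongrightarrow> 0) (at_right 0)"
proof -
  have "((\<lambda>y::real. inverse y ^ j / exp (inverse y)) \<longlongrightarrow> 0) (at_right 0)"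
    by (rule filterlim_compose[OF tendsto_power_div_exp_0 filterlim_inverse_at_top_right])
  then show ?thesis
  proof (rule Lim_transform_eventually)
    show "\<forall>\<^sub>F y in at_right 0. inverse y ^ j / exp (inverse y) = flat j y"
      unfolding eventually_at_filter by (auto simp: flat_def exp_minus field_simps)
  qed
qed

lemma flat_deriv: "(flat j has_real_derivative flat (j + 2) y - real j * flat (Suc j) y) (at y)"
proof -
  consider "y < 0" | "y = 0" | "0 < y" by linarith
  then show ?thesis
  proof cases
    case 1
    have "((\<lambda>y. 0) has_real_derivative 0) (at y)" by simp
    then have "(flat j has_real_derivative 0) (at y)"
      by (rule has_field_derivative_transform_within_open[of _ _ _ "{..<0}"])
        (use 1 in \<open>auto simp: flat_def\<close>)
    then show ?thesis using 1 by (simp add: flat_def)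
  next
    case 2
    have "((\<lambda>h. flat j h / h) \<longlongrightarrow> 0) (at 0)"
    proof (rule filterlim_split_at)
      have "\<forall>\<^sub>F h in at_left 0. 0 = flat j h / (h::real)"
        unfolding eventually_at_filter by (auto simp: flat_def)
      then show "((\<lambda>h. flat j h / h) \<longlongrightarrow> 0) (at_left 0)"
        by (rule Lim_transform_eventually[OF tendsto_const])
      have "\<forall>\<^sub>F h in at_right 0. flat (Suc j) h = flat j h / (h::real)"
        unfolding eventually_at_filter by (auto simp: flat_def)
      then show "((\<lambda>h. flat j h / h) \<longlongrightarrow> 0) (at_right 0)"
        by (rule Lim_transform_eventually[OF flat_tendsto_0])
    qed
    then show ?thesis using 2 by (simp add: DERIV_def flat_def)
  next
    case 3
    have i: "((\<lambda>y. 1 / y) has_real_derivative - ((1 / y) ^ 2)) (at y)"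
      using 3 by (auto intro!: derivative_eq_intros simp: power2_eq_square)
    have p: "((\<lambda>y. (1 / y) ^ j) has_real_derivative - (real j * (1 / y) ^ Suc j)) (at y)"
      by (rule DERIV_cong[OF DERIV_power[OF i]]) (cases j; simp add: power2_eq_square)
    have e: "((\<lambda>y. exp (- (1 / y))) has_real_derivative exp (- (1 / y)) * (1 / y) ^ 2) (at y)"
      by (rule DERIV_cong[OF DERIV_chain2[OF DERIV_exp DERIV_minus[OF i]]]) simp
    have "((\<lambda>y. (1 / y) ^ j * exp (- (1 / y))) has_real_derivative
        flat (j + 2) y - real j * flat (Suc j) y) (at y)"
      by (rule DERIV_cong[OF DERIV_mult[OF p e]])
        (use 3 in \<open>simp add: flat_def power2_eq_square algebra_simps\<close>)
    then show ?thesis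
      by (rule has_field_derivative_transform_within_open[of _ _ _ "{0<..}"])
        (use 3 in \<open>auto simp: flat_def\<close>)
  qed
qed

text \<open>For \<open>n > 0\<close>, a smooth function with values in \<open>[0, 1]\<close>, positive exactly on
  \<open>(s, t)\<close>; as \<open>n\<close> tends to infinity it tends to the indicator function of \<open>(s, t)\<close>.\<close>

definition bump :: "real \<Rightarrow> real \<Rightarrow> real \<Rightarrow> real \<Rightarrow> real" where
  "bump n s t x = flat 0 (n * (x - s)) * flat 0 (n * (t - x))"

text \<open>A space of functions containing \<^term>\<open>bump n s t\<close> and closed under differentiation.\<close>

inductive_set bump_span :: "real \<Rightarrow> real \<Rightarrow> real \<Rightarrow> (real \<Rightarrow> real) set" for n s t where
  base: "(\<lambda>x. flat j (n * (x - s)) * flat k (n * (t - x))) \<in> bump_span n s t"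
| lin: "f \<in> bump_span n s t \<Longrightarrow> g \<in> bump_span n s t \<Longrightarrow> (\<lambda>x. c * f x + d * g x) \<in> bump_span n s t"

lemma smooth_bump: "smooth (bump n s t)"
proof (rule smooth_coinduct)
  show "bump n s t \<in> bump_span n s t"
    unfolding bump_def[abs_def] by (rule bump_span.base)
  fix F assume "F \<in> bump_span n s t"
  then show "\<exists>G\<in>bump_span n s t. \<forall>x. (F has_real_derivative G x) (at x)"
  proof induction
    case (base j k)
    define E where "E = (\<lambda>j k x. flat j (n * (x - s)) * flat k (n * (t - x)))"
    have E: "E j k \<in> bump_span n s t" for j k unfolding E_def by (rule bump_span.base)
    define G where "G = (\<lambda>x. 1 * (n * E (j + 2) k x + (- n * real j) * E (Suc j) k x)
        + 1 * ((- n) * E j (k + 2) x + (n * real k) * E j (Suc k) x))"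
    have "G \<in> bump_span n s t" unfolding G_def by (intro bump_span.lin E)
    moreover have "(E j k has_real_derivative G x) (at x)" for x
    proof -
      have 1: "((\<lambda>x. flat j (n * (x - s))) has_real_derivative
          (flat (j + 2) (n * (x - s)) - real j * flat (Suc j) (n * (x - s))) * n) (at x)"
        by (rule DERIV_chain2[OF flat_deriv]) (auto intro!: derivative_eq_intros)
      have 2: "((\<lambda>x. flat k (n * (t - x))) has_real_derivative
          (flat (k + 2) (n * (t - x)) - real k * flat (Suc k) (n * (t - x))) * (- n)) (at x)"
        by (rule DERIV_chain2[OF flat_deriv]) (auto intro!: derivative_eq_intros)
      show ?thesis unfolding E_def G_def
        by (rule DERIV_cong[OF DERIV_mult[OF 1 2]]) (simp add: algebra_simps)
    qed
    ultimately show ?case unfolding E_def by blast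
  next
    case (lin f g c d)
    then obtain f' g' where "f' \<in> bump_span n s t" "g' \<in> bump_span n s t"
      "\<forall>x. (f has_real_derivative f' x) (at x)" "\<forall>x. (g has_real_derivative g' x) (at x)" by blast
    then show ?case
      by (intro bexI[of _ "\<lambda>x. c * f' x + d * g' x"] allI DERIV_add DERIV_cmult bump_span.lin) auto
  qed
qed

lemma flat_0_le: "0 \<le> flat 0 y" "flat 0 y \<le> 1"
  by (auto simp: flat_def)

lemma bump_bounds: "0 \<le> bump n s t x" "bump n s t x \<le> 1"
  unfolding bump_def by (auto simp: flat_0_le intro!: mult_le_one)

lemma bump_pos_iff: "0 < n \<Longrightarrow> 0 < bump n s t x \<longleftrightarrow> s < x \<and> x < t"
  by (auto simp: bump_def flat_def zero_less_mult_iff)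

lemma bump_eq_0: "0 < n \<Longrightarrow> \<not> (s < x \<and> x < t) \<Longrightarrow> bump n s t x = 0"
  using bump_pos_iff[of n s t x] bump_bounds(1)[of n s t x] by linarith

lemma flat_scaled_tendsto: "0 < y \<Longrightarrow> (\<lambda>n. flat 0 (real (Suc n) * y)) \<longlonglongrightarrow> 1"
proof -
  assume y: "0 < y"
  have "(\<lambda>n. exp (- (inverse (real (Suc n)) * (1 / y)))) \<longlonglongrightarrow> exp (- (0 * (1 / y)))"
    by (intro tendsto_intros LIMSEQ_inverse_real_of_nat)
  moreover have "flat 0 (real (Suc n) * y) = exp (- (inverse (real (Suc n)) * (1 / y)))" for n
  proof -
    have "0 < real (Suc n) * y" using y by simp
    then show ?thesis unfolding flat_def by (subst if_P) (simp_all add: divide_simps)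
  qed
  ultimately show ?thesis by simp
qed

lemma bump_tendsto: "(\<lambda>n. bump (real (Suc n)) s t x) \<longlonglongrightarrow> indicator {s<..<t} x"
proof (cases "s < x \<and> x < t")
  case True
  then have "(\<lambda>n. bump (real (Suc n)) s t x) \<longlonglongrightarrow> 1 * 1"
    unfolding bump_def by (intro tendsto_mult flat_scaled_tendsto) auto
  then show ?thesis using True by simp
next
  case False
  have "bump (real (Suc n)) s t x = 0" for n
    by (rule bump_eq_0[OF _ False]) simp
  moreover have "indicator {s<..<t} x = (0::real)" using False by simp
  ultimately show ?thesis by simp
qed

lemma test_functionsE:
  assumes "\<phi> \<in> test_functions"
  obtains s t where "0 < s" "s < t" "t < 1" "\<And>x. x \<notin> {s..t} \<Longrightarrow> \<phi> x = 0"
proof -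
  from assms obtain K where K: "compact K" "K \<subseteq> \<Omega>" "\<And>x. x \<notin> K \<Longrightarrow> \<phi> x = 0"
    by (auto simp: test_functions_def)
  show ?thesis
  proof (cases "K = {}")
    case True
    then show ?thesis using that[of "1/3" "2/3"] K by auto
  next
    case False
    obtain p where p: "p \<in> K" "\<And>x. x \<in> K \<Longrightarrow> p \<le> x" using compact_attains_inf[OF K(1) False] by blast
    obtain q where q: "q \<in> K" "\<And>x. x \<in> K \<Longrightarrow> x \<le> q" using compact_attains_sup[OF K(1) False] by blast
    show ?thesis
    proof (rule that[of "p / 2" "(q + 1) / 2"])
      show "\<phi> x = 0" if "x \<notin> {p / 2..(q + 1) / 2}" for x
      proof (rule K(3))
        show "x \<notin> K"
        proof
          assume x: "x \<in> K"
          then have "p \<le> x" "x \<le> q" "0 < x" "x < 1" "0 < p" "q < 1" using p q K(2) by auto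
          then show False using that by (auto simp: not_le)
        qed
      qed
    qed (use p q K(2) in force)+
  qed
qed

lemma test_functionsI:
  assumes "smooth \<phi>" "0 < s" "t < 1" "\<And>x. x \<notin> {s..t} \<Longrightarrow> \<phi> x = 0"
  shows "\<phi> \<in> test_functions"
proof -
  have "compact {s..t} \<and> {s..t} \<subseteq> \<Omega> \<and> (\<forall>x. x \<notin> {s..t} \<longrightarrow> \<phi> x = 0)"
    using assms by auto
  then show ?thesis using assms(1) unfolding test_functions_def smooth_def by blast
qed

lemma test_functions_smooth: "\<phi> \<in> test_functions \<Longrightarrow> smooth \<phi>"
  by (simp add: test_functions_def smooth_def)

lemma bump_test: "0 < n \<Longrightarrow> 0 < s \<Longrightarrow> t < 1 \<Longrightarrow> bump n s t \<in> test_functions"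
  by (rule test_functionsI[OF smooth_bump, of s t]) (auto intro!: bump_eq_0)

lemma test_functions_DERIV: "\<phi> \<in> test_functions \<Longrightarrow> (\<phi> has_real_derivative deriv \<phi> x) (at x)"
  using smooth_deriv[OF test_functions_smooth, of \<phi> 0 x] by simp

lemma test_functions_deriv_smooth: assumes "\<phi> \<in> test_functions" shows "smooth (deriv \<phi>)"
  unfolding smooth_def
proof (intro allI)
  fix n x
  have "(deriv ^^ Suc n) \<phi> differentiable at x"
    using test_functions_smooth[OF assms] unfolding smooth_def by blast
  then show "(deriv ^^ n) (deriv \<phi>) differentiable at x" by (simp add: funpow_swap1)
qed

lemma smooth_continuous: "smooth \<phi> \<Longrightarrow> continuous_on A \<phi>"
  using smooth_deriv[of \<phi> 0] by (intro DERIV_continuous_on[of A \<phi> "deriv \<phi>"])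
    (auto intro: has_field_derivative_at_within)

lemma test_functions_deriv: assumes "\<phi> \<in> test_functions" shows "deriv \<phi> \<in> test_functions"
proof -
  obtain s t where st: "0 < s" "s < t" "t < 1" "\<And>x. x \<notin> {s..t} \<Longrightarrow> \<phi> x = 0"
    using test_functionsE[OF assms] by blast
  show ?thesis
  proof (rule test_functionsI[OF test_functions_deriv_smooth[OF assms] st(1,3)])
    fix x assume x: "x \<notin> {s..t}"
    have "(\<phi> has_real_derivative 0) (at x)"
    proof (rule has_field_derivative_transform_within_open)
      show "((\<lambda>x. 0) has_real_derivative 0) (at x)" by simp
      show "open (- {s..t})" by auto
    qed (use x st in auto)
    then show "deriv \<phi> x = 0" by (rule DERIV_imp_deriv)
  qed
qed

lemma continuous_on_Linf: assumes "continuous_on UNIV f" shows "f \<in> Linf"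
proof -
  have "compact (f ` {0..1})"
    by (intro compact_continuous_image continuous_on_subset[OF assms]) auto
  then obtain C where "\<forall>x\<in>{0..1}. \<bar>f x\<bar> \<le> C"
    using compact_imp_bounded[of "f ` {0..1}"] by (auto simp: bounded_iff)
  then have C: "\<And>x. x \<in> {0..1} \<Longrightarrow> \<bar>f x\<bar> \<le> C" by blast
  show ?thesis
  proof (rule LinfI)
    show "f \<in> borel_measurable leb\<Omega>"
      by (intro borel_imp_leb borel_measurable_continuous_onI assms)
    show "AE x in leb\<Omega>. \<bar>f x\<bar> \<le> C" by (rule AE_I2) (use C in auto)
  qed
qed

lemma test_functions_Linf: "\<phi> \<in> test_functions \<Longrightarrow> \<phi> \<in> Linf"
  by (intro continuous_on_Linf smooth_continuous test_functions_smooth)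

section \<open>Primitives and weak derivatives\<close>

lemma prim_has_integral:
  assumes "integrable leb\<Omega> f" "x \<in> {0..1}" shows "(f has_integral prim f x) {0..x}"
proof -
  have "((\<lambda>t. indicator {..<x} t * f t) has_integral prim f x) \<Omega>"
    unfolding prim_def
    by (rule has_integral_integral_lebesgue_on[OF integrable_indicator_leb[OF assms(1)]]) auto
  also have "?this \<longleftrightarrow> ((\<lambda>t. if t \<in> {0<..<x} then f t else 0) has_integral prim f x) \<Omega>"
    by (rule has_integral_cong) (auto simp: indicator_def)
  finally have "(f has_integral prim f x) {0<..<x}"
    using assms(2) by (subst (asm) has_integral_restrict) auto
  then show ?thesis by (simp add: has_integral_Icc_iff_Ioo)
qed

lemma is_primitiveI:
  assumes "f \<in> Linf" "continuous_on {0..1} F" "finite S"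
    and "\<And>x. x \<in> \<Omega> - S \<Longrightarrow> (F has_real_derivative f x) (at x)"
  shows "is_primitive F f"
  unfolding is_primitive_def
proof (intro conjI ballI Linf_integrable assms(1))
  fix x :: real assume x: "x \<in> {0..1}"
  have "(f has_integral F x - F 0) {0..x}"
  proof (rule fundamental_theorem_of_calculus_interior_strong[OF assms(3)])
    show "continuous_on {0..x} F" using assms(2) by (rule continuous_on_subset) (use x in auto)
    show "(F has_vector_derivative f y) (at y)" if "y \<in> {0<..<x} - S" for y
      using assms(4)[of y] that x by (auto simp: has_real_derivative_iff_has_vector_derivative)
  qed (use x in auto)
  then show "F x = F 0 + prim f x"
    using has_integral_unique[OF prim_has_integral[OF Linf_integrable[OF assms(1)] x]] by fastforce
qed

lemma test_functions_primitive:
  assumes "\<phi> \<in> test_functions" shows "is_primitive \<phi> (deriv \<phi>)"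
proof (rule is_primitiveI)
  show "deriv \<phi> \<in> Linf" by (intro test_functions_Linf test_functions_deriv assms)
  show "continuous_on {0..1} \<phi>" by (intro smooth_continuous test_functions_smooth assms)
  show "finite {}" by simp
qed (rule test_functions_DERIV[OF assms])

lemma test_functions_ends: assumes "\<phi> \<in> test_functions" shows "\<phi> 0 = 0" "\<phi> 1 = 0"
  using test_functionsE[OF assms] by (metis atLeastAtMost_iff less_le_not_le)+

text \<open>At almost every point, the mean values of \<open>g\<close> over shrinking intervals tend to \<open>g\<close>.\<close>

lemma prim_eq_0_AE:
  assumes g: "integrable leb\<Omega> g" and 0: "\<And>x. x \<in> {0..1} \<Longrightarrow> prim g x = 0"
  shows "AE t in leb\<Omega>. g t = 0"
proof -
  define f where "f = (\<lambda>t. if t \<in> \<Omega> then g t else 0)"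
  have "integrable lebesgue f"
    unfolding f_def by (subst Lebesgue_Measure.integrable_restrict_UNIV) (use g in auto)
  then have "f absolutely_integrable_on UNIV" by (simp add: set_integrable_def)
  then have f_on: "f integrable_on cbox a b" for a b
    using absolutely_integrable_on_def integrable_on_subcbox set_lebesgue_integral_eq_integral(1) by blast
  obtain N where N: "negligible N" "\<And>x e. x \<notin> N \<Longrightarrow> 0 < e \<Longrightarrow> \<exists>d>0. \<forall>h. 0 < h \<and> h < d \<longrightarrow>
      norm (integral (cbox x (x + h *\<^sub>R One)) f /\<^sub>R h ^ DIM(real) - f x) < e"
    using integrable_ccontinuous_explicit[of f] f_on by blast
  have g0: "g x = 0" if x: "x \<in> \<Omega>" "x \<notin> N" for x
  proof (rule ccontr)
    assume "g x \<noteq> 0"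
    then obtain d where d: "d > 0" "\<And>h. 0 < h \<Longrightarrow> h < d \<Longrightarrow> \<bar>integral {x..x+h} f / h - f x\<bar> < \<bar>g x\<bar>"
      using N(2)[OF x(2), of "\<bar>g x\<bar>"] by (auto simp: field_simps)
    define h where "h = min (d / 2) (1 - x)"
    have h: "0 < h" "h < d" "x + h \<le> 1" using d x by (auto simp: h_def)
    have "(g has_integral 0) {0..x}" "(g has_integral 0) {0..x+h}"
      using prim_has_integral[OF g, of x] prim_has_integral[OF g, of "x+h"] 0[of x] 0[of "x+h"] h x by auto
    moreover have "integral {0..x} g + integral {x..x+h} g = integral {0..x+h} g"
      by (rule Henstock_Kurzweil_Integration.integral_combine) (use calculation h x in auto)
    ultimately have "integral {x..x+h} g = 0" by (auto dest!: integral_unique)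
    moreover have "integral {x..x+h} f = integral {x..x+h} g"
      by (rule integral_spike[of "{1}"]) (use h x in \<open>auto simp: f_def\<close>)
    ultimately show False using d(2)[OF h(1,2)] x by (simp add: f_def)
  qed
  have "AE t in lebesgue. t \<notin> N" using N(1) by (simp add: negligible_iff_null_sets AE_not_in)
  then show ?thesis
    by (subst AE_restrict_space_iff) (auto elim!: eventually_mono intro: g0)
qed

lemma integrable_locally:
  assumes "integrable leb\<Omega> v" shows "locally_integrable v"
  unfolding locally_integrable_def
proof (intro allI impI)
  fix K :: "real set" assume K: "compact K \<and> K \<subseteq> \<Omega>"
  then have K': "K \<in> sets borel" by (simp add: borel_compact)
  have "integrable lebesgue (\<lambda>x. indicator \<Omega> x *\<^sub>R (indicator K x * v x))"
    using integrable_indicator_leb[OF assms K'] by (subst (asm) integrable_restrict_space) auto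
  also have "(\<lambda>x. indicator \<Omega> x *\<^sub>R (indicator K x * v x)) = (\<lambda>x. indicator K x *\<^sub>R v x)"
    using K by (force simp: indicator_def)
  finally show "integrable (lebesgue_on K) v"
    using K' by (subst integrable_restrict_space) auto
qed

lemma locally_integrable_indicator:
  assumes "locally_integrable v" "0 < s" "t < 1"
  shows "integrable leb\<Omega> (\<lambda>x. indicator {s..t} x * v x)"
proof -
  have "{s..t} \<subseteq> \<Omega>" using assms by auto
  then have "integrable (lebesgue_on {s..t}) v" using assms by (simp add: locally_integrable_def)
  then show ?thesis
    using \<open>{s..t} \<subseteq> \<Omega>\<close>
    by (simp add: integrable_restrict_space indicator_inter_arith[symmetric] inf.absorb2 mult.assoc[symmetric])
qed

lemma locally_integrable_test:
  assumes "locally_integrable v" "\<phi> \<in> test_functions"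
  shows "integrable leb\<Omega> (\<lambda>x. v x * \<phi> x)"
proof -
  obtain s t where st: "0 < s" "s < t" "t < 1" "\<And>x. x \<notin> {s..t} \<Longrightarrow> \<phi> x = 0"
    using test_functionsE[OF assms(2)] by blast
  have "integrable leb\<Omega> (\<lambda>x. \<phi> x * (indicator {s..t} x * v x))"
    by (intro Linf_mult_integrable test_functions_Linf assms locally_integrable_indicator st)
  also have "(\<lambda>x. \<phi> x * (indicator {s..t} x * v x)) = (\<lambda>x. v x * \<phi> x)"
    using st(4) by (force simp: indicator_def)
  finally show ?thesis .
qed

text \<open>The fundamental lemma of the calculus of variations. Bumps converge boundedly to indicator
  functions of intervals, so all interval integrals of \<open>g\<close> vanish.\<close>

lemma test_functions_AE_0:
  assumes g: "locally_integrable g" and 0: "\<And>\<phi>. \<phi> \<in> test_functions \<Longrightarrow> (LINT x|leb\<Omega>. g x * \<phi> x) = 0"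
  shows "AE x in leb\<Omega>. g x = 0"
proof -
  have int0: "(LINT x|leb\<Omega>. indicator {s<..<t} x * g x) = 0" if st: "0 < s" "t < 1" for s t
  proof -
    have i: "integrable leb\<Omega> (\<lambda>x. indicator {s..t} x * g x)"
      by (rule locally_integrable_indicator[OF g st])
    have "(\<lambda>n. LINT x|leb\<Omega>. bump (real (Suc n)) s t x * (indicator {s..t} x * g x))
        \<longlonglongrightarrow> (LINT x|leb\<Omega>. indicator {s<..<t} x * (indicator {s..t} x * g x))"
    proof (rule integral_dominated_convergence)
      show "integrable leb\<Omega> (\<lambda>x. \<bar>indicator {s..t} x * g x\<bar>)" using i by simp
      show "(\<lambda>x. indicator {s<..<t} x * (indicator {s..t} x * g x)) \<in> borel_measurable leb\<Omega>"
        using integrable_indicator_leb[OF i, of "{s<..<t}"] by auto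
      show "(\<lambda>x. bump (real (Suc n)) s t x * (indicator {s..t} x * g x)) \<in> borel_measurable leb\<Omega>" for n
        using Linf_mult_integrable[OF test_functions_Linf[OF bump_test] i] st by auto
      show "AE x in leb\<Omega>. (\<lambda>n. bump (real (Suc n)) s t x * (indicator {s..t} x * g x))
          \<longlonglongrightarrow> indicator {s<..<t} x * (indicator {s..t} x * g x)"
        by (intro AE_I2 tendsto_mult bump_tendsto tendsto_const)
      show "AE x in leb\<Omega>. norm (bump (real (Suc n)) s t x * (indicator {s..t} x * g x))
          \<le> \<bar>indicator {s..t} x * g x\<bar>" for n
        by (rule AE_I2) (auto simp: abs_mult bump_bounds intro!: mult_left_le_one_le)
    qed
    moreover have "(LINT x|leb\<Omega>. bump (real (Suc n)) s t x * (indicator {s..t} x * g x)) = 0" for n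
    proof -
      have "(\<lambda>x. bump (real (Suc n)) s t x * (indicator {s..t} x * g x)) = (\<lambda>x. g x * bump (real (Suc n)) s t x)"
      proof (rule ext)
        fix x show "bump (real (Suc n)) s t x * (indicator {s..t} x * g x) = g x * bump (real (Suc n)) s t x"
        proof (cases "s < x \<and> x < t")
          case False
          have "bump (real (Suc n)) s t x = 0" by (rule bump_eq_0[OF _ False]) simp
          then show ?thesis by simp
        qed simp
      qed
      then show ?thesis using 0[OF bump_test[of "real (Suc n)" s t]] st by simp
    qed
    ultimately have "(LINT x|leb\<Omega>. indicator {s<..<t} x * (indicator {s..t} x * g x)) = 0"
      using LIMSEQ_unique[OF _ tendsto_const] by simp
    also have "(\<lambda>x. indicator {s<..<t} x * (indicator {s..t} x * g x)) = (\<lambda>x. indicator {s<..<t} x * g x)"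
      by (auto simp: indicator_def)
    finally show ?thesis .
  qed
  have "AE x in leb\<Omega>. indicator {1/real (Suc (Suc k))..1 - 1/real (Suc (Suc k))} x * g x = 0" for k
  proof (rule prim_eq_0_AE)
    let ?a = "1/real (Suc (Suc k))"
    have a: "0 < ?a" "1 - ?a < 1" by auto
    show "integrable leb\<Omega> (\<lambda>x. indicator {?a..1 - ?a} x * g x)"
      by (rule locally_integrable_indicator[OF g a])
    fix x :: real assume "x \<in> {0..1}"
    have "prim (\<lambda>x. indicator {?a..1 - ?a} x * g x) x = (LINT t|leb\<Omega>. indicator {?a<..<min x (1-?a)} t * g t)"
      unfolding prim_def
    proof (rule integral_cong_AE)
      show "(\<lambda>t. indicator {..<x} t * (indicator {?a..1 - ?a} t * g t)) \<in> borel_measurable leb\<Omega>"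
        using integrable_indicator_leb[OF locally_integrable_indicator[OF g a], of "{..<x}"] by auto
      have "(\<lambda>t. indicator {?a<..<min x (1 - ?a)} t * (indicator {?a..1 - ?a} t * g t)) \<in> borel_measurable leb\<Omega>"
        using integrable_indicator_leb[OF locally_integrable_indicator[OF g a], of "{?a<..<min x (1-?a)}"] by auto
      also have "(\<lambda>t. indicator {?a<..<min x (1 - ?a)} t * (indicator {?a..1 - ?a} t * g t))
          = (\<lambda>t. indicator {?a<..<min x (1 - ?a)} t * g t)"
        by (auto simp: indicator_def)
      finally show "(\<lambda>t. indicator {?a<..<min x (1 - ?a)} t * g t) \<in> borel_measurable leb\<Omega>" .
      show "AE t in leb\<Omega>. indicator {..<x} t * (indicator {?a..1 - ?a} t * g t)
          = indicator {?a<..<min x (1 - ?a)} t * g t"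
        using AE_leb_neq[of ?a] AE_leb_neq[of "1 - ?a"] by eventually_elim (auto simp: indicator_def)
    qed
    also have "\<dots> = 0" by (rule int0[OF a(1) min.strict_coboundedI2[OF a(2)]])
    finally show "prim (\<lambda>x. indicator {?a..1 - ?a} x * g x) x = 0" .
  qed
  then have "AE x in leb\<Omega>. \<forall>k. indicator {1/real (Suc (Suc k))..1 - 1/real (Suc (Suc k))} x * g x = 0"
    unfolding AE_all_countable by blast
  with AE_leb_in show ?thesis
  proof eventually_elim
    case (elim x)
    then obtain k where k: "inverse (real (Suc k)) < min x (1 - x)"
      using reals_Archimedean[of "min x (1 - x)"] by auto
    have "1 / real (Suc (Suc k)) \<le> inverse (real (Suc k))" by (simp add: field_simps)
    then have "x \<in> {1/real (Suc (Suc k))..1 - 1/real (Suc (Suc k))}" using k by auto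
    then show "g x = 0" using elim(2)[rule_format, of k] by simp
  qed
qed

lemma locally_integrable_iff:
  "locally_integrable v \<longleftrightarrow> (\<forall>K. compact K \<and> K \<subseteq> \<Omega> \<longrightarrow> integrable leb\<Omega> (\<lambda>x. indicator K x * v x))"
proof -
  have "integrable (lebesgue_on K) v \<longleftrightarrow> integrable leb\<Omega> (\<lambda>x. indicator K x * v x)"
    if "compact K" "K \<subseteq> \<Omega>" for K
  proof -
    have [simp]: "K \<in> sets borel" using that by (simp add: borel_compact)
    have eq: "(\<lambda>x. indicator K x *\<^sub>R v x) = (\<lambda>x. indicator \<Omega> x *\<^sub>R (indicator K x * v x))"
      using that by (force simp: indicator_def)
    have "integrable (lebesgue_on K) v \<longleftrightarrow> integrable lebesgue (\<lambda>x. indicator K x *\<^sub>R v x)"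
      by (rule integrable_restrict_space) simp
    also have "\<dots> \<longleftrightarrow> integrable leb\<Omega> (\<lambda>x. indicator K x * v x)"
      unfolding eq by (rule integrable_restrict_space[symmetric]) simp
    finally show ?thesis .
  qed
  then show ?thesis unfolding locally_integrable_def by blast
qed

lemma locally_integrable_cong_AE:
  assumes "locally_integrable v" "AE x in leb\<Omega>. v x = w x" shows "locally_integrable w"
  unfolding locally_integrable_iff
proof (intro allI impI)
  fix K :: "real set" assume K: "compact K \<and> K \<subseteq> \<Omega>"
  have v: "integrable leb\<Omega> (\<lambda>x. indicator K x * v x)"
    using assms(1) K unfolding locally_integrable_iff by blast
  have ae: "AE x in leb\<Omega>. indicator K x * v x = indicator K x * w x"
    using assms(2) by eventually_elim simp
  show "integrable leb\<Omega> (\<lambda>x. indicator K x * w x)"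
    by (rule integrable_cong_AE_imp[OF v leb_measurable_AE[OF borel_measurable_integrable[OF v] ae]])
      (use ae in \<open>auto elim: eventually_mono\<close>)
qed

lemma locally_integrable_diff:
  "locally_integrable v \<Longrightarrow> locally_integrable w \<Longrightarrow> locally_integrable (\<lambda>x. v x - w x)"
  unfolding locally_integrable_def by auto

lemma integral_cong_AE_leb:
  assumes "f \<in> borel_measurable leb\<Omega>" "AE x in leb\<Omega>. f x = g x"
  shows "(LINT x|leb\<Omega>. f x) = (LINT x|leb\<Omega>. (g x :: real))"
  by (rule integral_cong_AE[OF assms(1) leb_measurable_AE[OF assms] assms(2)])

lemma has_weak_deriv_test_integrable:
  assumes "has_weak_deriv v g" "\<phi> \<in> test_functions"
  shows "integrable leb\<Omega> (\<lambda>x. v x * deriv \<phi> x)" "integrable leb\<Omega> (\<lambda>x. g x * \<phi> x)"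
  using assms by (auto simp: has_weak_deriv_def intro: locally_integrable_test test_functions_deriv)

lemma has_weak_derivD:
  "has_weak_deriv v g \<Longrightarrow> \<phi> \<in> test_functions \<Longrightarrow>
    (LINT x|leb\<Omega>. v x * deriv \<phi> x) = - (LINT x|leb\<Omega>. g x * \<phi> x)"
  by (simp add: has_weak_deriv_def)

lemma has_weak_deriv_cong_AE:
  assumes h: "has_weak_deriv v g" and v: "AE x in leb\<Omega>. v x = w x" and g: "AE x in leb\<Omega>. g x = k x"
  shows "has_weak_deriv w k"
  unfolding has_weak_deriv_def
proof (intro conjI ballI)
  show "locally_integrable w" "locally_integrable k"
    using h v g locally_integrable_cong_AE unfolding has_weak_deriv_def by blast+
  fix \<phi> assume \<phi>: "\<phi> \<in> test_functions"
  note i = has_weak_deriv_test_integrable[OF h \<phi>]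
  have "(LINT x|leb\<Omega>. v x * deriv \<phi> x) = (LINT x|leb\<Omega>. w x * deriv \<phi> x)"
    by (rule integral_cong_AE_leb) (use i v in \<open>auto elim: eventually_mono\<close>)
  moreover have "(LINT x|leb\<Omega>. g x * \<phi> x) = (LINT x|leb\<Omega>. k x * \<phi> x)"
    by (rule integral_cong_AE_leb) (use i g in \<open>auto elim: eventually_mono\<close>)
  ultimately show "(LINT x|leb\<Omega>. w x * deriv \<phi> x) = - (LINT x|leb\<Omega>. k x * \<phi> x)"
    using has_weak_derivD[OF h \<phi>] by simp
qed

lemma has_weak_deriv_diff:
  assumes v: "has_weak_deriv v g" and w: "has_weak_deriv w k"
  shows "has_weak_deriv (\<lambda>x. v x - w x) (\<lambda>x. g x - k x)"
  unfolding has_weak_deriv_def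
proof (intro conjI ballI)
  show "locally_integrable (\<lambda>x. v x - w x)" "locally_integrable (\<lambda>x. g x - k x)"
    using v w locally_integrable_diff unfolding has_weak_deriv_def by blast+
  fix \<phi> assume \<phi>: "\<phi> \<in> test_functions"
  note i = has_weak_deriv_test_integrable[OF v \<phi>] has_weak_deriv_test_integrable[OF w \<phi>]
  show "(LINT x|leb\<Omega>. (v x - w x) * deriv \<phi> x) = - (LINT x|leb\<Omega>. (g x - k x) * \<phi> x)"
    using i has_weak_derivD[OF v \<phi>] has_weak_derivD[OF w \<phi>] by (simp add: left_diff_distrib)
qed

lemma has_weak_deriv_unique:
  assumes "has_weak_deriv v g" "has_weak_deriv v k" shows "AE x in leb\<Omega>. g x = k x"
proof -
  have d: "has_weak_deriv (\<lambda>x. v x - v x) (\<lambda>x. g x - k x)" by (rule has_weak_deriv_diff[OF assms])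
  have "AE x in leb\<Omega>. g x - k x = 0"
  proof (rule test_functions_AE_0)
    show "locally_integrable (\<lambda>x. g x - k x)" using d unfolding has_weak_deriv_def by blast
    show "(LINT x|leb\<Omega>. (g x - k x) * \<phi> x) = 0" if "\<phi> \<in> test_functions" for \<phi>
      using has_weak_derivD[OF d that] by simp
  qed
  then show ?thesis by eventually_elim simp
qed

lemma has_weak_deriv_wderiv: "has_weak_deriv v g \<Longrightarrow> has_weak_deriv v (wderiv v)"
  unfolding wderiv_def by (rule someI[of "has_weak_deriv v"])

lemma wderiv_AE: "has_weak_deriv v g \<Longrightarrow> AE x in leb\<Omega>. wderiv v x = g x"
  using has_weak_deriv_unique has_weak_deriv_wderiv by blast

lemma has_weak_deriv_primitive:
  assumes F: "is_primitive F f" shows "has_weak_deriv F f"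
  unfolding has_weak_deriv_def
proof (intro conjI ballI)
  show "locally_integrable F" "locally_integrable f"
    by (intro integrable_locally Linf_integrable is_primitive_Linf[OF F] is_primitive_integrable[OF F])+
  fix \<phi> assume \<phi>: "\<phi> \<in> test_functions"
  have i: "integrable leb\<Omega> (\<lambda>x. f x * \<phi> x)" "integrable leb\<Omega> (\<lambda>x. F x * deriv \<phi> x)"
    using \<open>locally_integrable F\<close> \<open>locally_integrable f\<close> \<phi>
    by (auto intro: locally_integrable_test test_functions_deriv)
  have "F 1 * \<phi> 1 = F 0 * \<phi> 0 + prim (\<lambda>x. f x * \<phi> x + F x * deriv \<phi> x) 1"
    by (rule is_primitiveD[OF is_primitive_mult[OF F test_functions_primitive[OF \<phi>]]]) simp
  then show "(LINT x|leb\<Omega>. F x * deriv \<phi> x) = - (LINT x|leb\<Omega>. f x * \<phi> x)"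
    using i by (simp add: test_functions_ends[OF \<phi>] prim_1)
qed

text \<open>The lemma of du Bois-Reymond. For a test function \<open>\<psi>\<close>, subtracting the multiple of a fixed bump
  \<open>\<eta>\<close> with the same integral gives a function whose antiderivative is again a test function.\<close>

lemma weak_deriv_0_const:
  assumes v: "has_weak_deriv v (\<lambda>x. 0)" and iv: "integrable leb\<Omega> v"
  shows "\<exists>k. AE x in leb\<Omega>. v x = k"
proof -
  define \<eta> where "\<eta> = bump 1 (1/3) (2/3)"
  have \<eta>: "\<eta> \<in> test_functions" unfolding \<eta>_def by (rule bump_test) auto
  define m where "m = (LINT x|leb\<Omega>. \<eta> x)"
  have "m \<noteq> 0"
  proof
    assume "m = 0"
    then have "AE x in leb\<Omega>. \<eta> x = 0"
      unfolding m_def \<eta>_def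
      by (subst (asm) integral_nonneg_eq_0_iff_AE)
        (use Linf_integrable[OF test_functions_Linf[OF \<eta>]] in \<open>auto simp: \<eta>_def bump_bounds\<close>)
    then have "AE x in leb\<Omega>. x \<notin> {1/3<..<2/3}"
    proof eventually_elim
      case (elim x)
      then show ?case using bump_pos_iff[of 1 "1/3" "2/3" x] by (auto simp: \<eta>_def)
    qed
    then have "AE x in leb\<Omega>. indicator {1/3<..<2/3} x = (0::real)"
      by eventually_elim simp
    then have "(LINT x|leb\<Omega>. indicator {1/3<..<2/3} x) = (0::real)"
      by (rule integral_eq_zero_AE)
    moreover have "measure leb\<Omega> {1/3<..<2/3::real} = 1/3"
      by (subst measure_restrict_space) auto
    ultimately show False by simp
  qed
  define k where "k = (LINT x|leb\<Omega>. v x * \<eta> x) / m"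
  have lv: "locally_integrable v" by (rule integrable_locally[OF iv])
  have "AE x in leb\<Omega>. v x - k = 0"
  proof (rule test_functions_AE_0)
    show "locally_integrable (\<lambda>x. v x - k)"
      by (intro integrable_locally Bochner_Integration.integrable_diff iv Linf_integrable) simp
    fix \<psi> assume \<psi>: "\<psi> \<in> test_functions"
    define c where "c = (LINT x|leb\<Omega>. \<psi> x) / m"
    define \<xi> where "\<xi> = (\<lambda>x. \<psi> x + (- c) * \<eta> x)"
    have sm: "smooth \<xi>" unfolding \<xi>_def
      by (rule smooth_lincomb[OF test_functions_smooth[OF \<psi>] test_functions_smooth[OF \<eta>]])
    obtain \<Phi> where \<Phi>: "\<And>x. (\<Phi> has_real_derivative \<xi> x) (at x)"
      using einterval_antiderivative[of "-\<infinity>" "\<infinity>" \<xi>] smooth_continuous[OF sm, of UNIV]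
      by (auto simp: has_real_derivative_iff_has_vector_derivative continuous_on_eq_continuous_at)
    define \<phi> where "\<phi> = (\<lambda>x. \<Phi> x - \<Phi> 0)"
    have D: "(\<phi> has_real_derivative \<xi> x) (at x)" for x
      unfolding \<phi>_def using DERIV_diff[OF \<Phi>[of x] DERIV_const[of "\<Phi> 0"]] by simp
    have dphi: "deriv \<phi> = \<xi>" by (rule ext) (rule DERIV_imp_deriv[OF D])
    obtain s1 t1 where st1: "0 < s1" "s1 < t1" "t1 < 1" "\<And>x. x \<notin> {s1..t1} \<Longrightarrow> \<psi> x = 0"
      using test_functionsE[OF \<psi>] by blast
    obtain s2 t2 where st2: "0 < s2" "s2 < t2" "t2 < 1" "\<And>x. x \<notin> {s2..t2} \<Longrightarrow> \<eta> x = 0"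
      using test_functionsE[OF \<eta>] by blast
    define s t where "s = min s1 s2" and "t = max t1 t2"
    have st: "0 < s" "s < t" "t < 1" using st1 st2 by (auto simp: s_def t_def)
    have \<xi>0: "\<xi> x = 0" if "x \<notin> {s..t}" for x
    proof -
      have "x \<notin> {s1..t1}" "x \<notin> {s2..t2}"
        using that by (auto simp: s_def t_def min_le_iff_disj le_max_iff_disj)
      then show ?thesis using st1(4) st2(4) by (simp add: \<xi>_def)
    qed
    have \<xi>L: "\<xi> \<in> Linf" by (intro continuous_on_Linf smooth_continuous sm)
    have cont: "continuous_on T \<phi>" for T
      by (rule DERIV_continuous_on[of _ _ \<xi>]) (rule has_field_derivative_at_within[OF D])
    have prim: "is_primitive \<phi> \<xi>"
      by (rule is_primitiveI[OF \<xi>L cont finite.emptyI D])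
    have i: "integrable leb\<Omega> \<psi>" "integrable leb\<Omega> \<eta>"
      using Linf_integrable test_functions_Linf \<psi> \<eta> by blast+
    have "\<phi> 1 = (LINT x|leb\<Omega>. \<xi> x)"
      using is_primitiveD[OF prim, of 1] by (simp add: prim_1 \<phi>_def)
    also have "\<dots> = (LINT x|leb\<Omega>. \<psi> x) - c * m" unfolding \<xi>_def m_def using i by simp
    also have "\<dots> = 0" using \<open>m \<noteq> 0\<close> by (simp add: c_def)
    finally have \<phi>1: "\<phi> 1 = 0" .
    have "\<phi> \<in> test_functions"
    proof (rule test_functionsI[OF _ st(1,3)])
      show "smooth \<phi>" by (rule smooth_antiderivative[OF sm D])
      fix x assume "x \<notin> {s..t}"
      then consider "x < s" | "t < x" by fastforce
      then show "\<phi> x = 0"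
      proof cases
        case 1
        have "\<phi> x = \<phi> 0"
        proof (rule DERIV_isconst3[where f = \<phi> and x = x and y = 0 and a = "min x 0 - 1" and b = s])
          show "min x 0 - 1 < s" "x \<in> {min x 0 - 1<..<s}" "0 \<in> {min x 0 - 1<..<s}"
            using 1 st by auto
          fix y assume "y \<in> {min x 0 - 1<..<s}"
          then show "(\<phi> has_real_derivative 0) (at y)" using D[of y] \<xi>0[of y] by simp
        qed
        then show ?thesis by (simp add: \<phi>_def)
      next
        case 2
        have "\<phi> x = \<phi> 1"
        proof (rule DERIV_isconst3[where f = \<phi> and x = x and y = 1 and a = t and b = "max x 1 + 1"])
          show "t < max x 1 + 1" "x \<in> {t<..<max x 1 + 1}" "1 \<in> {t<..<max x 1 + 1}"
            using 2 st by auto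
          fix y assume "y \<in> {t<..<max x 1 + 1}"
          then show "(\<phi> has_real_derivative 0) (at y)" using D[of y] \<xi>0[of y] by simp
        qed
        then show ?thesis using \<phi>1 by simp
      qed
    qed
    then have "(LINT x|leb\<Omega>. v x * \<xi> x) = 0"
      using has_weak_derivD[OF v, of \<phi>] by (simp add: dphi)
    moreover have iv': "integrable leb\<Omega> (\<lambda>x. v x * \<psi> x)" "integrable leb\<Omega> (\<lambda>x. v x * \<eta> x)"
      by (intro locally_integrable_test lv \<psi> \<eta>)+
    then have "(LINT x|leb\<Omega>. v x * \<xi> x) = (LINT x|leb\<Omega>. v x * \<psi> x) - c * (LINT x|leb\<Omega>. v x * \<eta> x)"
      unfolding \<xi>_def by (simp add: right_diff_distrib mult.left_commute)
    moreover have "c * (LINT x|leb\<Omega>. v x * \<eta> x) = k * (LINT x|leb\<Omega>. \<psi> x)"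
      by (simp add: c_def k_def)
    ultimately show "(LINT x|leb\<Omega>. (v x - k) * \<psi> x) = 0"
      using iv' i by (simp add: left_diff_distrib)
  qed
  then show ?thesis by (intro exI[of _ k]) (auto elim: eventually_mono)
qed

lemma is_primitive_prim: "integrable leb\<Omega> g \<Longrightarrow> is_primitive (\<lambda>x. k + prim g x) g"
  by (simp add: is_primitive_def)

text \<open>The lemma of du Bois-Reymond applies to the difference of \<open>v\<close> and the indefinite integral of \<open>g\<close>.\<close>

lemma weak_deriv_primitive:
  assumes v: "has_weak_deriv v g" and "integrable leb\<Omega> v" "integrable leb\<Omega> g"
  obtains F where "is_primitive F g" "AE x in leb\<Omega>. v x = F x"
proof -
  have p: "has_weak_deriv (\<lambda>x. 0 + prim g x) g"
    by (intro has_weak_deriv_primitive is_primitive_prim assms)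
  have "has_weak_deriv (\<lambda>x. v x - (0 + prim g x)) (\<lambda>x. 0)"
    using has_weak_deriv_diff[OF v p] by simp
  then obtain k where k: "AE x in leb\<Omega>. v x - (0 + prim g x) = k"
    using weak_deriv_0_const assms Linf_integrable[OF prim_Linf[OF assms(3)]] by force
  have "AE x in leb\<Omega>. v x = k + prim g x" using k by eventually_elim simp
  then show ?thesis using that is_primitive_prim[OF assms(3)] by blast
qed

section \<open>Sobolev spaces\<close>

lemma Lp2_iff: "v \<in> Lp 2 \<longleftrightarrow> v \<in> borel_measurable leb\<Omega> \<and> integrable leb\<Omega> (\<lambda>x. (v x)\<^sup>2)"
  by (simp add: Lp_def powr_numeral)

lemma Lp2_norm: "Lp_norm 2 v = sqrt (LINT x|leb\<Omega>. (v x)\<^sup>2)"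
  by (simp add: Lp_norm_def powr_numeral powr_half_sqrt)

lemma Lp2_integrable: assumes "v \<in> Lp 2" shows "integrable leb\<Omega> v"
proof (rule Bochner_Integration.integrable_bound)
  show "integrable leb\<Omega> (\<lambda>x. 1 + (v x)\<^sup>2)"
    using assms Linf_integrable[OF Linf_const[of 1]] by (intro Bochner_Integration.integrable_add) (auto simp: Lp2_iff)
  show "v \<in> borel_measurable leb\<Omega>" using assms by (simp add: Lp2_iff)
  have "\<bar>y\<bar> \<le> 1 + y\<^sup>2" for y :: real
    using zero_le_power2[of "\<bar>y\<bar> - 1"] zero_le_power2[of y] by (simp add: power2_diff)
  then show "AE x in leb\<Omega>. norm (v x) \<le> norm (1 + (v x)\<^sup>2)"
    by (intro AE_I2) (simp add: abs_of_nonneg)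
qed

lemma Linf_Lp2: "v \<in> Linf \<Longrightarrow> v \<in> Lp 2"
  using Linf_integrable[OF Linf_mult[of v v]] by (auto simp: Lp2_iff power2_eq_square)

lemma integral_abs_le_Lp2:
  assumes "v \<in> Lp 2" shows "(LINT x|leb\<Omega>. \<bar>v x\<bar>) \<le> sqrt (LINT x|leb\<Omega>. (v x)\<^sup>2)"
proof (rule real_le_rsqrt)
  let ?m = "LINT x|leb\<Omega>. \<bar>v x\<bar>"
  have i: "integrable leb\<Omega> (\<lambda>x. \<bar>v x\<bar>)" using Lp2_integrable[OF assms] by simp
  have i2: "integrable leb\<Omega> (\<lambda>x. (v x)\<^sup>2)" using assms by (simp add: Lp2_iff)
  have i3: "integrable leb\<Omega> (\<lambda>x. ?m\<^sup>2)" by (rule Linf_integrable[OF Linf_const])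
  have "0 \<le> (LINT x|leb\<Omega>. (\<bar>v x\<bar> - ?m)\<^sup>2)" by (rule integral_nonneg_AE) simp
  also have "(\<lambda>x. (\<bar>v x\<bar> - ?m)\<^sup>2) = (\<lambda>x. (v x)\<^sup>2 + ?m\<^sup>2 - (2 * ?m) * \<bar>v x\<bar>)"
    by (rule ext) (simp add: power2_diff)
  also have "(LINT x|leb\<Omega>. (v x)\<^sup>2 + ?m\<^sup>2 - (2 * ?m) * \<bar>v x\<bar>)
      = (LINT x|leb\<Omega>. (v x)\<^sup>2) + ?m\<^sup>2 - (2 * ?m) * ?m"
    using i i2 i3 by simp
  finally show "?m\<^sup>2 \<le> (LINT x|leb\<Omega>. (v x)\<^sup>2)" by (simp add: power2_eq_square)
qed

lemma Lp2_cong_AE: assumes "v \<in> Lp 2" "AE x in leb\<Omega>. v x = w x" shows "w \<in> Lp 2"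
proof -
  have m: "v \<in> borel_measurable leb\<Omega>" and i: "integrable leb\<Omega> (\<lambda>x. (v x)\<^sup>2)"
    using assms(1) by (auto simp: Lp2_iff)
  have w: "w \<in> borel_measurable leb\<Omega>" by (rule leb_measurable_AE[OF m assms(2)])
  moreover have "integrable leb\<Omega> (\<lambda>x. (w x)\<^sup>2)"
    by (rule integrable_cong_AE_imp[OF i]) (use w assms(2) in \<open>auto elim: eventually_mono\<close>)
  ultimately show ?thesis by (simp add: Lp2_iff)
qed

lemma H1_weak:
  assumes "v \<in> H1" shows "has_weak_deriv v (wderiv v)" "wderiv v \<in> Lp 2"
proof -
  obtain g where g: "g \<in> Lp 2" "has_weak_deriv v g" using assms by (auto simp: H1_def)
  show "has_weak_deriv v (wderiv v)" by (rule has_weak_deriv_wderiv[OF g(2)])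
  have "AE x in leb\<Omega>. g x = wderiv v x" using wderiv_AE[OF g(2)] by eventually_elim simp
  then show "wderiv v \<in> Lp 2" by (rule Lp2_cong_AE[OF g(1)])
qed

lemma H1_primitive:
  assumes "v \<in> H1"
  obtains F where "is_primitive F (wderiv v)" "AE x in leb\<Omega>. v x = F x"
  using weak_deriv_primitive[OF H1_weak(1)[OF assms]] Lp2_integrable H1_weak(2)[OF assms] assms
  by (auto simp: H1_def)

lemma AE_leb_sym: "AE x in leb\<Omega>. v x = w x \<Longrightarrow> AE x in leb\<Omega>. w x = v x"
  by (auto elim: eventually_mono)

lemma H1_Linf: assumes "v \<in> H1" shows "v \<in> Linf"
  by (rule H1_primitive[OF assms]) (use Linf_cong_AE is_primitive_Linf AE_leb_sym in blast)

lemma W1inf_weak: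
  assumes "v \<in> W1inf" shows "has_weak_deriv v (wderiv v)" "wderiv v \<in> Linf"
proof -
  obtain g where g: "g \<in> Linf" "has_weak_deriv v g" using assms by (auto simp: W1inf_def)
  show "has_weak_deriv v (wderiv v)" by (rule has_weak_deriv_wderiv[OF g(2)])
  show "wderiv v \<in> Linf" by (rule Linf_cong_AE[OF g(1) AE_leb_sym[OF wderiv_AE[OF g(2)]]])
qed

lemma W1inf_primitive:
  assumes "v \<in> W1inf"
  obtains F where "is_primitive F (wderiv v)" "AE x in leb\<Omega>. v x = F x"
  using weak_deriv_primitive[OF W1inf_weak(1)[OF assms]] Linf_integrable W1inf_weak(2)[OF assms] assms
  by (auto simp: W1inf_def)

lemma test_functions_weak: "\<phi> \<in> test_functions \<Longrightarrow> has_weak_deriv \<phi> (deriv \<phi>)"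
  by (intro has_weak_deriv_primitive test_functions_primitive)

lemma test_functions_H1_0: assumes \<phi>: "\<phi> \<in> test_functions" shows "\<phi> \<in> H1_0"
proof -
  have "has_weak_deriv (\<lambda>x. \<phi> x - \<phi> x) (\<lambda>x. 0)"
    using has_weak_deriv_diff[OF test_functions_weak[OF \<phi>] test_functions_weak[OF \<phi>]] by simp
  then have "AE x in leb\<Omega>. (wderiv (\<lambda>x. \<phi> x - \<phi> x) x)\<^sup>2 = 0"
    by (rule eventually_mono[OF wderiv_AE]) simp
  then have "H1_norm (\<lambda>x. \<phi> x - \<phi> x) = 0"
    unfolding H1_norm_def Lp2_norm by (simp add: integral_eq_zero_AE)
  moreover have "\<phi> \<in> H1" unfolding H1_def
    using test_functions_weak[OF \<phi>] Linf_Lp2 test_functions_Linf test_functions_deriv \<phi> by blast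
  ultimately show ?thesis unfolding H1_0_def using \<phi> by (auto intro!: exI[of _ "\<lambda>n. \<phi>"])
qed

text \<open>An integral identity that holds for all test functions passes to the limit in \<^const>\<open>H1_norm\<close>.\<close>

lemma H1_0_test_approx:
  assumes u: "u \<in> H1_0" and L: "\<And>\<phi>. \<phi> \<in> test_functions \<Longrightarrow>
     (LINT x|leb\<Omega>. p x * deriv \<phi> x + q x * \<phi> x) = 0"
    and p: "p \<in> Linf" and q: "q \<in> Linf"
  shows "(LINT x|leb\<Omega>. p x * wderiv u x + q x * u x) = 0"
proof -
  from u have uH: "u \<in> H1" by (simp add: H1_0_def)
  from u obtain \<phi> where \<phi>: "\<And>n. \<phi> n \<in> test_functions"
    and lim: "(\<lambda>n. H1_norm (\<lambda>x. u x - \<phi> n x)) \<longlonglongrightarrow> 0"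
    by (auto simp: H1_0_def)
  obtain C where C: "0 \<le> C" "AE x in leb\<Omega>. \<bar>p x\<bar> \<le> C" using p by (rule LinfE)
  obtain D where D: "0 \<le> D" "AE x in leb\<Omega>. \<bar>q x\<bar> \<le> D" using q by (rule LinfE)
  let ?I = "LINT x|leb\<Omega>. p x * wderiv u x + q x * u x"
  have bound: "\<bar>?I\<bar> \<le> (C + D) * H1_norm (\<lambda>x. u x - \<phi> n x)" for n
  proof -
    let ?e = "\<lambda>x. u x - \<phi> n x" and ?d = "\<lambda>x. wderiv u x - deriv (\<phi> n) x"
    have w: "has_weak_deriv ?e ?d"
      by (rule has_weak_deriv_diff[OF H1_weak(1)[OF uH] test_functions_weak[OF \<phi>]])
    have i: "integrable leb\<Omega> (wderiv u)" "integrable leb\<Omega> u"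
      "integrable leb\<Omega> (deriv (\<phi> n))" "integrable leb\<Omega> (\<phi> n)"
      using Lp2_integrable H1_weak[OF uH] uH Linf_integrable test_functions_Linf test_functions_deriv \<phi>
      by (auto simp: H1_def)
    have L2: "?e \<in> Lp 2"
      by (intro Linf_Lp2 Linf_diff H1_Linf[OF uH] test_functions_Linf \<phi>)
    have wd: "AE x in leb\<Omega>. wderiv ?e x = ?d x" by (rule wderiv_AE[OF w])
    have H1e: "wderiv ?e \<in> Lp 2"
    proof -
      have m: "?d \<in> borel_measurable leb\<Omega>" using i by auto
      have "integrable leb\<Omega> (\<lambda>x. (wderiv u x)\<^sup>2 + (deriv (\<phi> n) x * deriv (\<phi> n) x - (2 * deriv (\<phi> n) x) * wderiv u x))"
        using H1_weak(2)[OF uH] test_functions_Linf[OF test_functions_deriv[OF \<phi>[of n]]] i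
        by (intro Bochner_Integration.integrable_add Bochner_Integration.integrable_diff Linf_mult_integrable Linf_mult Linf_const)
          (auto simp: Lp2_iff)
      also have "(\<lambda>x. (wderiv u x)\<^sup>2 + (deriv (\<phi> n) x * deriv (\<phi> n) x - (2 * deriv (\<phi> n) x) * wderiv u x)) = (\<lambda>x. (?d x)\<^sup>2)"
        by (rule ext) (simp add: power2_eq_square algebra_simps)
      finally have "?d \<in> Lp 2" using m by (simp add: Lp2_iff)
      then show ?thesis by (rule Lp2_cong_AE[OF _ AE_leb_sym[OF wd]])
    qed
    have ie: "integrable leb\<Omega> ?e" "integrable leb\<Omega> (wderiv ?e)"
      using Lp2_integrable L2 H1e by blast+
    have int: "integrable leb\<Omega> (\<lambda>x. p x * wderiv u x + q x * u x)"
      "integrable leb\<Omega> (\<lambda>x. p x * deriv (\<phi> n) x + q x * \<phi> n x)"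
      by (intro Bochner_Integration.integrable_add Linf_mult_integrable p q i)+
    have split: "(\<lambda>x. p x * ?d x + q x * ?e x)
        = (\<lambda>x. (p x * wderiv u x + q x * u x) - (p x * deriv (\<phi> n) x + q x * \<phi> n x))"
      by (rule ext) (simp add: algebra_simps)
    have "?I = ?I - (LINT x|leb\<Omega>. p x * deriv (\<phi> n) x + q x * \<phi> n x)"
      unfolding L[OF \<phi>[of n]] by (rule diff_zero[symmetric])
    also have "\<dots> = (LINT x|leb\<Omega>. p x * ?d x + q x * ?e x)"
      unfolding split by (rule Bochner_Integration.integral_diff[OF int, symmetric])
    finally have I: "?I = (LINT x|leb\<Omega>. p x * ?d x + q x * ?e x)" .
    have "\<bar>?I\<bar> \<le> (LINT x|leb\<Omega>. \<bar>p x * ?d x + q x * ?e x\<bar>)"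
      unfolding I by (rule integral_abs_bound)
    also have "\<dots> \<le> (LINT x|leb\<Omega>. C * \<bar>wderiv ?e x\<bar> + D * \<bar>?e x\<bar>)"
    proof (rule integral_mono_AE)
      have "integrable leb\<Omega> (\<lambda>x. p x * ?d x + q x * ?e x)"
        unfolding split by (rule Bochner_Integration.integrable_diff[OF int])
      then show "integrable leb\<Omega> (\<lambda>x. \<bar>p x * ?d x + q x * ?e x\<bar>)" by simp
      show "integrable leb\<Omega> (\<lambda>x. C * \<bar>wderiv ?e x\<bar> + D * \<bar>?e x\<bar>)" using ie by simp
      show "AE x in leb\<Omega>. \<bar>p x * ?d x + q x * ?e x\<bar> \<le> C * \<bar>wderiv ?e x\<bar> + D * \<bar>?e x\<bar>"
        using C(2) D(2) wd
      proof eventually_elim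
        case (elim x)
        have "\<bar>p x * ?d x + q x * ?e x\<bar> \<le> \<bar>p x\<bar> * \<bar>?d x\<bar> + \<bar>q x\<bar> * \<bar>?e x\<bar>"
          using abs_triangle_ineq[of "p x * ?d x" "q x * ?e x"] by (simp add: abs_mult)
        also have "\<dots> \<le> C * \<bar>?d x\<bar> + D * \<bar>?e x\<bar>"
          using elim by (intro add_mono mult_right_mono) auto
        finally show ?case using elim by simp
      qed
    qed
    also have "\<dots> = C * (LINT x|leb\<Omega>. \<bar>wderiv ?e x\<bar>) + D * (LINT x|leb\<Omega>. \<bar>?e x\<bar>)"
      using ie by simp
    also have "\<dots> \<le> C * H1_norm ?e + D * H1_norm ?e"
    proof (intro add_mono mult_left_mono C D)
      have "(LINT x|leb\<Omega>. \<bar>wderiv ?e x\<bar>) \<le> Lp_norm 2 (wderiv ?e)"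
        using integral_abs_le_Lp2[OF H1e] by (simp add: Lp2_norm)
      also have "\<dots> \<le> H1_norm ?e" unfolding H1_norm_def by (rule real_le_rsqrt) simp
      finally show "(LINT x|leb\<Omega>. \<bar>wderiv ?e x\<bar>) \<le> H1_norm ?e" .
      have "(LINT x|leb\<Omega>. \<bar>?e x\<bar>) \<le> Lp_norm 2 ?e"
        using integral_abs_le_Lp2[OF L2] by (simp add: Lp2_norm)
      also have "\<dots> \<le> H1_norm ?e" unfolding H1_norm_def by (rule real_le_rsqrt) simp
      finally show "(LINT x|leb\<Omega>. \<bar>?e x\<bar>) \<le> H1_norm ?e" .
    qed
    finally show ?thesis by (simp add: algebra_simps)
  qed
  have "(\<lambda>n. (C + D) * H1_norm (\<lambda>x. u x - \<phi> n x)) \<longlonglongrightarrow> (C + D) * 0"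
    by (intro tendsto_intros lim)
  then have "\<bar>?I\<bar> \<le> (C + D) * 0"
    by (rule LIMSEQ_le_const) (use bound in blast)
  then show ?thesis by simp
qed

text \<open>The two moments \<open>\<integral> u'\<close> and \<open>\<integral> (x * u' + u)\<close> vanish for test functions, hence on \<^const>\<open>H1_0\<close>; this
  is how the zero boundary values enter.\<close>

lemma H1_0_const_deriv:
  assumes u: "u \<in> H1_0" and k: "AE x in leb\<Omega>. wderiv u x = k"
  shows "AE x in leb\<Omega>. wderiv u x = 0" "AE x in leb\<Omega>. u x = 0"
proof -
  have uH: "u \<in> H1" using u by (simp add: H1_0_def)
  have iu: "integrable leb\<Omega> u" and iw: "integrable leb\<Omega> (wderiv u)"
    using uH H1_weak[OF uH] Lp2_integrable by (auto simp: H1_def)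
  have id: "(\<lambda>x. x) \<in> Linf" by (rule continuous_on_Linf) simp
  have "(LINT x|leb\<Omega>. 1 * wderiv u x + 0 * u x) = 0"
  proof (rule H1_0_test_approx[OF u])
    fix \<phi> assume \<phi>: "\<phi> \<in> test_functions"
    show "(LINT x|leb\<Omega>. 1 * deriv \<phi> x + 0 * \<phi> x) = 0"
      using is_primitiveD[OF test_functions_primitive[OF \<phi>], of 1]
      by (simp add: test_functions_ends[OF \<phi>] prim_1)
  qed auto
  moreover have "(LINT x|leb\<Omega>. 1 * wderiv u x + 0 * u x) = (LINT x|leb\<Omega>. k)"
    by (rule integral_cong_AE_leb) (use iw k in \<open>auto elim: eventually_mono\<close>)
  ultimately have "k = 0" by simp
  then show w0: "AE x in leb\<Omega>. wderiv u x = 0" using k by simp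
  have "has_weak_deriv u (\<lambda>x. 0)"
    by (rule has_weak_deriv_cong_AE[OF H1_weak(1)[OF uH]]) (use w0 in auto)
  then obtain d where d: "AE x in leb\<Omega>. u x = d" using weak_deriv_0_const iu by blast
  have "(LINT x|leb\<Omega>. x * wderiv u x + 1 * u x) = 0"
  proof (rule H1_0_test_approx[OF u])
    fix \<phi> assume \<phi>: "\<phi> \<in> test_functions"
    have "is_primitive (\<lambda>x. x) (\<lambda>x. 1)"
      by (rule is_primitiveI[of _ _ "{}"]) auto
    from is_primitiveD[OF is_primitive_mult[OF this test_functions_primitive[OF \<phi>]], of 1]
    show "(LINT x|leb\<Omega>. x * deriv \<phi> x + 1 * \<phi> x) = 0"
      by (simp add: test_functions_ends[OF \<phi>] prim_1 add.commute)
  qed (use id in auto)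
  moreover have "(LINT x|leb\<Omega>. x * wderiv u x + 1 * u x) = (LINT x|leb\<Omega>. d)"
  proof (rule integral_cong_AE_leb)
    show "(\<lambda>x. x * wderiv u x + 1 * u x) \<in> borel_measurable leb\<Omega>"
      using Linf_mult_integrable[OF id iw] iu by (intro borel_measurable_add) auto
    show "AE x in leb\<Omega>. x * wderiv u x + 1 * u x = d"
      using w0 d by eventually_elim simp
  qed
  ultimately have "d = 0" by simp
  then show "AE x in leb\<Omega>. u x = 0" using d by simp
qed

text \<open>If the residual vanishes, the strong form of the equation reduces to \<open>a * u'' = 0\<close>, so
  \<open>u\<close> is affine and, having zero boundary values, vanishes.\<close>

lemma resid_nonzero:
  assumes a: "a \<in> W1inf" and b: "b \<in> Linf" and c: "c \<in> Linf" and f: "f \<in> Lp 2"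
    and a0: "0 < a0" "AE x in leb\<Omega>. a0 \<le> a x"
    and u: "weak_solution a b c f u" "u \<in> H2" and f0: "\<not> (AE x in leb\<Omega>. f x = 0)"
  shows "\<not> (AE x in leb\<Omega>. resid a b c f u x = 0)"
proof
  assume r: "AE x in leb\<Omega>. resid a b c f u x = 0"
  have u0: "u \<in> H1_0" and uH: "u \<in> H1" and pH: "wderiv u \<in> H1"
    using u by (auto simp: weak_solution_def H2_def)
  define p where "p = wderiv u"
  obtain P where P: "is_primitive P (wderiv p)" "AE x in leb\<Omega>. p x = P x"
    using H1_primitive[OF pH] unfolding p_def by blast
  obtain A where A: "is_primitive A (wderiv a)" "AE x in leb\<Omega>. a x = A x"
    using W1inf_primitive[OF a] by blast
  define a' where "a' = wderiv a"
  have L: "a \<in> Linf" "a' \<in> Linf" "p \<in> Linf" "u \<in> Linf"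
    using W1inf_weak(2)[OF a] a H1_Linf[OF pH] H1_Linf[OF uH] by (auto simp: W1inf_def a'_def p_def)
  have W: "has_weak_deriv (\<lambda>x. a x * p x) (\<lambda>x. a' x * p x)"
    unfolding has_weak_deriv_def
  proof (intro conjI ballI)
    show "locally_integrable (\<lambda>x. a x * p x)" "locally_integrable (\<lambda>x. a' x * p x)"
      by (intro integrable_locally Linf_integrable Linf_mult L)+
    fix \<phi> assume \<phi>: "\<phi> \<in> test_functions"
    note \<phi>L = test_functions_Linf[OF \<phi>] test_functions_Linf[OF test_functions_deriv[OF \<phi>]]
    have wd: "AE x in leb\<Omega>. deriv \<phi> x = wderiv \<phi> x"
      by (rule AE_leb_sym[OF wderiv_AE[OF test_functions_weak[OF \<phi>]]])
    have "(LINT x|leb\<Omega>. f x * \<phi> x) = bilin a b c u \<phi>"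
      using u test_functions_H1_0[OF \<phi>] by (simp add: weak_solution_def)
    also have "\<dots> = (LINT x|leb\<Omega>. a x * p x * deriv \<phi> x + b x * p x * \<phi> x + c x * u x * \<phi> x)"
      unfolding bilin_def p_def[symmetric]
    proof (rule integral_cong_AE_leb[symmetric])
      show "(\<lambda>x. a x * p x * deriv \<phi> x + b x * p x * \<phi> x + c x * u x * \<phi> x) \<in> borel_measurable leb\<Omega>"
        by (intro Linf_measurable Linf_add Linf_mult L b c \<phi>L)
    qed (use wd in \<open>eventually_elim, simp\<close>)
    finally have 1: "(LINT x|leb\<Omega>. f x * \<phi> x)
        = (LINT x|leb\<Omega>. a x * p x * deriv \<phi> x + b x * p x * \<phi> x + c x * u x * \<phi> x)" .
    have i: "integrable leb\<Omega> (\<lambda>x. a x * p x * deriv \<phi> x)" "integrable leb\<Omega> (\<lambda>x. b x * p x * \<phi> x)"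
      "integrable leb\<Omega> (\<lambda>x. c x * u x * \<phi> x)" "integrable leb\<Omega> (\<lambda>x. a' x * p x * \<phi> x)"
      by (intro Linf_integrable Linf_mult L b c \<phi>L)+
    have "(LINT x|leb\<Omega>. f x * \<phi> x)
        = (LINT x|leb\<Omega>. b x * p x * \<phi> x + c x * u x * \<phi> x - a' x * p x * \<phi> x)"
    proof (rule integral_cong_AE_leb)
      show "(\<lambda>x. f x * \<phi> x) \<in> borel_measurable leb\<Omega>"
        using f \<phi>L by (intro borel_measurable_times) (auto simp: Lp2_iff)
      show "AE x in leb\<Omega>. f x * \<phi> x = b x * p x * \<phi> x + c x * u x * \<phi> x - a' x * p x * \<phi> x"
        using r
      proof eventually_elim
        case (elim x)
        then have fx: "f x = b x * p x + c x * u x - a' x * p x"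
          by (simp add: resid_def p_def a'_def)
        show ?case unfolding fx by (simp add: left_diff_distrib distrib_right)
      qed
    qed
    with 1 i show "(LINT x|leb\<Omega>. a x * p x * deriv \<phi> x) = - (LINT x|leb\<Omega>. a' x * p x * \<phi> x)"
      by simp
  qed
  have "has_weak_deriv (\<lambda>x. A x * P x) (\<lambda>x. a' x * P x + A x * wderiv p x)"
    unfolding a'_def by (intro has_weak_deriv_primitive is_primitive_mult A P)
  then have "has_weak_deriv (\<lambda>x. a x * p x) (\<lambda>x. a' x * P x + A x * wderiv p x)"
  proof (rule has_weak_deriv_cong_AE)
    show "AE x in leb\<Omega>. A x * P x = a x * p x" using A(2) P(2) by eventually_elim simp
  qed simp
  from has_weak_deriv_unique[OF W this] have q0: "AE x in leb\<Omega>. wderiv p x = 0"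
    using A(2) P(2) a0(2)
  proof eventually_elim
    case (elim x)
    then have "A x * wderiv p x = 0" "A x \<noteq> 0" using a0(1) by auto
    then show ?case by simp
  qed
  have "AE x in leb\<Omega>. wderiv u x = P 0"
    using P(2) AE_leb_in
  proof eventually_elim
    case (elim x)
    have "prim (wderiv p) x = prim (\<lambda>x. 0) x"
      by (rule prim_cong_AE[OF _ q0]) (use is_primitive_integrable[OF P(1)] in auto)
    also have "\<dots> = 0" by (simp add: prim_def)
    finally show ?case using is_primitiveD[OF P(1), of x] elim by (simp add: p_def)
  qed
  from H1_0_const_deriv[OF u0 this] r have "AE x in leb\<Omega>. f x = 0"
    by eventually_elim (simp add: resid_def)
  then show False using f0 by simp
qed

section \<open>Bounded almost everywhere convergence\<close>

text \<open>Convergence almost everywhere on \<open>\<Omega>\<close> of a uniformly essentially bounded sequence. It is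
  preserved by sums and products and implies convergence of the integrals.\<close>

definition bconv :: "(nat \<Rightarrow> real \<Rightarrow> real) \<Rightarrow> (real \<Rightarrow> real) \<Rightarrow> bool" where
  "bconv s f \<longleftrightarrow> (\<forall>k. s k \<in> borel_measurable leb\<Omega>) \<and> f \<in> borel_measurable leb\<Omega> \<and>
     (AE x in leb\<Omega>. (\<lambda>k. s k x) \<longlonglongrightarrow> f x) \<and> (\<exists>C. \<forall>k. AE x in leb\<Omega>. \<bar>s k x\<bar> \<le> C)"

lemma bconv_integral: "bconv s f \<Longrightarrow> (\<lambda>k. LINT x|leb\<Omega>. s k x) \<longlonglongrightarrow> (LINT x|leb\<Omega>. f x)"
  unfolding bconv_def by (elim conjE exE) (rule leb_bounded_convergence, auto)

lemma bconv_fixed: assumes "v \<in> Linf" shows "bconv (\<lambda>k. v) v"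
  unfolding bconv_def using assms by (auto elim: LinfE)

lemma bconv_scalar:
  assumes "\<alpha> \<longlonglongrightarrow> l" shows "bconv (\<lambda>k x. \<alpha> k) (\<lambda>x. l)"
proof -
  obtain C where "\<forall>k. norm (\<alpha> k) \<le> C"
    using convergent_imp_Bseq[OF convergentI[OF assms]] by (auto simp: Bseq_def)
  then show ?thesis unfolding bconv_def using assms by auto
qed

lemma bconv_add:
  assumes "bconv s f" "bconv r g" shows "bconv (\<lambda>k x. s k x + r k x) (\<lambda>x. f x + g x)"
proof -
  from assms obtain C D where C: "\<And>k. AE x in leb\<Omega>. \<bar>s k x\<bar> \<le> C" and D: "\<And>k. AE x in leb\<Omega>. \<bar>r k x\<bar> \<le> D"
    by (auto simp: bconv_def)
  have "AE x in leb\<Omega>. \<bar>s k x + r k x\<bar> \<le> C + D" for k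
    using C[of k] D[of k] by eventually_elim linarith
  moreover have "AE x in leb\<Omega>. (\<lambda>k. s k x) \<longlonglongrightarrow> f x" "AE x in leb\<Omega>. (\<lambda>k. r k x) \<longlonglongrightarrow> g x"
    using assms by (simp_all add: bconv_def)
  then have "AE x in leb\<Omega>. (\<lambda>k. s k x + r k x) \<longlonglongrightarrow> f x + g x"
    by eventually_elim (rule tendsto_add)
  ultimately show ?thesis using assms unfolding bconv_def by (auto intro: borel_measurable_add)
qed

lemma bconv_mult:
  assumes "bconv s f" "bconv r g" shows "bconv (\<lambda>k x. s k x * r k x) (\<lambda>x. f x * g x)"
proof -
  from assms obtain C D where C: "\<And>k. AE x in leb\<Omega>. \<bar>s k x\<bar> \<le> C" and D: "\<And>k. AE x in leb\<Omega>. \<bar>r k x\<bar> \<le> D"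
    by (auto simp: bconv_def)
  have "AE x in leb\<Omega>. \<bar>s k x * r k x\<bar> \<le> C * D" for k
    using C[of k] D[of k]
  proof eventually_elim
    case (elim x)
    then have "0 \<le> C" using abs_ge_zero[of "s k x"] by linarith
    then show ?case unfolding abs_mult using elim by (intro mult_mono) auto
  qed
  moreover have "AE x in leb\<Omega>. (\<lambda>k. s k x) \<longlonglongrightarrow> f x" "AE x in leb\<Omega>. (\<lambda>k. r k x) \<longlonglongrightarrow> g x"
    using assms by (simp_all add: bconv_def)
  then have "AE x in leb\<Omega>. (\<lambda>k. s k x * r k x) \<longlonglongrightarrow> f x * g x"
    by eventually_elim (rule tendsto_mult)
  ultimately show ?thesis using assms unfolding bconv_def by (auto intro: borel_measurable_times)
qed

lemma bconv_diff:
  assumes "bconv s f" "bconv r g" shows "bconv (\<lambda>k x. s k x - r k x) (\<lambda>x. f x - g x)"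
  using bconv_add[OF assms(1) bconv_mult[OF bconv_fixed[OF Linf_const[of "-1"]] assms(2)]] by simp

lemma bconv_sum:
  "(\<And>i. i \<in> A \<Longrightarrow> bconv (s i) (f i)) \<Longrightarrow> bconv (\<lambda>k x. \<Sum>i\<in>A. s i k x) (\<lambda>x. \<Sum>i\<in>A. f i x)"
  by (induction A rule: infinite_finite_induct) (auto intro: bconv_add bconv_fixed)

section \<open>Finite element functions in nodal coordinates\<close>

lemma mesh_less: assumes "mesh N x" "i < j" "j \<le> N" shows "x i < x j"
  using assms(2,3)
proof (induction j)
  case (Suc j)
  then have "x j < x (Suc j)" using assms(1) by (simp add: mesh_def)
  then show ?case using Suc by (cases "i = j") auto
qed simp

lemma mesh_le: assumes "mesh N x" "i \<le> j" "j \<le> N" shows "x i \<le> x j"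
  using mesh_less[OF assms(1), of i j] assms by (cases "i = j") auto

lemma mesh_pos: "mesh N x \<Longrightarrow> 0 < N"
  by (cases N) (auto simp: mesh_def)

lemma mesh_elem_len: "mesh N x \<Longrightarrow> i \<in> {1..N} \<Longrightarrow> 0 < elem_len x i"
  using mesh_less[of N x "i - 1" i] by (simp add: elem_len_def)

lemma mesh_range: assumes "mesh N x" "i \<le> N" shows "0 \<le> x i" "x i \<le> 1"
  using mesh_le[OF assms(1), of 0 i] mesh_le[OF assms(1), of i N] assms by (auto simp: mesh_def)

lemma mesh_elem_range: assumes "mesh N x" "i \<in> {1..N}" shows "0 \<le> x (i - 1)" "x i \<le> 1"
proof -
  have "i - 1 \<le> N" "i \<le> N" using assms(2) by auto
  then show "0 \<le> x (i - 1)" "x i \<le> 1" using mesh_range[OF assms(1)] by blast+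
qed

lemma mesh_cover:
  assumes x: "mesh N x" and t: "t \<in> {0..1}"
  obtains k where "k \<in> {1..N}" "x (k - 1) \<le> t" "t \<le> x k"
proof (cases "t = 0")
  case True
  then show ?thesis using that[of 1] mesh_range[OF x, of 1] mesh_pos[OF x] x by (auto simp: mesh_def)
next
  case False
  define k where "k = (LEAST k. t \<le> x k)"
  have ex: "t \<le> x N" using t x by (simp add: mesh_def)
  have k: "t \<le> x k" unfolding k_def by (rule LeastI[of "\<lambda>k. t \<le> x k", OF ex])
  have kN: "k \<le> N" unfolding k_def by (rule Least_le[of "\<lambda>k. t \<le> x k", OF ex])
  have "0 < k" using k False t x by (cases k) (auto simp: mesh_def)
  then have "\<not> t \<le> x (k - 1)" unfolding k_def by (intro not_less_Least) simp
  then show ?thesis using that[of k] k kN \<open>0 < k\<close> by auto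
qed

text \<open>The slope on element \<open>i\<close> of the piecewise affine function with nodal values \<open>U\<close>.\<close>

definition slope :: "(nat \<Rightarrow> real) \<Rightarrow> (nat \<Rightarrow> real) \<Rightarrow> nat \<Rightarrow> real" where
  "slope x U i = (U i - U (i - 1)) / elem_len x i"

text \<open>The function that is \<open>0\<close> left of element \<open>i\<close>, constant right of it, and has slope \<open>1\<close> on it.\<close>

definition ramp :: "(nat \<Rightarrow> real) \<Rightarrow> nat \<Rightarrow> real \<Rightarrow> real" where
  "ramp x i t = max 0 (min (t - x (i - 1)) (elem_len x i))"

text \<open>The piecewise affine function on \<open>[0, 1]\<close> with nodal values \<open>U\<close>, for \<open>U 0 = 0\<close>. Writing it with
  ramps makes it depend continuously on mesh and nodal values at every point.\<close>

definition interp :: "nat \<Rightarrow> (nat \<Rightarrow> real) \<Rightarrow> (nat \<Rightarrow> real) \<Rightarrow> real \<Rightarrow> real" where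
  "interp N x U t = (\<Sum>i=1..N. slope x U i * ramp x i t)"

text \<open>Its derivative away from the nodes, and \<open>0\<close> at the nodes.\<close>

definition interp_deriv :: "nat \<Rightarrow> (nat \<Rightarrow> real) \<Rightarrow> (nat \<Rightarrow> real) \<Rightarrow> real \<Rightarrow> real" where
  "interp_deriv N x U t = (\<Sum>i=1..N. slope x U i * indicator (elem x i) t)"

lemma telescope: "(\<Sum>i=1..m. U i - U (i - 1)) = U m - (U 0 :: real)" for m :: nat
  by (induction m) auto

lemma interp_eq:
  assumes x: "mesh N x" and k: "k \<in> {1..N}" and t: "x (k - 1) \<le> t" "t \<le> x k" and U: "U 0 = 0"
  shows "interp N x U t = U (k - 1) + slope x U k * (t - x (k - 1))"
proof -
  have "interp N x U t = (\<Sum>i=1..k. slope x U i * ramp x i t)"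
    unfolding interp_def
  proof (rule sum.mono_neutral_right)
    show "\<forall>i\<in>{1..N} - {1..k}. slope x U i * ramp x i t = 0"
    proof
      fix i assume "i \<in> {1..N} - {1..k}"
      then have "x k \<le> x (i - 1)" by (intro mesh_le[OF x]) auto
      then show "slope x U i * ramp x i t = 0" using t by (simp add: ramp_def)
    qed
  qed (use k in auto)
  also have "{1..k} = insert k {1..k - 1}" using k by auto
  also have "(\<Sum>i\<in>insert k {1..k - 1}. slope x U i * ramp x i t)
      = slope x U k * ramp x k t + (\<Sum>i=1..k - 1. slope x U i * ramp x i t)"
    using k by (intro sum.insert) auto
  also have "ramp x k t = t - x (k - 1)" using t by (simp add: ramp_def elem_len_def)
  also have "(\<Sum>i=1..k - 1. slope x U i * ramp x i t) = (\<Sum>i=1..k - 1. U i - U (i - 1))"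
  proof (rule sum.cong)
    fix i assume i: "i \<in> {1..k - 1}"
    then have h: "0 < elem_len x i" using k by (intro mesh_elem_len[OF x]) auto
    have "x i \<le> x (k - 1)" using i k by (intro mesh_le[OF x]) auto
    then have "ramp x i t = elem_len x i" using t h by (auto simp: ramp_def elem_len_def)
    then show "slope x U i * ramp x i t = U i - U (i - 1)" using h by (simp add: slope_def)
  qed simp
  finally show ?thesis using U telescope[of U "k - 1"] by simp
qed

lemma interp_node:
  assumes x: "mesh N x" and U: "U 0 = 0" and k: "k \<le> N" shows "interp N x U (x k) = U k"
proof (cases "k = 0")
  case True
  then show ?thesis
    using interp_eq[where U = U and k = 1 and t = "x 0", OF x _ _ _ U] mesh_pos[OF x] mesh_le[OF x, of 0 1] U by auto
next
  case False
  then have k1: "k \<in> {1..N}" using k by auto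
  have "interp N x U (x k) = U (k - 1) + slope x U k * (x k - x (k - 1))"
    by (rule interp_eq[where U = U, OF x k1 _ _ U]) (use mesh_le[OF x, of "k - 1" k] k in auto)
  then show ?thesis using mesh_elem_len[OF x k1] by (simp add: slope_def elem_len_def)
qed

lemma interp_deriv_eq:
  assumes x: "mesh N x" and k: "k \<in> {1..N}" and t: "t \<in> elem x k"
  shows "interp_deriv N x U t = slope x U k"
proof -
  have "interp_deriv N x U t = (\<Sum>i=1..N. if i = k then slope x U k else 0)"
    unfolding interp_deriv_def
  proof (rule sum.cong)
    fix i assume i: "i \<in> {1..N}"
    have "t \<notin> elem x i" if "i < k"
    proof -
      have "x i \<le> x (k - 1)" by (rule mesh_le[OF x]) (use that k in auto)
      then show ?thesis using t by (auto simp: elem_def)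
    qed
    moreover have "t \<notin> elem x i" if "k < i"
    proof -
      have "x k \<le> x (i - 1)" by (rule mesh_le[OF x]) (use that i in auto)
      then show ?thesis using t by (auto simp: elem_def)
    qed
    ultimately show "slope x U i * indicator (elem x i) t = (if i = k then slope x U k else 0)"
      using t by (cases "i = k") (auto simp: nat_neq_iff)
  qed simp
  then show ?thesis using k by simp
qed

lemma interp_has_deriv:
  assumes x: "mesh N x" and k: "k \<in> {1..N}" and t: "t \<in> elem x k" and U: "U 0 = 0"
  shows "(interp N x U has_real_derivative interp_deriv N x U t) (at t)"
proof -
  have "((\<lambda>t. U (k - 1) + slope x U k * (t - x (k - 1))) has_real_derivative slope x U k) (at t)"
    by (auto intro!: derivative_eq_intros)
  then have "(interp N x U has_real_derivative slope x U k) (at t)"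
  proof (rule has_field_derivative_transform_within_open)
    show "open (elem x k)" by (simp add: elem_def)
    show "U (k - 1) + slope x U k * (s - x (k - 1)) = interp N x U s" if "s \<in> elem x k" for s
      using interp_eq[where U = U and t = s, OF x k _ _ U] that by (auto simp: elem_def)
  qed (rule t)
  then show ?thesis by (simp add: interp_deriv_eq[OF x k t])
qed

lemma interp_continuous: "continuous_on A (interp N x U)"
  unfolding interp_def ramp_def
  by (intro continuous_intros)

lemma Linf_sum: "(\<And>i. i \<in> A \<Longrightarrow> f i \<in> Linf) \<Longrightarrow> (\<lambda>x. \<Sum>i\<in>A. f i x) \<in> Linf"
  by (induction A rule: infinite_finite_induct) auto

lemma interp_Linf: "interp N x U \<in> Linf"
  by (rule continuous_on_Linf[OF interp_continuous])

lemma interp_deriv_Linf: "interp_deriv N x U \<in> Linf"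
  unfolding interp_deriv_def
  by (intro Linf_sum Linf_mult Linf_const indicator_Linf) (simp add: elem_def)

lemma interp_primitive:
  assumes x: "mesh N x" and U: "U 0 = 0"
  shows "is_primitive (interp N x U) (interp_deriv N x U)"
proof (rule is_primitiveI[OF interp_deriv_Linf interp_continuous, of "x ` {..N}"])
  fix t assume t: "t \<in> \<Omega> - x ` {..N}"
  then obtain k where k: "k \<in> {1..N}" "x (k - 1) \<le> t" "t \<le> x k"
    using mesh_cover[OF x, of t] by auto
  have "t \<noteq> x (k - 1)" "t \<noteq> x k" using t k(1) by auto
  then have "t \<in> elem x k" using k by (simp add: elem_def)
  then show "(interp N x U has_real_derivative interp_deriv N x U t) (at t)"
    by (rule interp_has_deriv[where U = U, OF x k(1) _ U])
qed simp

lemma interp_in_fe_space: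
  assumes x: "mesh N x" and U: "U 0 = 0" "U N = 0" shows "interp N x U \<in> fe_space N x"
  unfolding fe_space_def
proof (intro CollectI conjI ballI)
  show "interp N x U 0 = 0" "interp N x U 1 = 0"
    using interp_node[where U = U and k = 0, OF x] interp_node[where U = U and k = N, OF x] U x
    by (auto simp: mesh_def)
  fix i assume i: "i \<in> {1..N}"
  have "\<forall>t\<in>elem x i. interp N x U t = slope x U i * t + (U (i - 1) - slope x U i * x (i - 1))"
    using interp_eq[where U = U, OF x i _ _ U(1)] by (auto simp: elem_def algebra_simps)
  then show "\<exists>p q. \<forall>t\<in>elem x i. interp N x U t = p * t + q" by blast
qed (rule interp_continuous)

lemma fe_space_interp:
  assumes x: "mesh N x" and v: "v \<in> fe_space N x" and t: "t \<in> {0..1}"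
  shows "v t = interp N x (\<lambda>i. v (x i)) t"
proof -
  obtain k where k: "k \<in> {1..N}" "x (k - 1) \<le> t" "t \<le> x k" using mesh_cover[OF x t] by blast
  have "\<exists>p q. \<forall>t\<in>elem x k. v t = p * t + q" using v k(1) unfolding fe_space_def by blast
  then obtain p q where pq: "\<And>s. s \<in> elem x k \<Longrightarrow> v s = p * s + q" by blast
  have lt: "x (k - 1) < x k" using mesh_less[OF x, of "k - 1" k] k(1) by auto
  have cv: "continuous_on {x (k - 1)..x k} v"
    using v mesh_elem_range[OF x k(1)]
    by (auto simp: fe_space_def elim!: continuous_on_subset)
  have all: "v s = p * s + q" if "s \<in> {x (k - 1)..x k}" for s
  proof -
    have "v s - (p * s + q) = 0"
    proof (rule continuous_constant_on_closure[where S = "{x (k - 1)<..<x k}" and f = "\<lambda>s. v s - (p * s + q)"])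
      show "continuous_on (closure {x (k - 1)<..<x k}) (\<lambda>s. v s - (p * s + q))"
        using lt cv by (auto intro!: continuous_intros)
      show "v r - (p * r + q) = 0" if "r \<in> {x (k - 1)<..<x k}" for r
        using pq[of r] that by (simp add: elem_def)
      show "s \<in> closure {x (k - 1)<..<x k}" using that lt by simp
    qed
    then show ?thesis by simp
  qed
  have v0: "v (x 0) = 0" using v x by (simp add: fe_space_def mesh_def)
  have "interp N x (\<lambda>i. v (x i)) t = v (x (k - 1)) + slope x (\<lambda>i. v (x i)) k * (t - x (k - 1))"
    by (rule interp_eq[where U = "\<lambda>i. v (x i)", OF x k v0])
  also have "slope x (\<lambda>i. v (x i)) k = p"
    using all[of "x k"] all[of "x (k - 1)"] lt
    by (simp add: slope_def elem_len_def field_simps)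
  finally show ?thesis using all[of t] all[of "x (k - 1)"] k lt by (simp add: algebra_simps)
qed

lemma fe_weak_deriv:
  assumes x: "mesh N x" and v: "v \<in> fe_space N x"
  shows "has_weak_deriv v (interp_deriv N x (\<lambda>i. v (x i)))"
proof (rule has_weak_deriv_cong_AE)
  have "v (x 0) = 0" using v x by (simp add: fe_space_def mesh_def)
  then show "has_weak_deriv (interp N x (\<lambda>i. v (x i))) (interp_deriv N x (\<lambda>i. v (x i)))"
    by (intro has_weak_deriv_primitive interp_primitive x)
  show "AE t in leb\<Omega>. interp N x (\<lambda>i. v (x i)) t = v t"
    using AE_leb_in by eventually_elim (use fe_space_interp[OF x v] in auto)
qed simp

text \<open>The nodal values of the hat function at node \<open>j\<close>.\<close>

definition unit_vec :: "nat \<Rightarrow> nat \<Rightarrow> real" where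
  "unit_vec j i = (if i = j then 1 else 0)"

text \<open>\<open>B(u\<^sub>h, w\<^sub>h) - (f, w\<^sub>h)\<close> for the piecewise affine functions with nodal values \<open>U\<close> and \<open>W\<close>,
  as one integral. It is linear in \<open>W\<close>, and affine in \<open>U\<close>.\<close>

definition galerkin :: "(real \<Rightarrow> real) \<Rightarrow> (real \<Rightarrow> real) \<Rightarrow> (real \<Rightarrow> real) \<Rightarrow> (real \<Rightarrow> real) \<Rightarrow>
    nat \<Rightarrow> (nat \<Rightarrow> real) \<Rightarrow> (nat \<Rightarrow> real) \<Rightarrow> (nat \<Rightarrow> real) \<Rightarrow> real" where
  "galerkin a b c f N x U W = (LINT t|leb\<Omega>. a t * interp_deriv N x U t * interp_deriv N x W t +
     (b t * interp_deriv N x U t + c t * interp N x U t - f t) * interp N x W t)"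

lemma galerkin_bilin:
  assumes L: "a \<in> Linf" "b \<in> Linf" "c \<in> Linf" "f \<in> Linf"
    and x: "mesh N x" and U: "U 0 = 0" "U N = 0" and v: "v \<in> fe_space N x"
  shows "galerkin a b c f N x U (\<lambda>i. v (x i)) = bilin a b c (interp N x U) v - (LINT t|leb\<Omega>. f t * v t)"
proof -
  let ?g = "interp_deriv N x U" and ?w = "interp N x U" and ?W = "\<lambda>i. v (x i)"
  note IL = interp_Linf[of N x] interp_deriv_Linf[of N x]
  have wU: "AE t in leb\<Omega>. wderiv ?w t = ?g t"
    by (rule wderiv_AE[OF has_weak_deriv_primitive[OF interp_primitive[where U = U, OF x U(1)]]])
  have wv: "AE t in leb\<Omega>. wderiv v t = interp_deriv N x ?W t"
    by (rule wderiv_AE[OF fe_weak_deriv[OF x v]])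
  have vv: "AE t in leb\<Omega>. v t = interp N x ?W t"
    using AE_leb_in by eventually_elim (use fe_space_interp[OF x v] in auto)
  have "bilin a b c ?w v = (LINT t|leb\<Omega>. a t * ?g t * interp_deriv N x ?W t +
      b t * ?g t * interp N x ?W t + c t * ?w t * interp N x ?W t)"
    unfolding bilin_def
  proof (rule integral_cong_AE_leb[symmetric])
    show "(\<lambda>t. a t * ?g t * interp_deriv N x ?W t + b t * ?g t * interp N x ?W t
        + c t * ?w t * interp N x ?W t) \<in> borel_measurable leb\<Omega>"
      by (intro Linf_measurable Linf_add Linf_mult L IL)
  qed (use wU wv vv in \<open>eventually_elim, simp\<close>)
  moreover have "(LINT t|leb\<Omega>. f t * v t) = (LINT t|leb\<Omega>. f t * interp N x ?W t)"
  proof (rule integral_cong_AE_leb[symmetric])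
    show "(\<lambda>t. f t * interp N x ?W t) \<in> borel_measurable leb\<Omega>" by (intro Linf_measurable Linf_mult L IL)
  qed (use vv in \<open>eventually_elim, simp\<close>)
  moreover have "galerkin a b c f N x U ?W = (LINT t|leb\<Omega>. (a t * ?g t * interp_deriv N x ?W t +
      b t * ?g t * interp N x ?W t + c t * ?w t * interp N x ?W t) - f t * interp N x ?W t)"
    unfolding galerkin_def by (rule Bochner_Integration.integral_cong) (simp_all add: algebra_simps)
  moreover have "\<dots> = (LINT t|leb\<Omega>. a t * ?g t * interp_deriv N x ?W t +
      b t * ?g t * interp N x ?W t + c t * ?w t * interp N x ?W t) - (LINT t|leb\<Omega>. f t * interp N x ?W t)"
    by (intro Bochner_Integration.integral_diff Linf_integrable Linf_add Linf_mult L IL)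
  ultimately show ?thesis by simp
qed

lemma interp_lincomb:
  assumes W: "W 0 = 0" "W N = 0"
  shows "interp N x W t = (\<Sum>j\<in>{1..<N}. W j * interp N x (unit_vec j) t)"
    and "interp_deriv N x W t = (\<Sum>j\<in>{1..<N}. W j * interp_deriv N x (unit_vec j) t)"
proof -
  have W_eq: "W i = (\<Sum>j\<in>{1..<N}. W j * unit_vec j i)" if "i \<le> N" for i
  proof -
    have "(\<Sum>j\<in>{1..<N}. W j * unit_vec j i) = (\<Sum>j\<in>{1..<N}. if j = i then W j else 0)"
      by (rule sum.cong) (auto simp: unit_vec_def)
    also have "\<dots> = (if i \<in> {1..<N} then W i else 0)" by (rule sum.delta) simp
    also have "\<dots> = W i" using that W by (cases "i = 0"; cases "i = N") auto
    finally show ?thesis by simp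
  qed
  have sl: "slope x W i = (\<Sum>j\<in>{1..<N}. W j * slope x (unit_vec j) i)" if "i \<in> {1..N}" for i
  proof -
    have "W i - W (i - 1) = (\<Sum>j\<in>{1..<N}. W j * unit_vec j i - W j * unit_vec j (i - 1))"
    proof -
      have "i \<le> N" "i - 1 \<le> N" using that by auto
      then show ?thesis using W_eq[of i] W_eq[of "i - 1"] unfolding sum_subtractf by simp
    qed
    then show ?thesis by (simp add: slope_def sum_divide_distrib right_diff_distrib)
  qed
  have sw: "(\<Sum>i=1..N. slope x W i * z i) = (\<Sum>j\<in>{1..<N}. W j * (\<Sum>i=1..N. slope x (unit_vec j) i * z i))"
    for z :: "nat \<Rightarrow> real"
  proof -
    have "(\<Sum>i=1..N. slope x W i * z i) = (\<Sum>i=1..N. \<Sum>j\<in>{1..<N}. W j * (slope x (unit_vec j) i * z i))"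
      by (rule sum.cong) (simp_all add: sl sum_distrib_right mult.assoc)
    also have "\<dots> = (\<Sum>j\<in>{1..<N}. \<Sum>i=1..N. W j * (slope x (unit_vec j) i * z i))" by (rule sum.swap)
    finally show ?thesis by (simp add: sum_distrib_left)
  qed
  show "interp N x W t = (\<Sum>j\<in>{1..<N}. W j * interp N x (unit_vec j) t)"
    unfolding interp_def by (rule sw)
  show "interp_deriv N x W t = (\<Sum>j\<in>{1..<N}. W j * interp_deriv N x (unit_vec j) t)"
    unfolding interp_deriv_def by (rule sw)
qed

lemma galerkin_lincomb:
  assumes L: "a \<in> Linf" "b \<in> Linf" "c \<in> Linf" "f \<in> Linf" and W: "W 0 = 0" "W N = 0"
  shows "galerkin a b c f N x U W = (\<Sum>j\<in>{1..<N}. W j * galerkin a b c f N x U (unit_vec j))"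
proof -
  note IL = interp_Linf[of N x] interp_deriv_Linf[of N x]
  define A where "A = (\<lambda>t. a t * interp_deriv N x U t)"
  define B where "B = (\<lambda>t. b t * interp_deriv N x U t + c t * interp N x U t - f t)"
  have AB: "A \<in> Linf" "B \<in> Linf"
    unfolding A_def B_def by (intro Linf_add Linf_diff Linf_mult L IL)+
  have gal: "galerkin a b c f N x U V = (LINT t|leb\<Omega>. A t * interp_deriv N x V t + B t * interp N x V t)" for V
    by (simp add: galerkin_def A_def B_def)
  have "galerkin a b c f N x U W = (LINT t|leb\<Omega>. (\<Sum>j\<in>{1..<N}. W j *
      (A t * interp_deriv N x (unit_vec j) t + B t * interp N x (unit_vec j) t)))"
    unfolding gal interp_lincomb[where W = W, OF W] sum_distrib_left sum.distrib[symmetric]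
    by (intro Bochner_Integration.integral_cong sum.cong) (simp_all add: algebra_simps)
  also have "\<dots> = (\<Sum>j\<in>{1..<N}. LINT t|leb\<Omega>. W j *
      (A t * interp_deriv N x (unit_vec j) t + B t * interp N x (unit_vec j) t))"
    by (intro Bochner_Integration.integral_sum integrable_mult_right Linf_integrable Linf_add Linf_mult AB IL)
  also have "\<dots> = (\<Sum>j\<in>{1..<N}. W j * galerkin a b c f N x U (unit_vec j))"
    unfolding gal by simp
  finally show ?thesis .
qed

lemma galerkin_fe_solution:
  assumes L: "a \<in> Linf" "b \<in> Linf" "c \<in> Linf" "f \<in> Linf"
    and x: "mesh N x" and U: "U 0 = 0" "U N = 0"
    and 0: "\<And>j. j \<in> {1..<N} \<Longrightarrow> galerkin a b c f N x U (unit_vec j) = 0"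
  shows "fe_solution a b c f N x (interp N x U)"
  unfolding fe_solution_def
proof (intro conjI ballI interp_in_fe_space x U)
  fix v assume v: "v \<in> fe_space N x"
  have W: "v (x 0) = 0" "v (x N) = 0" using v x by (simp_all add: fe_space_def mesh_def)
  have "galerkin a b c f N x U (\<lambda>i. v (x i)) = 0"
    using galerkin_lincomb[OF L, where W = "\<lambda>i. v (x i)", OF W] 0 by simp
  then show "bilin a b c (interp N x U) v = (LINT t|leb\<Omega>. f t * v t)"
    using galerkin_bilin[OF L x U v] by simp
qed

text \<open>Coercivity: integrating \<open>b * v * v'\<close> by parts leaves the coefficient \<open>c - b' / 2\<close>.\<close>

lemma galerkin_coercive:
  assumes L: "a \<in> Linf" "c \<in> Linf" "f \<in> Linf" and b: "b \<in> W1inf"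
    and a0: "AE t in leb\<Omega>. a0 \<le> a t" and cb: "AE t in leb\<Omega>. 0 \<le> c t - 1/2 * wderiv b t"
    and x: "mesh N x" and U: "U 0 = 0" "U N = 0"
  shows "a0 * (LINT t|leb\<Omega>. (interp_deriv N x U t)\<^sup>2) - (LINT t|leb\<Omega>. f t * interp N x U t)
      \<le> galerkin a b c f N x U U"
proof -
  let ?g = "interp_deriv N x U" and ?v = "interp N x U"
  note IL = interp_Linf[of N x] interp_deriv_Linf[of N x]
  have bL: "b \<in> Linf" "wderiv b \<in> Linf" using b W1inf_weak(2)[OF b] by (simp_all add: W1inf_def)
  obtain B where B: "is_primitive B (wderiv b)" "AE t in leb\<Omega>. b t = B t" using W1inf_primitive[OF b] .
  note v = interp_primitive[where U = U, OF x U(1)]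
  have v01: "?v 0 = 0" "?v 1 = 0"
    using interp_node[where U = U and k = 0, OF x] interp_node[where U = U and k = N, OF x] U x
    by (auto simp: mesh_def)
  have 0: "(LINT t|leb\<Omega>. wderiv b t * (?v t * ?v t) + B t * (?g t * ?v t + ?v t * ?g t)) = 0"
    using is_primitiveD[OF is_primitive_mult[OF B(1) is_primitive_mult[OF v v]], of 1] v01
    by (simp add: prim_1)
  have 0: "(LINT t|leb\<Omega>. b t * ?g t * ?v t + 1/2 * wderiv b t * (?v t * ?v t)) = 0"
  proof -
    have "(LINT t|leb\<Omega>. 2 * (b t * ?g t * ?v t + 1/2 * wderiv b t * (?v t * ?v t)))
        = (LINT t|leb\<Omega>. wderiv b t * (?v t * ?v t) + B t * (?g t * ?v t + ?v t * ?g t))"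
    proof (rule integral_cong_AE_leb)
      show "(\<lambda>t. 2 * (b t * ?g t * ?v t + 1/2 * wderiv b t * (?v t * ?v t))) \<in> borel_measurable leb\<Omega>"
        by (intro Linf_measurable Linf_add Linf_mult Linf_const bL IL)
      show "AE t in leb\<Omega>. 2 * (b t * ?g t * ?v t + 1/2 * wderiv b t * (?v t * ?v t))
          = wderiv b t * (?v t * ?v t) + B t * (?g t * ?v t + ?v t * ?g t)"
        using B(2) by eventually_elim (simp add: algebra_simps)
    qed
    also have "\<dots> = 0" by (rule 0)
    finally show ?thesis unfolding integral_mult_right_zero by simp
  qed
  define h where "h = (\<lambda>t. a t * (?g t)\<^sup>2 + (c t - 1/2 * wderiv b t) * (?v t)\<^sup>2)"
  have h: "integrable leb\<Omega> h"
    unfolding h_def power2_eq_square by (intro Linf_integrable Linf_add Linf_diff Linf_mult Linf_const L bL IL)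
  have fi: "integrable leb\<Omega> (\<lambda>t. f t * ?v t)" by (intro Linf_integrable Linf_mult L IL)
  have bi: "integrable leb\<Omega> (\<lambda>t. b t * ?g t * ?v t + 1/2 * wderiv b t * (?v t * ?v t))"
    by (intro Linf_integrable Linf_add Linf_mult Linf_const bL IL)
  have gi: "integrable leb\<Omega> (\<lambda>t. (?g t)\<^sup>2)"
    unfolding power2_eq_square by (intro Linf_integrable Linf_mult IL)
  have "galerkin a b c f N x U U = (LINT t|leb\<Omega>. (h t + (b t * ?g t * ?v t + 1/2 * wderiv b t * (?v t * ?v t))) - f t * ?v t)"
    unfolding galerkin_def h_def
    by (rule Bochner_Integration.integral_cong) (simp_all add: algebra_simps power2_eq_square)
  also have "\<dots> = (LINT t|leb\<Omega>. h t) - (LINT t|leb\<Omega>. f t * ?v t)"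
    unfolding Bochner_Integration.integral_diff[OF Bochner_Integration.integrable_add[OF h bi] fi]
      Bochner_Integration.integral_add[OF h bi] 0 by simp
  finally have eq: "galerkin a b c f N x U U = (LINT t|leb\<Omega>. h t) - (LINT t|leb\<Omega>. f t * ?v t)" .
  have "a0 * (LINT t|leb\<Omega>. (?g t)\<^sup>2) = (LINT t|leb\<Omega>. a0 * (?g t)\<^sup>2)" by simp
  also have "\<dots> \<le> (LINT t|leb\<Omega>. h t)"
  proof (rule integral_mono_AE[OF _ h])
    show "AE t in leb\<Omega>. a0 * (?g t)\<^sup>2 \<le> h t"
      using a0 cb
    proof eventually_elim
      case (elim t)
      have "a0 * (?g t)\<^sup>2 \<le> a t * (?g t)\<^sup>2" using elim by (intro mult_right_mono) auto
      moreover have "0 \<le> (c t - 1/2 * wderiv b t) * (?v t)\<^sup>2" using elim by (intro mult_nonneg_nonneg) auto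
      ultimately show ?case by (simp add: h_def)
    qed
  qed (use gi in simp)
  finally show ?thesis unfolding eq by simp
qed

lemma interp_bound:
  assumes x: "mesh N x" and U: "U 0 = 0" and t: "t \<in> {0..1}"
  shows "\<bar>interp N x U t\<bar> \<le> sqrt (LINT t|leb\<Omega>. (interp_deriv N x U t)\<^sup>2)"
proof -
  have "interp N x U 0 = 0" using interp_node[where U = U and k = 0, OF x U] U x by (simp add: mesh_def)
  then have "\<bar>interp N x U t\<bar> = \<bar>prim (interp_deriv N x U) t\<bar>"
    using is_primitiveD[OF interp_primitive[where U = U, OF x U] t] by simp
  also have "\<dots> \<le> (LINT t|leb\<Omega>. \<bar>interp_deriv N x U t\<bar>)"
    by (rule prim_bound[OF Linf_integrable[OF interp_deriv_Linf]])
  also have "\<dots> \<le> sqrt (LINT t|leb\<Omega>. (interp_deriv N x U t)\<^sup>2)"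
    by (rule integral_abs_le_Lp2[OF Linf_Lp2[OF interp_deriv_Linf]])
  finally show ?thesis .
qed

section \<open>Continuous dependence on mesh and nodal values\<close>

text \<open>Meshes \<open>X k\<close> with nodal values \<open>V k\<close> converge node by node to the mesh \<open>x\<close> with nodal values \<open>U\<close>.\<close>

context
  fixes N :: nat and X V :: "nat \<Rightarrow> nat \<Rightarrow> real" and x U :: "nat \<Rightarrow> real"
  assumes mX: "\<And>k. mesh N (X k)" and mx: "mesh N x"
    and Xx: "\<And>i. i \<le> N \<Longrightarrow> (\<lambda>k. X k i) \<longlonglongrightarrow> x i"
    and VU: "\<And>i. i \<le> N \<Longrightarrow> (\<lambda>k. V k i) \<longlonglongrightarrow> U i"
begin

lemma elem_len_tendsto: "i \<in> {1..N} \<Longrightarrow> (\<lambda>k. elem_len (X k) i) \<longlonglongrightarrow> elem_len x i"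
  unfolding elem_len_def by (intro tendsto_diff Xx) auto

lemma slope_tendsto: "i \<in> {1..N} \<Longrightarrow> (\<lambda>k. slope (X k) (V k) i) \<longlonglongrightarrow> slope x U i"
  unfolding slope_def using mesh_elem_len[OF mx, of i]
  by (intro tendsto_divide tendsto_diff VU elem_len_tendsto) auto

lemma elem_indicator_bconv:
  assumes i: "i \<in> {1..N}" shows "bconv (\<lambda>k. indicator (elem (X k) i)) (indicator (elem x i))"
  unfolding bconv_def
proof (intro conjI allI exI)
  have "indicat_real (elem y i) \<in> borel_measurable leb\<Omega>" for y
    by (rule Linf_measurable[OF indicator_Linf]) (simp add: elem_def)
  then show "indicat_real (elem (X k) i) \<in> borel_measurable leb\<Omega>"
    "indicat_real (elem x i) \<in> borel_measurable leb\<Omega>" for k by blast+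
  show "AE t in leb\<Omega>. \<bar>indicator (elem (X k) i) t\<bar> \<le> (1::real)" for k
    by (rule AE_I2) (auto simp: indicator_def)
  have l: "(\<lambda>k. X k (i - 1)) \<longlonglongrightarrow> x (i - 1)" "(\<lambda>k. X k i) \<longlonglongrightarrow> x i" using i by (auto intro: Xx)
  show "AE t in leb\<Omega>. (\<lambda>k. indicator (elem (X k) i) t) \<longlonglongrightarrow> (indicator (elem x i) t :: real)"
    using AE_leb_neq[of "x (i - 1)"] AE_leb_neq[of "x i"]
  proof eventually_elim
    case (elim t)
    have "\<forall>\<^sub>F k in sequentially. indicator (elem x i) t = (indicator (elem (X k) i) t :: real)"
    proof (cases "t \<in> elem x i")
      case True
      then have "x (i - 1) < t" "t < x i" by (simp_all add: elem_def)
      then have "\<forall>\<^sub>F k in sequentially. X k (i - 1) < t" "\<forall>\<^sub>F k in sequentially. t < X k i"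
        using order_tendstoD l by blast+
      then show ?thesis by eventually_elim (use True in \<open>simp add: elem_def\<close>)
    next
      case False
      then consider "t < x (i - 1)" | "x i < t" using elim by (auto simp: elem_def)
      then show ?thesis
      proof cases
        case 1
        then have "\<forall>\<^sub>F k in sequentially. t < X k (i - 1)" using order_tendstoD l by blast
        then show ?thesis by eventually_elim (use False in \<open>simp add: elem_def\<close>)
      next
        case 2
        then have "\<forall>\<^sub>F k in sequentially. X k i < t" using order_tendstoD l by blast
        then show ?thesis by eventually_elim (use False in \<open>simp add: elem_def\<close>)
      qed
    qed
    then show ?case by (rule Lim_transform_eventually[OF tendsto_const])
  qed
qed

lemma ramp_bconv:
  assumes i: "i \<in> {1..N}" shows "bconv (\<lambda>k. ramp (X k) i) (ramp x i)"
  unfolding bconv_def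
proof (intro conjI allI exI)
  have "ramp y i \<in> borel_measurable leb\<Omega>" for y
    unfolding ramp_def[abs_def]
    by (intro borel_imp_leb borel_measurable_continuous_onI continuous_intros)
  then show "ramp (X k) i \<in> borel_measurable leb\<Omega>" "ramp x i \<in> borel_measurable leb\<Omega>" for k by blast+
  show "AE t in leb\<Omega>. \<bar>ramp (X k) i t\<bar> \<le> 1" for k
  proof (rule AE_I2)
    fix t
    have "elem_len (X k) i \<le> 1"
      using mesh_elem_range[OF mX i, of k] by (simp add: elem_len_def)
    then show "\<bar>ramp (X k) i t\<bar> \<le> 1" by (auto simp: ramp_def)
  qed
  show "AE t in leb\<Omega>. (\<lambda>k. ramp (X k) i t) \<longlonglongrightarrow> ramp x i t"
    unfolding ramp_def
    by (intro AE_I2 tendsto_max tendsto_min tendsto_diff tendsto_const elem_len_tendsto[OF i] Xx) (use i in auto)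
qed

lemma interp_bconv: "bconv (\<lambda>k. interp N (X k) (V k)) (interp N x U)"
  unfolding interp_def[abs_def]
  by (intro bconv_sum bconv_mult bconv_scalar slope_tendsto ramp_bconv)

lemma interp_deriv_bconv: "bconv (\<lambda>k. interp_deriv N (X k) (V k)) (interp_deriv N x U)"
  unfolding interp_deriv_def[abs_def]
  by (intro bconv_sum bconv_mult bconv_scalar slope_tendsto elem_indicator_bconv)

end

lemma galerkin_tendsto:
  assumes L: "a \<in> Linf" "b \<in> Linf" "c \<in> Linf" "f \<in> Linf"
    and mX: "\<And>k. mesh N (X k)" and mx: "mesh N x"
    and Xx: "\<And>i. i \<le> N \<Longrightarrow> (\<lambda>k. X k i) \<longlonglongrightarrow> x i"
    and VU: "\<And>i. i \<le> N \<Longrightarrow> (\<lambda>k. V k i) \<longlonglongrightarrow> U i"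
  shows "(\<lambda>k. galerkin a b c f N (X k) (V k) W) \<longlonglongrightarrow> galerkin a b c f N x U W"
proof -
  note B = interp_bconv[OF mX mx Xx VU] interp_deriv_bconv[OF mX mx Xx VU]
    interp_bconv[OF mX mx Xx, of "\<lambda>_. W" W] interp_deriv_bconv[OF mX mx Xx, of "\<lambda>_. W" W]
  show ?thesis unfolding galerkin_def
    by (rule bconv_integral) (intro bconv_add bconv_diff bconv_mult bconv_fixed L B tendsto_const; assumption)
qed

lemma elem_avg_eq:
  assumes x: "mesh N x" and U: "U 0 = 0" and i: "i \<in> {1..N}"
  shows "elem_avg x (fe_resid a b c f (interp N x U)) i = sqrt (1 / elem_len x i *
    (LINT t|leb\<Omega>. indicator (elem x i) t * (f t + wderiv a t * interp_deriv N x U t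
       - b t * interp_deriv N x U t - c t * interp N x U t)\<^sup>2))"
proof -
  let ?r = "fe_resid a b c f (interp N x U)"
  let ?q = "\<lambda>t. f t + wderiv a t * interp_deriv N x U t - b t * interp_deriv N x U t - c t * interp N x U t"
  have sub: "elem x i \<subseteq> \<Omega>"
    using mesh_elem_range[OF x i] by (auto simp: elem_def)
  have m: "elem x i \<in> sets lebesgue" by (simp add: elem_def)
  have r: "?r t = ?q t" if "t \<in> elem x i" for t
    using DERIV_imp_deriv[OF interp_has_deriv[where U = U, OF x i that U]] by (simp add: fe_resid_def)
  have "(LINT t|lebesgue_on (elem x i). \<bar>?r t\<bar>\<^sup>2) = (LINT t|lebesgue. indicator (elem x i) t *\<^sub>R \<bar>?r t\<bar>\<^sup>2)"
    by (rule integral_restrict_space) (use m in simp)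
  also have "\<dots> = (LINT t|lebesgue. indicator \<Omega> t *\<^sub>R (indicator (elem x i) t * (?q t)\<^sup>2))"
    by (rule Bochner_Integration.integral_cong) (use sub r in \<open>auto simp: indicator_def\<close>)
  also have "\<dots> = (LINT t|leb\<Omega>. indicator (elem x i) t * (?q t)\<^sup>2)"
    by (rule integral_restrict_space[symmetric]) simp
  finally show ?thesis by (simp add: elem_avg_def)
qed

lemma elem_avg_tendsto:
  assumes L: "wderiv a \<in> Linf" "b \<in> Linf" "c \<in> Linf" "f \<in> Linf"
    and mX: "\<And>k. mesh N (X k)" and mx: "mesh N x"
    and Xx: "\<And>i. i \<le> N \<Longrightarrow> (\<lambda>k. X k i) \<longlonglongrightarrow> x i"
    and VU: "\<And>i. i \<le> N \<Longrightarrow> (\<lambda>k. V k i) \<longlonglongrightarrow> U i"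
    and V0: "\<And>k. V k 0 = 0" and U0: "U 0 = 0" and i: "i \<in> {1..N}"
  shows "(\<lambda>k. elem_avg (X k) (fe_resid a b c f (interp N (X k) (V k))) i)
    \<longlonglongrightarrow> elem_avg x (fe_resid a b c f (interp N x U)) i"
proof -
  note B = interp_bconv[OF mX mx Xx VU] interp_deriv_bconv[OF mX mx Xx VU]
    elem_indicator_bconv[where U = U and V = V, OF mX mx Xx VU i]
  have "bconv (\<lambda>k t. indicator (elem (X k) i) t * (f t + wderiv a t * interp_deriv N (X k) (V k) t
       - b t * interp_deriv N (X k) (V k) t - c t * interp N (X k) (V k) t)\<^sup>2)
     (\<lambda>t. indicator (elem x i) t * (f t + wderiv a t * interp_deriv N x U t
       - b t * interp_deriv N x U t - c t * interp N x U t)\<^sup>2)"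
    unfolding power2_eq_square
    by (intro bconv_add bconv_diff bconv_mult bconv_fixed L B; assumption)
  from bconv_integral[OF this] show ?thesis
    unfolding elem_avg_eq[where U = U, OF mx U0 i] elem_avg_eq[where U = "V k" for k, OF mX V0 i]
    using mesh_elem_len[OF mx i]
    by (intro tendsto_real_sqrt tendsto_mult tendsto_divide tendsto_const elem_len_tendsto[where U = U and V = V, OF mX mx Xx VU i]) auto
qed

section \<open>Brouwer's theorem on a coordinate box\<close>

lemma bounded_coordinates_subseq:
  fixes X :: "nat \<Rightarrow> 'i \<Rightarrow> real"
  assumes "finite I" "\<And>k i. i \<in> I \<Longrightarrow> X k i \<in> {lo i..hi i}"
  shows "\<exists>r L. strict_mono (r :: nat \<Rightarrow> nat) \<and> (\<forall>i\<in>I. (\<lambda>k. X (r k) i) \<longlonglongrightarrow> L i)"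
  using assms
proof (induction I rule: finite_induct)
  case empty
  then show ?case by (auto intro!: exI[of _ id] strict_mono_id)
next
  case (insert i I)
  then obtain r L where r: "strict_mono r" "\<forall>i\<in>I. (\<lambda>k. X (r k) i) \<longlonglongrightarrow> L i" by auto
  have "bounded (range (\<lambda>k. X (r k) i))"
    using insert.prems by (intro bounded_subset[OF bounded_closed_interval[of "lo i" "hi i"]]) auto
  then obtain l s where s: "strict_mono s" "((\<lambda>k. X (r k) i) \<circ> s) \<longlonglongrightarrow> l"
    using bounded_imp_convergent_subsequence by blast
  have "\<forall>j\<in>insert i I. (\<lambda>k. X ((r \<circ> s) k) j) \<longlonglongrightarrow> (L(i := l)) j"
  proof
    fix j assume j: "j \<in> insert i I"
    show "(\<lambda>k. X ((r \<circ> s) k) j) \<longlonglongrightarrow> (L(i := l)) j"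
    proof (cases "j = i")
      case True
      then show ?thesis using s(2) by (simp add: o_def)
    next
      case False
      then have "(\<lambda>k. X (r k) j) \<longlonglongrightarrow> L j" using r(2) j by simp
      from LIMSEQ_subseq_LIMSEQ[OF this s(1)] show ?thesis using False by (simp add: o_def)
    qed
  qed
  moreover have "strict_mono (r \<circ> s)" using r(1) s(1) by (rule strict_mono_o)
  ultimately show ?case by blast
qed

text \<open>The dimension is the cardinality of a finite index set rather than that of a type, so that it
  may vary inside a statement. Continuity is sequential and coordinatewise. On the grid with \<open>p\<close>
  cells in each direction, Kuhn's lemma gives a cell on which, for every coordinate \<open>i\<close>, the map
  does not decrease coordinate \<open>i\<close> of one vertex and does not increase that of another one; a limit
  point of these cells for \<open>p\<close> tending to infinity is fixed.\<close>

theorem brouwer_box: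
  fixes T :: "('i \<Rightarrow> real) \<Rightarrow> 'i \<Rightarrow> real"
  assumes fin: "finite I" and lohi: "\<And>i. i \<in> I \<Longrightarrow> lo i \<le> hi i"
    and self: "\<And>y i. (\<And>j. j \<in> I \<Longrightarrow> y j \<in> {lo j..hi j}) \<Longrightarrow> i \<in> I \<Longrightarrow> T y i \<in> {lo i..hi i}"
    and cont: "\<And>Y y i. (\<And>k j. j \<in> I \<Longrightarrow> Y k j \<in> {lo j..hi j}) \<Longrightarrow>
       (\<And>j. j \<in> I \<Longrightarrow> (\<lambda>k::nat. Y k j) \<longlonglongrightarrow> y j) \<Longrightarrow> i \<in> I \<Longrightarrow> (\<lambda>k. T (Y k) i) \<longlonglongrightarrow> T y i"
  shows "\<exists>y. (\<forall>i\<in>I. y i \<in> {lo i..hi i}) \<and> (\<forall>i\<in>I. T y i = y i)"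
proof -
  define n where "n = card I"
  obtain e where e: "bij_betw e I {0..<n}" using ex_bij_betw_finite_nat[OF fin] unfolding n_def by blast
  define g where "g = inv_into I e"
  have g: "g m \<in> I" "e (g m) = m" if "m < n" for m
    using that e unfolding g_def bij_betw_def by (auto intro: inv_into_into f_inv_into_f)
  have e': "e j < n" "g (e j) = j" if "j \<in> I" for j
    using that e unfolding g_def bij_betw_def by auto
  define pt where "pt = (\<lambda>(p::nat) (x::nat \<Rightarrow> nat) j. lo j + (hi j - lo j) * (real (x (e j)) / real p))"
  have pt_box: "pt p x j \<in> {lo j..hi j}" if "0 < p" "\<forall>m<n. x m \<le> p" "j \<in> I" for p x j
  proof -
    have "real (x (e j)) / real p \<le> 1" using that e' by simp
    then have "(hi j - lo j) * (real (x (e j)) / real p) \<le> hi j - lo j"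
      using lohi[OF that(3)] by (intro mult_left_le) auto
    moreover have "0 \<le> (hi j - lo j) * (real (x (e j)) / real p)" using lohi[OF that(3)] by simp
    ultimately show ?thesis by (simp add: pt_def)
  qed
  \<comment> \<open>Label \<open>0\<close> means that coordinate \<open>m\<close> is not decreased, label \<open>1\<close> that it is not increased; on the
    faces of the box both may hold, and the label is the one that Kuhn's lemma prescribes.\<close>
  define lab where "lab = (\<lambda>p x m. if x m = p \<or> (x m \<noteq> 0 \<and> T (pt p x) (g m) < pt p x (g m)) then 1 else (0::nat))"
  have lab0: "pt p x (g m) \<le> T (pt p x) (g m)"
    if "lab p x m = 0" "0 < p" "\<forall>m<n. x m \<le> p" "m < n" for p x m
  proof (cases "x m = 0")
    case True
    then have "pt p x (g m) = lo (g m)" using g that by (simp add: pt_def)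
    then show ?thesis using self[of "pt p x" "g m"] pt_box that g by auto
  next
    case False
    then show ?thesis using that(1) by (auto simp: lab_def split: if_splits)
  qed
  have lab1: "T (pt p x) (g m) \<le> pt p x (g m)"
    if "lab p x m = 1" "0 < p" "\<forall>m<n. x m \<le> p" "m < n" for p x m
  proof (cases "x m = p")
    case True
    then have "pt p x (g m) = hi (g m)" using g that by (simp add: pt_def)
    then show ?thesis using self[of "pt p x" "g m"] pt_box that g by auto
  next
    case False
    then show ?thesis using that(1) by (auto simp: lab_def split: if_splits)
  qed
  \<comment> \<open>The vertices \<open>b\<close> and \<open>c\<close> belong to the cell at \<open>a\<close>; \<open>T\<close> does not decrease coordinate \<open>i\<close> of \<open>b\<close> and does
    not increase that of \<open>c\<close>.\<close>
  define Q where "Q = (\<lambda>k a i b c.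
      (\<forall>j\<in>I. b j \<in> {lo j..hi j} \<and> \<bar>b j - a j\<bar> \<le> (hi j - lo j) * (1 / real (Suc k))) \<and>
      (\<forall>j\<in>I. c j \<in> {lo j..hi j} \<and> \<bar>c j - a j\<bar> \<le> (hi j - lo j) * (1 / real (Suc k))) \<and>
      b i \<le> T b i \<and> T c i \<le> c i)"
  have "\<exists>a. (\<forall>j\<in>I. a j \<in> {lo j..hi j}) \<and> (\<forall>i\<in>I. \<exists>b c. Q k a i b c)" for k
  proof -
    let ?p = "Suc k"
    obtain q where q: "\<forall>m<n. q m < ?p" and rs: "\<forall>m<n. \<exists>r s. (\<forall>j<n. q j \<le> r j \<and> r j \<le> q j + 1) \<and>
        (\<forall>j<n. q j \<le> s j \<and> s j \<le> q j + 1) \<and> lab ?p r m \<noteq> lab ?p s m"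
    proof (rule kuhn_lemma[of ?p n "lab ?p"])
      show "\<forall>x. (\<forall>i<n. x i \<le> ?p) \<longrightarrow> (\<forall>i<n. lab ?p x i = 0 \<or> lab ?p x i = 1)"
        by (simp add: lab_def)
      show "\<forall>x. (\<forall>i<n. x i \<le> ?p) \<longrightarrow> (\<forall>i<n. x i = 0 \<longrightarrow> lab ?p x i = 0)"
        by (simp add: lab_def)
      show "\<forall>x. (\<forall>i<n. x i \<le> ?p) \<longrightarrow> (\<forall>i<n. x i = ?p \<longrightarrow> lab ?p x i = 1)"
        by (simp add: lab_def)
    qed auto
    have near: "\<bar>pt ?p r j - pt ?p q j\<bar> \<le> (hi j - lo j) * (1 / real ?p)"
      if "\<forall>j<n. q j \<le> r j \<and> r j \<le> q j + 1" "j \<in> I" for r j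
    proof -
      have d: "q (e j) \<le> r (e j)" "r (e j) \<le> q (e j) + 1" using that e' by auto
      have "pt ?p r j - pt ?p q j = (hi j - lo j) * ((real (r (e j)) - real (q (e j))) / real ?p)"
        by (simp add: pt_def algebra_simps diff_divide_distrib)
      moreover have "\<bar>(real (r (e j)) - real (q (e j))) / real ?p\<bar> \<le> 1 / real ?p"
        unfolding abs_divide using d by (intro divide_right_mono frac_le) auto
      ultimately show ?thesis
        using lohi[OF that(2)] by (simp only: abs_mult) (intro mult_mono, auto)
    qed
    have "\<exists>b c. Q k (pt ?p q) i b c" if i: "i \<in> I" for i
    proof -
      obtain r s where r: "\<forall>j<n. q j \<le> r j \<and> r j \<le> q j + 1" and s: "\<forall>j<n. q j \<le> s j \<and> s j \<le> q j + 1"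
        and ne: "lab ?p r (e i) \<noteq> lab ?p s (e i)"
        using rs e'[OF i] by blast
      have "\<exists>b c. (\<forall>j<n. q j \<le> b j \<and> b j \<le> q j + 1) \<and> (\<forall>j<n. q j \<le> c j \<and> c j \<le> q j + 1) \<and>
          lab ?p b (e i) = 0 \<and> lab ?p c (e i) = 1"
      proof (cases "lab ?p r (e i) = 0")
        case True
        then have "lab ?p s (e i) = 1" using ne by (simp add: lab_def split: if_splits)
        then show ?thesis using True r s by blast
      next
        case False
        then have "lab ?p r (e i) = 1" "lab ?p s (e i) = 0" using ne by (simp_all add: lab_def split: if_splits)
        then show ?thesis using r s by blast
      qed
      then obtain b c where b: "\<forall>j<n. q j \<le> b j \<and> b j \<le> q j + 1" "lab ?p b (e i) = 0"
        and c: "\<forall>j<n. q j \<le> c j \<and> c j \<le> q j + 1" "lab ?p c (e i) = 1" by blast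
      have le: "\<forall>m<n. b m \<le> ?p" "\<forall>m<n. c m \<le> ?p"
        using q b(1) c(1) by (metis Suc_eq_plus1 Suc_leI le_trans)+
      show ?thesis
        using near[OF b(1)] near[OF c(1)] pt_box[OF _ le(1)] pt_box[OF _ le(2)]
          lab0[OF b(2) _ le(1) e'(1)[OF i]] lab1[OF c(2) _ le(2) e'(1)[OF i]] e'(2)[OF i]
        unfolding Q_def by (intro exI[of _ "pt ?p b"] exI[of _ "pt ?p c"]) auto
    qed
    moreover have "\<forall>j\<in>I. pt ?p q j \<in> {lo j..hi j}"
    proof
      fix j assume "j \<in> I"
      have "\<forall>m<n. q m \<le> ?p" using q by (auto intro: less_imp_le)
      then show "pt ?p q j \<in> {lo j..hi j}" by (rule pt_box[OF zero_less_Suc _ \<open>j \<in> I\<close>])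
    qed
    ultimately show ?thesis by blast
  qed
  then obtain a where a: "\<And>k j. j \<in> I \<Longrightarrow> a k j \<in> {lo j..hi j}"
    and ex: "\<And>k i. i \<in> I \<Longrightarrow> \<exists>b c. Q k (a k) i b c" by metis
  define b where "b = (\<lambda>k i. SOME b. \<exists>c. Q k (a k) i b c)"
  define c where "c = (\<lambda>k i. SOME c. Q k (a k) i (b k i) c)"
  have "Q k (a k) i (b k i) (c k i)" if "i \<in> I" for k i
  proof -
    have "\<exists>c. Q k (a k) i (b k i) c"
      unfolding b_def by (rule someI_ex[OF ex[OF that]])
    then show ?thesis unfolding c_def by (rule someI_ex)
  qed
  then have
    b: "\<And>k i j. i \<in> I \<Longrightarrow> j \<in> I \<Longrightarrow> b k i j \<in> {lo j..hi j}"
       "\<And>k i j. i \<in> I \<Longrightarrow> j \<in> I \<Longrightarrow> \<bar>b k i j - a k j\<bar> \<le> (hi j - lo j) * (1 / real (Suc k))"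
    and c: "\<And>k i j. i \<in> I \<Longrightarrow> j \<in> I \<Longrightarrow> c k i j \<in> {lo j..hi j}"
       "\<And>k i j. i \<in> I \<Longrightarrow> j \<in> I \<Longrightarrow> \<bar>c k i j - a k j\<bar> \<le> (hi j - lo j) * (1 / real (Suc k))"
    and bT: "\<And>k i. i \<in> I \<Longrightarrow> b k i i \<le> T (b k i) i" and cT: "\<And>k i. i \<in> I \<Longrightarrow> T (c k i) i \<le> c k i i"
    unfolding Q_def by blast+
  obtain r L where r: "strict_mono r" and L: "\<And>i. i \<in> I \<Longrightarrow> (\<lambda>k. a (r k) i) \<longlonglongrightarrow> L i"
    using bounded_coordinates_subseq[of I a lo hi] fin a by blast
  have small: "(\<lambda>k. (hi j - lo j) * (1 / real (Suc (r k)))) \<longlonglongrightarrow> 0" for j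
  proof -
    have "(\<lambda>k. (hi j - lo j) * inverse (real (Suc k))) \<longlonglongrightarrow> (hi j - lo j) * 0"
      by (intro tendsto_mult tendsto_const LIMSEQ_inverse_real_of_nat)
    from LIMSEQ_subseq_LIMSEQ[OF this r] show ?thesis by (simp add: o_def inverse_eq_divide)
  qed
  have lim: "(\<lambda>k. d (r k) j) \<longlonglongrightarrow> L j"
    if "\<And>k. \<bar>d k j - a k j\<bar> \<le> (hi j - lo j) * (1 / real (Suc k))" "j \<in> I" for d j
  proof -
    have "(\<lambda>k. d (r k) j - a (r k) j) \<longlonglongrightarrow> 0"
      by (rule Lim_null_comparison[OF _ small[of j]]) (use that in auto)
    from tendsto_add[OF this L[OF that(2)]] show ?thesis by simp
  qed
  have "T L i = L i" if i: "i \<in> I" for i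
  proof (rule antisym)
    have bl: "(\<lambda>k. b (r k) i j) \<longlonglongrightarrow> L j" and cl: "(\<lambda>k. c (r k) i j) \<longlonglongrightarrow> L j" if "j \<in> I" for j
      using lim[of "\<lambda>k. b k i" j] lim[of "\<lambda>k. c k i" j] b(2) c(2) i that by auto
    have "(\<lambda>k. T (b (r k) i) i) \<longlonglongrightarrow> T L i"
      by (rule cont) (use i b(1) bl in auto)
    from LIMSEQ_le[OF bl[OF i] this] show "L i \<le> T L i" using bT[OF i] by auto
    have "(\<lambda>k. T (c (r k) i) i) \<longlonglongrightarrow> T L i"
      by (rule cont) (use i c(1) cl in auto)
    from LIMSEQ_le[OF this cl[OF i]] show "T L i \<le> L i" using cT[OF i] by auto
  qed
  moreover have "L i \<in> {lo i..hi i}" if "i \<in> I" for i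
    using L[OF that] a[OF that] by (auto intro: LIMSEQ_le_const LIMSEQ_le_const2)
  ultimately show ?thesis by blast
qed

section \<open>Fixed point of the mesh equidistribution map\<close>

text \<open>Here \<open>\<rho>\<close> is any mesh density and \<open>G = 0\<close> any system of discrete equations for the interior nodal
  values, both continuous in mesh and nodal values. With \<open>F i = \<rho> i * h i - \<sigma> / N\<close>, the map
  \<open>h \<mapsto> h - F / R\<close> keeps \<open>\<Sum> h = 1\<close>. Since \<open>h i - F i / R = h i * (1 - \<rho> i / R) + \<sigma> / (N * R)\<close>, the
  bounds \<open>1 \<le> \<rho> \<le> R\<close> and \<open>1 \<le> \<sigma> \<le> 2\<close> give that it also keeps \<open>1 / (R * N) \<le> h i \<le> 2 / N\<close>.
  The nodal values are moved by \<open>- G\<close> and clipped to \<open>[-M, M]\<close>. Where clipping is active at a fixed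
  point, \<open>U j * G j < 0\<close>, so the coercivity hypothesis excludes it.\<close>

lemma S_mesh_fixed_point:
  fixes \<rho> G :: "(nat \<Rightarrow> real) \<Rightarrow> (nat \<Rightarrow> real) \<Rightarrow> nat \<Rightarrow> real"
  assumes N: "0 < N" and R: "1 < R" and M: "0 < M"
    and \<rho>_bounds: "\<And>x U i. x \<in> S_mesh R N \<Longrightarrow> U 0 = 0 \<Longrightarrow> U N = 0 \<Longrightarrow> i \<in> {1..N} \<Longrightarrow> 1 \<le> \<rho> x U i \<and> \<rho> x U i \<le> R"
    and \<rho>_sum: "\<And>x U. x \<in> S_mesh R N \<Longrightarrow> U 0 = 0 \<Longrightarrow> U N = 0 \<Longrightarrow> (\<Sum>i=1..N. \<rho> x U i * elem_len x i) \<le> 2"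
    and \<rho>_cont: "\<And>X x V U i. (\<And>k::nat. X k \<in> S_mesh R N) \<Longrightarrow> x \<in> S_mesh R N \<Longrightarrow>
       (\<And>k. V k 0 = 0 \<and> V k N = 0) \<Longrightarrow> U 0 = 0 \<Longrightarrow> U N = 0 \<Longrightarrow>
       (\<And>i. i \<le> N \<Longrightarrow> (\<lambda>k. X k i) \<longlonglongrightarrow> x i) \<Longrightarrow> (\<And>i. i \<le> N \<Longrightarrow> (\<lambda>k. V k i) \<longlonglongrightarrow> U i) \<Longrightarrow>
       i \<in> {1..N} \<Longrightarrow> (\<lambda>k. \<rho> (X k) (V k) i) \<longlonglongrightarrow> \<rho> x U i"
    and G_cont: "\<And>X x V U i. (\<And>k::nat. X k \<in> S_mesh R N) \<Longrightarrow> x \<in> S_mesh R N \<Longrightarrow>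
       (\<And>k. V k 0 = 0 \<and> V k N = 0) \<Longrightarrow> U 0 = 0 \<Longrightarrow> U N = 0 \<Longrightarrow>
       (\<And>i. i \<le> N \<Longrightarrow> (\<lambda>k. X k i) \<longlonglongrightarrow> x i) \<Longrightarrow> (\<And>i. i \<le> N \<Longrightarrow> (\<lambda>k. V k i) \<longlonglongrightarrow> U i) \<Longrightarrow>
       i \<in> {1..<N} \<Longrightarrow> (\<lambda>k. G (X k) (V k) i) \<longlonglongrightarrow> G x U i"
    and G_coercive: "\<And>x U j. x \<in> S_mesh R N \<Longrightarrow> U 0 = 0 \<Longrightarrow> U N = 0 \<Longrightarrow>
       (\<Sum>j\<in>{1..<N}. U j * G x U j) \<le> 0 \<Longrightarrow> j \<in> {1..<N} \<Longrightarrow> \<bar>U j\<bar> < M"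
  shows "\<exists>x\<in>S_mesh R N. \<exists>U. U 0 = 0 \<and> U N = 0 \<and> (\<forall>j\<in>{1..<N}. G x U j = 0) \<and>
    (\<forall>i\<in>{1..N}. \<rho> x U i * elem_len x i = (\<Sum>i=1..N. \<rho> x U i * elem_len x i) / real N)"
proof -
  define l m where "l = 1 / (R * real N)" and "m = 2 / real N"
  have Nl: "real N * l = 1 / R" and Nm: "real N * m = 2" using N by (auto simp: l_def m_def)
  have lm: "0 < l" "l \<le> m" using N R by (auto simp: l_def m_def field_simps)
  have R1: "0 < 1 - 1 / R" using R by simp
  define s where "s = (\<lambda>y::nat + nat \<Rightarrow> real. \<Sum>i=1..N. y (Inl i))"
  \<comment> \<open>A retraction of the box \<open>[l, m]\<close> in \<open>N\<close> dimensions onto its section by the hyperplane of coordinate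
    sum \<open>1\<close>: where the sum is less than \<open>1\<close>, move towards the corner \<open>m\<close>, whose sum is \<open>2\<close>; where it is
    greater, towards the corner \<open>l\<close>, whose sum is \<open>1 / R < 1\<close>.\<close>
  define P1 where "P1 = (\<lambda>y i. m - (m - y (Inl i)) / (2 - min (s y) 1))"
  define P where "P = (\<lambda>y i. l + (P1 y i - l) * ((1 - 1 / R) / (max (s y) 1 - 1 / R)))"
  define x where "x = (\<lambda>y i. \<Sum>k=1..i. P y k)"
  define U where "U = (\<lambda>y::nat + nat \<Rightarrow> real. \<lambda>j. if j \<in> {1..<N} then y (Inr j) else 0)"
  define \<sigma> where "\<sigma> = (\<lambda>y. \<Sum>i=1..N. \<rho> (x y) (U y) i * P y i)"
  \<comment> \<open>Coordinates \<open>Inl i\<close> are element lengths, coordinates \<open>Inr j\<close> are nodal values.\<close>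
  define T where "T = (\<lambda>y z. case z of Inl i \<Rightarrow> P y i - (\<rho> (x y) (U y) i * P y i - \<sigma> y / real N) / R
      | Inr j \<Rightarrow> max (- M) (min M (U y j - G (x y) (U y) j)))"
  define I where "I = Inl ` {1..N} \<union> Inr ` {1..<N}"
  define lo hi where "lo = (\<lambda>z::nat + nat. case z of Inl i \<Rightarrow> l | Inr j \<Rightarrow> - M)"
    and "hi = (\<lambda>z::nat + nat. case z of Inl i \<Rightarrow> m | Inr j \<Rightarrow> M)"
  have elem_len: "elem_len (x y) i = P y i" if "i \<in> {1..N}" for y i
    using that by (cases i) (auto simp: elem_len_def x_def)
  have sP1: "(\<Sum>i=1..N. P1 y i) = max (s y) 1" for y
  proof -
    have "(\<Sum>i=1..N. P1 y i) = real N * m - (real N * m - s y) / (2 - min (s y) 1)"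
      by (simp add: P1_def s_def sum_subtractf sum_divide_distrib[symmetric])
    also have "\<dots> = max (s y) 1" unfolding Nm by (auto simp: min_def max_def)
    finally show ?thesis .
  qed
  have sP: "(\<Sum>i=1..N. P y i) = 1" for y
  proof -
    have "(\<Sum>i=1..N. P y i) = (\<Sum>i=1..N. l) + ((\<Sum>i=1..N. P1 y i) - (\<Sum>i=1..N. l)) * ((1 - 1 / R) / (max (s y) 1 - 1 / R))"
      by (simp only: P_def sum.distrib sum_distrib_right[symmetric] sum_subtractf)
    also have "\<dots> = real N * l + (max (s y) 1 - real N * l) * ((1 - 1 / R) / (max (s y) 1 - 1 / R))"
      unfolding sP1 by simp
    also have "\<dots> = 1"
      unfolding Nl using R1 by (simp add: max_def)
    finally show ?thesis .
  qed
  have P_box: "P y i \<in> {l..m}" if "y (Inl i) \<in> {l..m}" for y i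
  proof -
    have "0 \<le> (m - y (Inl i)) / (2 - min (s y) 1)" using that by (intro divide_nonneg_nonneg) auto
    moreover have "(m - y (Inl i)) / (2 - min (s y) 1) \<le> (m - y (Inl i)) / 1"
      using that by (intro divide_left_mono) auto
    ultimately have P1: "l \<le> P1 y i" "P1 y i \<le> m" using that by (auto simp: P1_def)
    have k: "0 \<le> (1 - 1 / R) / (max (s y) 1 - 1 / R)" "(1 - 1 / R) / (max (s y) 1 - 1 / R) \<le> 1"
      using R1 by (auto simp: max_def)
    have "(P1 y i - l) * ((1 - 1 / R) / (max (s y) 1 - 1 / R)) \<le> P1 y i - l"
      using P1 k by (intro mult_left_le) auto
    moreover have "0 \<le> (P1 y i - l) * ((1 - 1 / R) / (max (s y) 1 - 1 / R))"
      using P1 k by (intro mult_nonneg_nonneg) auto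
    ultimately show ?thesis using P1 by (auto simp: P_def)
  qed
  have P_id: "P y i = y (Inl i)" if "s y = 1" for y i
    using that R by (simp add: P_def P1_def)
  have box: "y (Inl i) \<in> {l..m}" if "\<And>z. z \<in> I \<Longrightarrow> y z \<in> {lo z..hi z}" "i \<in> {1..N}" for y i
    using that(1)[of "Inl i"] that(2) by (auto simp: I_def lo_def hi_def)
  have x_S: "x y \<in> S_mesh R N" if "\<And>z. z \<in> I \<Longrightarrow> y z \<in> {lo z..hi z}" for y
  proof -
    have "P y i \<in> {l..m}" if "i \<in> {1..N}" for i using P_box box that \<open>\<And>z. z \<in> I \<Longrightarrow> _\<close> by blast
    note P' = this
    have "x y i < x y (Suc i)" if "i < N" for i
      using P'[of "Suc i"] that lm by (simp add: x_def)
    then have "mesh N (x y)" using sP by (simp add: mesh_def x_def)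
    then show ?thesis using P' elem_len by (auto simp: S_mesh_def l_def m_def)
  qed
  have U0: "U y 0 = 0" "U y N = 0" for y by (auto simp: U_def)
  have \<sigma>_eq: "\<sigma> y = (\<Sum>i=1..N. \<rho> (x y) (U y) i * elem_len (x y) i)" for y
    unfolding \<sigma>_def by (rule sum.cong) (simp_all add: elem_len)
  have "\<exists>y. (\<forall>z\<in>I. y z \<in> {lo z..hi z}) \<and> (\<forall>z\<in>I. T y z = y z)"
  proof (rule brouwer_box)
    show "finite I" by (simp add: I_def)
    show "lo z \<le> hi z" for z using lm M by (auto simp: lo_def hi_def split: sum.split)
  next
    fix y z assume y: "\<And>z. z \<in> I \<Longrightarrow> y z \<in> {lo z..hi z}" and z: "z \<in> I"
    have x: "x y \<in> S_mesh R N" by (rule x_S) (rule y)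
    have PB: "P y i \<in> {l..m}" if "i \<in> {1..N}" for i
      using y[of "Inl i"] that by (intro P_box) (simp add: I_def lo_def hi_def)
    from z consider i where "z = Inl i" "i \<in> {1..N}" | j where "z = Inr j" by (auto simp: I_def)
    then show "T y z \<in> {lo z..hi z}"
    proof cases
      case 1
      let ?r = "\<rho> (x y) (U y) i"
      have r: "1 \<le> ?r" "?r \<le> R" using \<rho>_bounds[OF x U0 1(2)] by auto
      have P: "l \<le> P y i" "P y i \<le> m" using PB[OF 1(2)] by auto
      have \<sigma>2: "\<sigma> y \<le> 2" unfolding \<sigma>_eq by (rule \<rho>_sum[OF x U0])
      have "(\<Sum>i=1..N. 1 * P y i) \<le> \<sigma> y"
        unfolding \<sigma>_def
      proof (rule sum_mono)
        fix i assume i: "i \<in> {1..N}"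
        then show "1 * P y i \<le> \<rho> (x y) (U y) i * P y i"
          using \<rho>_bounds[OF x U0 i] PB[OF i] lm by (intro mult_right_mono) auto
      qed
      then have \<sigma>1: "1 \<le> \<sigma> y" using sP by simp
      have T: "T y z = P y i * (1 - ?r / R) + \<sigma> y * l"
        using 1 N R by (simp add: T_def l_def field_simps)
      have "1 * l \<le> \<sigma> y * l" using \<sigma>1 lm by (intro mult_right_mono) auto
      moreover have "0 \<le> P y i * (1 - ?r / R)" using P lm r R by (intro mult_nonneg_nonneg) auto
      moreover have "P y i * (1 - ?r / R) \<le> m * (1 - 1 / R)"
        using P lm r R by (intro mult_mono) (auto simp: divide_right_mono)
      moreover have "\<sigma> y * l \<le> 2 * l" using \<sigma>2 lm by (intro mult_right_mono) auto
      moreover have "m * (1 - 1 / R) + 2 * l = m" using N R by (simp add: m_def l_def field_simps)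
      ultimately show ?thesis unfolding T using 1 by (simp add: lo_def hi_def)
    next
      case 2
      then show ?thesis using M by (auto simp: T_def lo_def hi_def)
    qed
  next
    fix Y y z assume Y: "\<And>k z. z \<in> I \<Longrightarrow> Y k z \<in> {lo z..hi z}"
      and Yy: "\<And>z. z \<in> I \<Longrightarrow> (\<lambda>k::nat. Y k z) \<longlonglongrightarrow> y z" and z: "z \<in> I"
    have y: "y z \<in> {lo z..hi z}" if "z \<in> I" for z
      using Yy[OF that] Y[OF that] by (auto intro: LIMSEQ_le_const LIMSEQ_le_const2)
    have Yl: "(\<lambda>k. Y k (Inl i)) \<longlonglongrightarrow> y (Inl i)" if "i \<in> {1..N}" for i
      using Yy that by (auto simp: I_def)
    have Yr: "(\<lambda>k. Y k (Inr i)) \<longlonglongrightarrow> y (Inr i)" if "i \<in> {1..<N}" for i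
      using Yy that by (auto simp: I_def)
    have s: "(\<lambda>k. s (Y k)) \<longlonglongrightarrow> s y" unfolding s_def by (intro tendsto_sum Yl)
    have ne: "2 - min (s y) 1 \<noteq> 0" "max (s y) 1 - 1 / R \<noteq> 0" using R1 by (auto simp: min_def max_def)
    have P: "(\<lambda>k. P (Y k) i) \<longlonglongrightarrow> P y i" if "i \<in> {1..N}" for i
      unfolding P_def P1_def by (intro tendsto_intros s Yl that ne)
    have X: "(\<lambda>k. x (Y k) i) \<longlonglongrightarrow> x y i" if "i \<le> N" for i
      unfolding x_def by (intro tendsto_sum P) (use that in auto)
    have V: "(\<lambda>k. U (Y k) i) \<longlonglongrightarrow> U y i" for i
      unfolding U_def using Yr by (cases "i \<in> {1..<N}") auto
    have rho: "(\<lambda>k. \<rho> (x (Y k)) (U (Y k)) i) \<longlonglongrightarrow> \<rho> (x y) (U y) i" if "i \<in> {1..N}" for i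
      using x_S[OF Y] x_S[OF y] U0 X V that by (intro \<rho>_cont) auto
    have g: "(\<lambda>k. G (x (Y k)) (U (Y k)) i) \<longlonglongrightarrow> G (x y) (U y) i" if "i \<in> {1..<N}" for i
      using x_S[OF Y] x_S[OF y] U0 X V that by (intro G_cont) auto
    have sg: "(\<lambda>k. \<sigma> (Y k)) \<longlonglongrightarrow> \<sigma> y" unfolding \<sigma>_def by (intro tendsto_sum tendsto_mult rho P)
    from z consider i where "z = Inl i" "i \<in> {1..N}" | j where "z = Inr j" "j \<in> {1..<N}" by (auto simp: I_def)
    then show "(\<lambda>k. T (Y k) z) \<longlonglongrightarrow> T y z"
    proof cases
      case 1
      then show ?thesis using R N
        by (auto simp: T_def intro!: tendsto_diff tendsto_divide tendsto_mult P rho sg)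
    next
      case 2
      then show ?thesis
        by (auto simp: T_def intro!: tendsto_max tendsto_min tendsto_diff g V)
    qed
  qed
  then obtain y where y: "\<And>z. z \<in> I \<Longrightarrow> y z \<in> {lo z..hi z}" and fixp: "\<And>z. z \<in> I \<Longrightarrow> T y z = y z" by blast
  have x: "x y \<in> S_mesh R N" by (rule x_S) (rule y)
  have y_eq: "y (Inl i) = P y i - (\<rho> (x y) (U y) i * P y i - \<sigma> y / real N) / R" if "i \<in> {1..N}" for i
    using fixp[of "Inl i"] that by (simp add: I_def T_def)
  have "s y = (\<Sum>i=1..N. P y i - (\<rho> (x y) (U y) i * P y i - \<sigma> y / real N) / R)"
    unfolding s_def by (rule sum.cong) (simp_all add: y_eq)
  also have "\<dots> = (\<Sum>i=1..N. P y i) - ((\<Sum>i=1..N. \<rho> (x y) (U y) i * P y i) - \<sigma> y) / R"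
    using N by (simp add: sum_subtractf sum_divide_distrib[symmetric])
  also have "\<dots> = 1" unfolding sP \<sigma>_def by simp
  finally have "s y = 1" .
  then have eq: "\<rho> (x y) (U y) i * elem_len (x y) i = (\<Sum>i=1..N. \<rho> (x y) (U y) i * elem_len (x y) i) / real N"
    if "i \<in> {1..N}" for i
    using y_eq[OF that] P_id R elem_len[OF that] by (simp add: \<sigma>_eq)
  let ?g = "\<lambda>j. G (x y) (U y) j"
  have Uj: "U y j = max (- M) (min M (U y j - ?g j))" if "j \<in> {1..<N}" for j
    using fixp[of "Inr j"] that by (simp add: I_def T_def U_def)
  have bd: "(0 < ?g j \<longrightarrow> U y j = - M) \<and> (?g j < 0 \<longrightarrow> U y j = M)" if "j \<in> {1..<N}" for j
    using Uj[OF that] M by (auto simp: max_def min_def split: if_splits)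
  have "(\<Sum>j\<in>{1..<N}. U y j * ?g j) \<le> 0"
  proof (rule sum_nonpos)
    fix j assume "j \<in> {1..<N}"
    then show "U y j * ?g j \<le> 0"
      using bd[of j] M by (cases "?g j" "0::real" rule: linorder_cases) (auto simp: mult_nonneg_nonpos)
  qed
  then have lt: "\<bar>U y j\<bar> < M" if "j \<in> {1..<N}" for j
    using G_coercive[where U = "U y", OF x U0 _ that] by blast
  have "?g j = 0" if "j \<in> {1..<N}" for j
    using bd[OF that] lt[OF that] M by (cases "?g j" "0::real" rule: linorder_cases) auto
  then show ?thesis using x U0 eq by blast
qed

section \<open>Norms and the bound on the mesh density\<close>

lemma Linf_norm_AE:
  assumes "v \<in> Linf" shows "AE x in leb\<Omega>. \<bar>v x\<bar> \<le> Linf_norm v" "0 \<le> Linf_norm v"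
proof -
  obtain C where C: "AE x in leb\<Omega>. \<bar>v x\<bar> \<le> C" using assms by (rule LinfE)
  let ?e = "esssup leb\<Omega> (\<lambda>x. ereal \<bar>v x\<bar>)"
  have m: "(\<lambda>x. ereal \<bar>v x\<bar>) \<in> borel_measurable leb\<Omega>" using assms by auto
  have le: "?e \<le> ereal C" by (rule esssup_I[OF m]) (use C in auto)
  have ae: "AE x in leb\<Omega>. ereal \<bar>v x\<bar> \<le> ?e" by (rule esssup_AE)
  have ge: "0 \<le> ?e"
  proof (rule ccontr)
    assume "\<not> 0 \<le> ?e"
    then have "AE x in leb\<Omega>. False"
      by (intro eventually_mono[OF ae]) (metis abs_ge_zero ereal_less_eq(5) order_trans)
    then have "(LINT x|leb\<Omega>. (1::real)) = 0" by (intro integral_eq_zero_AE) auto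
    then show False by simp
  qed
  then have eq: "ereal (Linf_norm v) = ?e" unfolding Linf_norm_def using le by (intro ereal_real') auto
  show "AE x in leb\<Omega>. \<bar>v x\<bar> \<le> Linf_norm v" using ae unfolding eq[symmetric] by simp
  show "0 \<le> Linf_norm v" using ge unfolding eq[symmetric] by simp
qed

lemma Linf_norm_pos:
  assumes "v \<in> Linf" "\<not> (AE x in leb\<Omega>. v x = 0)" shows "0 < Linf_norm v"
proof (rule ccontr)
  assume "\<not> 0 < Linf_norm v"
  then have "Linf_norm v \<le> 0" by simp
  have "AE x in leb\<Omega>. v x = 0" using Linf_norm_AE(1)[OF assms(1)]
    by eventually_elim (use \<open>Linf_norm v \<le> 0\<close> in auto)
  then show False using assms(2) by simp
qed

lemma Lp_norm_pos:
  assumes v: "v \<in> Linf" and v0: "\<not> (AE x in leb\<Omega>. v x = 0)" and p: "0 < p" shows "0 < Lp_norm p v"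
proof -
  obtain C where C: "0 \<le> C" "AE x in leb\<Omega>. \<bar>v x\<bar> \<le> C" using v by (rule LinfE)
  have "(\<lambda>x. \<bar>v x\<bar> powr p) \<in> Linf"
  proof (rule LinfI)
    show "(\<lambda>x. \<bar>v x\<bar> powr p) \<in> borel_measurable leb\<Omega>" using v by auto
    show "AE x in leb\<Omega>. \<bar>\<bar>v x\<bar> powr p\<bar> \<le> C powr p"
      using C(2) by eventually_elim (use p in \<open>auto intro: powr_mono2\<close>)
  qed
  then have i: "integrable leb\<Omega> (\<lambda>x. \<bar>v x\<bar> powr p)" by (rule Linf_integrable)
  have "(LINT x|leb\<Omega>. \<bar>v x\<bar> powr p) \<noteq> 0"
  proof
    assume "(LINT x|leb\<Omega>. \<bar>v x\<bar> powr p) = 0"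
    then have "AE x in leb\<Omega>. \<bar>v x\<bar> powr p = 0"
      by (subst (asm) integral_nonneg_eq_0_iff_AE[OF i]) auto
    then have "AE x in leb\<Omega>. v x = 0" by eventually_elim simp
    then show False using v0 by simp
  qed
  moreover have "0 \<le> (LINT x|leb\<Omega>. \<bar>v x\<bar> powr p)" by (rule integral_nonneg_AE) simp
  ultimately show ?thesis unfolding Lp_norm_def by simp
qed

lemma Lp2_norm_le_Linf_norm:
  assumes v: "v \<in> Linf" shows "Lp_norm 2 v \<le> Linf_norm v"
proof -
  have "(LINT x|leb\<Omega>. (v x)\<^sup>2) \<le> (LINT x|leb\<Omega>. (Linf_norm v)\<^sup>2)"
  proof (rule integral_mono_AE)
    show "integrable leb\<Omega> (\<lambda>x. (v x)\<^sup>2)" using Linf_Lp2[OF v] by (simp add: Lp2_iff)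
    show "integrable leb\<Omega> (\<lambda>x. (Linf_norm v)\<^sup>2)" by (rule Linf_integrable[OF Linf_const])
    show "AE x in leb\<Omega>. (v x)\<^sup>2 \<le> (Linf_norm v)\<^sup>2"
      using Linf_norm_AE(1)[OF v] by eventually_elim (use Linf_norm_AE(2)[OF v] in \<open>simp add: abs_le_square_iff[symmetric]\<close>)
  qed
  then have le: "(LINT x|leb\<Omega>. (v x)\<^sup>2) \<le> (Linf_norm v)\<^sup>2" by simp
  show ?thesis unfolding Lp2_norm
    using real_sqrt_le_mono[OF le] Linf_norm_AE(2)[OF v] by simp
qed

lemma cube_powr_third: assumes "0 \<le> w" shows "(w ^ 3) powr (1 / 3) = (w::real)"
proof -
  have "w ^ 3 = w powr 3" using assms by (simp add: powr_numeral)
  then have "(w ^ 3) powr (1 / 3) = w powr (3 * (1 / 3))" by (simp only: powr_powr)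
  then show ?thesis using assms by simp
qed

lemma powr_third_cube: assumes "0 \<le> y" shows "(y powr (1 / 3)) ^ 3 = (y::real)"
proof -
  have "(y powr (1 / 3)) ^ 3 = (y powr (1 / 3)) powr 3" by (simp add: powr_numeral)
  also have "\<dots> = y powr (1 / 3 * 3)" by (simp only: powr_powr)
  finally show ?thesis using assms by simp
qed

lemma square_powr_third: assumes "0 \<le> y" shows "(y\<^sup>2) powr (1 / 3) = (y::real) powr (2 / 3)"
proof -
  have "y\<^sup>2 = y powr 2" using assms by (simp add: powr_numeral)
  then have "(y\<^sup>2) powr (1 / 3) = y powr (2 * (1 / 3))" by (simp only: powr_powr)
  then show ?thesis by simp
qed

lemma powr_third_subadd:
  assumes "0 \<le> y" shows "(1 + y) powr (1 / 3) \<le> 1 + y powr (1 / 3 :: real)"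
proof -
  let ?w = "y powr (1 / 3)"
  have "1 + y \<le> (1 + ?w) ^ 3"
    using powr_third_cube[OF assms] by (simp add: power3_eq_cube algebra_simps)
  then have "(1 + y) powr (1 / 3) \<le> ((1 + ?w) ^ 3) powr (1 / 3)"
    using assms by (intro powr_mono2) auto
  also have "\<dots> = 1 + ?w" by (rule cube_powr_third) simp
  finally show ?thesis .
qed

lemma density_le:
  assumes "0 \<le> A" "0 < S"
  shows "(1 + A\<^sup>2 / S ^ 3) powr (1 / 3) \<le> 1 + A powr (2 / 3) / (S :: real)"
proof -
  have "(1 + A\<^sup>2 / S ^ 3) powr (1 / 3) \<le> 1 + (A\<^sup>2 / S ^ 3) powr (1 / 3)"
    using assms by (intro powr_third_subadd) auto
  also have "(A\<^sup>2 / S ^ 3) powr (1 / 3) = A powr (2 / 3) / S"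
    using assms by (simp add: powr_divide square_powr_third cube_powr_third)
  finally show ?thesis .
qed

text \<open>With \<open>z = \<gamma> * (L / P) powr (2/3)\<close> and \<open>R = (1 + z)\<^sup>2\<close>, the claim reduces to
  \<open>1 + z * (R + 1) powr (1/3) \<le> R\<close>, which holds because \<open>R + 1 \<le> (2 + z) ^ 3\<close>.\<close>

lemma density_le_rho0:
  fixes L P :: real
  assumes C: "0 < C1" "0 < C2" and L: "0 < L" and P: "0 < P"
    and R: "R = (1 + gamma_const C1 C2 * (L / P) powr (2 / 3))\<^sup>2"
    and A: "0 \<le> A" "A \<le> L * (1 + C1 * sqrt (R + 1) + C2)"
    and S: "1 / 2 * P powr (2 / 3) \<le> S"
  shows "(1 + A\<^sup>2 / S ^ 3) powr (1 / 3) \<le> R"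
proof -
  define z where "z = gamma_const C1 C2 * (L / P) powr (2 / 3)"
  have z: "0 \<le> z" by (simp add: z_def gamma_const_def)
  have Rz: "R = (1 + z)\<^sup>2" using R by (simp add: z_def)
  have R0: "0 \<le> R" by (simp add: Rz)
  have P': "0 < 1 / 2 * P powr (2 / 3)" using P by simp
  then have S0: "0 < S" using S by linarith
  have "A \<le> L * ((1 + C1 + C2) * sqrt (R + 1))"
  proof -
    have "1 \<le> sqrt (R + 1)" using R0 by simp
    then have "1 + C1 * sqrt (R + 1) + C2 \<le> (1 + C1 + C2) * sqrt (R + 1)"
      using C mult_left_mono[OF \<open>1 \<le> sqrt (R + 1)\<close>, of C2] unfolding distrib_right by linarith
    then have "L * (1 + C1 * sqrt (R + 1) + C2) \<le> L * ((1 + C1 + C2) * sqrt (R + 1))"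
      using L by simp
    then show ?thesis using A by linarith
  qed
  then have "A powr (2 / 3) \<le> (L * ((1 + C1 + C2) * sqrt (R + 1))) powr (2 / 3)"
    using A by (intro powr_mono2) auto
  also have "\<dots> = L powr (2 / 3) * ((1 + C1 + C2) powr (2 / 3) * (R + 1) powr (1 / 3))"
    using L C R0 by (simp add: powr_mult powr_half_sqrt[symmetric] powr_powr)
  also have "(R + 1) powr (1 / 3) \<le> 2 + z"
  proof -
    have "R + 1 \<le> (2 + z) ^ 3"
      using z by (simp add: Rz power2_eq_square power3_eq_cube algebra_simps)
    then have "(R + 1) powr (1 / 3) \<le> ((2 + z) ^ 3) powr (1 / 3)" using R0 by (intro powr_mono2) auto
    then show ?thesis using z by (simp add: cube_powr_third)
  qed
  finally have A': "A powr (2 / 3) \<le> L powr (2 / 3) * ((1 + C1 + C2) powr (2 / 3) * (2 + z))"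
    by (auto simp: mult_left_mono)
  have "A powr (2 / 3) / S \<le> L powr (2 / 3) * ((1 + C1 + C2) powr (2 / 3) * (2 + z)) / (1 / 2 * P powr (2 / 3))"
    using z A' S P' by (intro frac_le) auto
  also have "\<dots> = z * (2 + z)"
    using L P by (simp add: z_def gamma_const_def powr_divide field_simps)
  finally have "1 + A powr (2 / 3) / S \<le> R"
    by (simp add: Rz power2_eq_square algebra_simps)
  then show ?thesis using density_le[OF A(1) S0] by linarith
qed

section \<open>The equidistributing mesh\<close>

lemma resid_Linf:
  assumes "a \<in> W1inf" "b \<in> Linf" "c \<in> Linf" "f \<in> Linf" "u \<in> H2"
  shows "resid a b c f u \<in> Linf"
proof -
  have "u \<in> Linf" "wderiv u \<in> Linf" using assms(5) H1_Linf by (auto simp: H2_def)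
  then show ?thesis unfolding resid_def[abs_def]
    by (intro Linf_add Linf_diff Linf_mult W1inf_weak(2)[OF assms(1)] assms)
qed

lemma elem_avg_nonneg: "mesh N x \<Longrightarrow> i \<in> {1..N} \<Longrightarrow> 0 \<le> elem_avg x rh i"
  unfolding elem_avg_def
  by (intro real_sqrt_ge_zero mult_nonneg_nonneg integral_nonneg_AE)
    (auto dest: mesh_elem_len[of N x i])

lemma elem_avg_le:
  assumes x: "mesh N x" and U: "U 0 = 0" and i: "i \<in> {1..N}" and K: "0 \<le> K"
    and L: "wderiv a \<in> Linf" "b \<in> Linf" "c \<in> Linf" "f \<in> Linf"
    and le: "AE t in leb\<Omega>. \<bar>f t + wderiv a t * interp_deriv N x U t
       - b t * interp_deriv N x U t - c t * interp N x U t\<bar> \<le> K"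
  shows "elem_avg x (fe_resid a b c f (interp N x U)) i \<le> K"
proof -
  let ?q = "\<lambda>t. f t + wderiv a t * interp_deriv N x U t
       - b t * interp_deriv N x U t - c t * interp N x U t"
  have h: "0 < elem_len x i" by (rule mesh_elem_len[OF x i])
  have ind: "indicator (elem x i) \<in> Linf" by (rule indicator_Linf) (simp add: elem_def)
  have sub: "elem x i \<subseteq> \<Omega>" using mesh_elem_range[OF x i] by (auto simp: elem_def)
  have "(LINT t|leb\<Omega>. indicator (elem x i) t * (?q t)\<^sup>2) \<le> (LINT t|leb\<Omega>. indicator (elem x i) t * K\<^sup>2)"
  proof (rule integral_mono_AE)
    show "integrable leb\<Omega> (\<lambda>t. indicator (elem x i) t * (?q t)\<^sup>2)"
      unfolding power2_eq_square
      by (intro Linf_integrable Linf_add Linf_diff Linf_mult ind L interp_Linf interp_deriv_Linf)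
    show "integrable leb\<Omega> (\<lambda>t. indicator (elem x i) t * K\<^sup>2)"
      by (intro Linf_integrable Linf_mult Linf_const ind)
    show "AE t in leb\<Omega>. indicator (elem x i) t * (?q t)\<^sup>2 \<le> indicator (elem x i) t * K\<^sup>2"
      using le
    proof eventually_elim
      case (elim t)
      then have "(?q t)\<^sup>2 \<le> K\<^sup>2" using K by (simp add: abs_le_square_iff[symmetric])
      then show ?case by (intro mult_left_mono) auto
    qed
  qed
  also have "\<dots> = elem_len x i * K\<^sup>2"
  proof -
    have "measure leb\<Omega> (elem x i) = elem_len x i"
      using h sub by (subst measure_restrict_space) (auto simp: elem_def elem_len_def)
    moreover have "elem x i \<inter> space leb\<Omega> = elem x i" using sub by auto
    ultimately show ?thesis by simp
  qed
  finally have "1 / elem_len x i * (LINT t|leb\<Omega>. indicator (elem x i) t * (?q t)\<^sup>2) \<le> K\<^sup>2"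
    using h by (simp add: field_simps)
  then show ?thesis unfolding elem_avg_eq[where U = U, OF x U i] by (intro real_le_lsqrt K)
qed

text \<open>The a priori bound: coercivity controls the \<open>L\<^sup>2\<close> norm of the derivative, which
  dominates the maximum norm.\<close>

lemma galerkin_bounded:
  assumes L: "a \<in> Linf" "c \<in> Linf" "f \<in> Linf" and b: "b \<in> W1inf" and a0: "0 < a0"
    and a_ge: "AE t in leb\<Omega>. a0 \<le> a t" and cb: "AE t in leb\<Omega>. 0 \<le> c t - 1/2 * wderiv b t"
    and x: "mesh N x" and U: "U 0 = 0" "U N = 0"
    and le: "galerkin a b c f N x U U \<le> 0" and j: "j \<le> N"
  shows "\<bar>U j\<bar> \<le> Linf_norm f / a0"
proof -
  define E where "E = (LINT t|leb\<Omega>. (interp_deriv N x U t)\<^sup>2)"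
  have E: "0 \<le> E" unfolding E_def by (rule integral_nonneg_AE) simp
  have "(LINT t|leb\<Omega>. f t * interp N x U t) \<le> (LINT t|leb\<Omega>. Linf_norm f * sqrt E)"
  proof (rule integral_mono_AE)
    show "integrable leb\<Omega> (\<lambda>t. f t * interp N x U t)"
      by (intro Linf_integrable Linf_mult L interp_Linf)
    show "integrable leb\<Omega> (\<lambda>t. Linf_norm f * sqrt E)" by (rule Linf_integrable[OF Linf_const])
    show "AE t in leb\<Omega>. f t * interp N x U t \<le> Linf_norm f * sqrt E"
      using Linf_norm_AE(1)[OF L(3)] AE_leb_in
    proof eventually_elim
      case (elim t)
      have "f t * interp N x U t \<le> \<bar>f t\<bar> * \<bar>interp N x U t\<bar>"
        using abs_ge_self[of "f t * interp N x U t"] by (simp add: abs_mult)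
      also have "\<dots> \<le> Linf_norm f * sqrt E"
        using elim interp_bound[where U = U and t = t, OF x U(1)] Linf_norm_AE(2)[OF L(3)]
        by (intro mult_mono) (auto simp: E_def)
      finally show ?case .
    qed
  qed
  then have "a0 * E \<le> Linf_norm f * sqrt E"
    using galerkin_coercive[where U = U, OF L b a_ge cb x U] le unfolding E_def[symmetric] by simp
  then have "a0 * sqrt E * sqrt E \<le> Linf_norm f * sqrt E" using E by (simp add: mult.assoc)
  then have "a0 * sqrt E \<le> Linf_norm f"
    using E Linf_norm_AE(2)[OF L(3)] by (cases "E = 0") (auto dest: mult_right_le_imp_le)
  then have "sqrt E \<le> Linf_norm f / a0" using a0 by (simp add: field_simps)
  moreover have "\<bar>U j\<bar> \<le> sqrt E"
    using interp_bound[where U = U and t = "x j", OF x U(1)] interp_node[where U = U, OF x U(1) j]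
      mesh_range[OF x j] by (simp add: E_def)
  ultimately show ?thesis by linarith
qed

text \<open>The discrete residual differs from \<open>r\<close> by \<open>(b - a') * (u - u\<^sub>h)' + c * (u - u\<^sub>h)\<close>.\<close>

lemma fe_resid_bound:
  assumes a: "a \<in> W1inf" and L: "b \<in> Linf" "c \<in> Linf" "f \<in> Linf" and u: "u \<in> H2"
    and x: "mesh N x" and U: "U 0 = 0"
  shows "AE t in leb\<Omega>. \<bar>f t + wderiv a t * interp_deriv N x U t
       - b t * interp_deriv N x U t - c t * interp N x U t\<bar>
     \<le> Linf_norm (resid a b c f u)
       + Linf_norm (\<lambda>t. b t - wderiv a t) * Linf_norm (wderiv (\<lambda>t. u t - interp N x U t))
       + Linf_norm c * Linf_norm (\<lambda>t. u t - interp N x U t)"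
proof -
  let ?e = "\<lambda>t. u t - interp N x U t"
  have uH: "u \<in> H1" and wL: "wderiv u \<in> Linf" and uL: "u \<in> Linf"
    using u H1_Linf by (auto simp: H2_def)
  have aL: "wderiv a \<in> Linf" by (rule W1inf_weak(2)[OF a])
  have "has_weak_deriv ?e (\<lambda>t. wderiv u t - interp_deriv N x U t)"
    by (intro has_weak_deriv_diff H1_weak(1) uH has_weak_deriv_primitive interp_primitive x U)
  note wd = wderiv_AE[OF this]
  have eL: "?e \<in> Linf" by (intro Linf_diff uL interp_Linf)
  have dL: "wderiv ?e \<in> Linf"
    by (rule Linf_cong_AE[OF _ AE_leb_sym[OF wd]]) (intro Linf_diff wL interp_deriv_Linf)
  have baL: "(\<lambda>t. b t - wderiv a t) \<in> Linf" by (intro Linf_diff L aL)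
  have rL: "resid a b c f u \<in> Linf" by (rule resid_Linf[OF a L u])
  show ?thesis
    using wd Linf_norm_AE(1)[OF eL] Linf_norm_AE(1)[OF dL] Linf_norm_AE(1)[OF baL]
      Linf_norm_AE(1)[OF rL] Linf_norm_AE(1)[OF L(2)]
  proof eventually_elim
    case (elim t)
    let ?d = "wderiv ?e t"
    have eq: "f t + wderiv a t * interp_deriv N x U t - b t * interp_deriv N x U t - c t * interp N x U t
        = resid a b c f u t + ((b t - wderiv a t) * ?d + c t * ?e t)"
      unfolding elim(1) resid_def by (simp add: algebra_simps)
    have "\<bar>resid a b c f u t + ((b t - wderiv a t) * ?d + c t * ?e t)\<bar>
        \<le> \<bar>resid a b c f u t\<bar> + (\<bar>b t - wderiv a t\<bar> * \<bar>?d\<bar> + \<bar>c t\<bar> * \<bar>?e t\<bar>)"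
      unfolding abs_mult[symmetric] by (intro order_trans[OF abs_triangle_ineq] add_left_mono abs_triangle_ineq)
    also have "\<dots> \<le> Linf_norm (resid a b c f u) + (Linf_norm (\<lambda>t. b t - wderiv a t) * Linf_norm (wderiv ?e)
        + Linf_norm c * Linf_norm ?e)"
      using elim Linf_norm_AE(2)[OF baL] Linf_norm_AE(2)[OF L(2)] by (intro add_mono mult_mono) auto
    finally show ?case unfolding eq by (simp only: add.assoc)
  qed
qed

theorem theorem2p4:
  fixes a b c f u :: "real \<Rightarrow> real" and a0 C1 C2 :: real and N0 :: nat
  assumes a_W1inf: "a \<in> W1inf" and b_W1inf: "b \<in> W1inf"
    and c_Linf: "c \<in> Linf" and f_L2: "f \<in> Lp 2"
    and a0_pos: "0 < a0" and a_ge: "AE x in leb\<Omega>. a0 \<le> a x"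
    and coercive: "AE x in leb\<Omega>. 0 \<le> c x - 1/2 * wderiv b x"
    and f_nonzero: "\<not> (AE x in leb\<Omega>. f x = 0)"
    and u_sol: "weak_solution a b c f u"
    and C1_C2: "error_constants a b c C1 C2"
    and N0_pos: "0 < N0"
    and N0: "\<And>N x uh. N0 \<le> N \<Longrightarrow>
       x \<in> S_mesh (rho0 C1 C2 (resid a b c f u)) N \<Longrightarrow> fe_solution a b c f N x uh \<Longrightarrow>
         1/2 * Lp_norm (2/3) (resid a b c f u) powr (2/3)
           \<le> alpha_h N x (fe_resid a b c f uh) powr (1/3) \<and>
         alpha_h N x (fe_resid a b c f uh) powr (1/3)
           \<le> 3/2 * Lp_norm (2/3) (resid a b c f u) powr (2/3)"
    and f_Linf: "f \<in> Linf" and u_H2: "u \<in> H2"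
  shows "\<forall>N\<ge>N0. \<exists>x uh. mesh N x \<and> fe_solution a b c f N x uh \<and>
           equidistributing N x (fe_resid a b c f uh)"
proof (intro allI impI)
  fix N assume NN: "N0 \<le> N"
  then have N: "0 < N" using N0_pos by simp
  have aL: "a \<in> Linf" and bL: "b \<in> Linf" using a_W1inf b_W1inf by (simp_all add: W1inf_def)
  note L = aL bL c_Linf f_Linf and L' = W1inf_weak(2)[OF a_W1inf] bL c_Linf f_Linf
  define r where "r = resid a b c f u"
  have rL: "r \<in> Linf" unfolding r_def by (rule resid_Linf[OF a_W1inf bL c_Linf f_Linf u_H2])
  have r0: "\<not> (AE x in leb\<Omega>. r x = 0)" unfolding r_def
    by (rule resid_nonzero[OF a_W1inf bL c_Linf f_L2 a0_pos a_ge u_sol u_H2 f_nonzero])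
  define L P where "L = Linf_norm r" and "P = Lp_norm (2/3) r"
  have Lpos: "0 < L" unfolding L_def by (rule Linf_norm_pos[OF rL r0])
  have Ppos: "0 < P" unfolding P_def by (rule Lp_norm_pos[OF rL r0]) simp
  have C: "0 < C1" "0 < C2" using C1_C2 by (simp_all add: error_constants_def)
  define R where "R = rho0 C1 C2 r"
  have R_eq: "R = (1 + gamma_const C1 C2 * (L / P) powr (2 / 3))\<^sup>2"
    by (simp add: R_def rho0_def L_def P_def)
  \<comment> \<open>The residual does not vanish, so \<open>R\<close> is strictly greater than \<open>1\<close> and the threshold \<open>\<beta>\<close> below is
    positive.\<close>
  have "0 < gamma_const C1 C2 * (L / P) powr (2 / 3)"
    using C Lpos Ppos by (simp add: gamma_const_def)
  then have R: "1 < R" unfolding R_eq by (simp add: one_less_power)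
  define \<beta> where "\<beta> = 1/2 * P powr (2/3)"
  have \<beta>: "0 < \<beta>" using Ppos by (simp add: \<beta>_def)
  define A where "A = (\<lambda>x U. elem_avg x (fe_resid a b c f (interp N x U)))"
  define S where "S = (\<lambda>x U. \<Sum>i=1..N. elem_len x i * A x U i powr (2/3))"
  \<comment> \<open>For arbitrary nodal values \<open>\<alpha>\<^sub>h\<close> may vanish and the density may exceed \<open>R\<close>, so both are truncated;
    \<open>S\<close> is the cube root of \<open>\<alpha>\<^sub>h\<close>.\<close>
  define \<rho> where "\<rho> = (\<lambda>x U i. min R ((1 + (A x U i)\<^sup>2 / max (S x U) \<beta> ^ 3) powr (1/3)))"
  define G where "G = (\<lambda>x U j. galerkin a b c f N x U (unit_vec j))"
  define M where "M = Linf_norm f / a0 + 1"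
  have M: "0 < M" using Linf_norm_AE(2)[OF f_Linf] a0_pos unfolding M_def
    by (intro add_nonneg_pos divide_nonneg_pos) auto
  have S_meshD: "mesh N x" if "x \<in> S_mesh R N" for x using that by (simp add: S_mesh_def)
  have A0: "0 \<le> A x U i" if "x \<in> S_mesh R N" "i \<in> {1..N}" for x U i
    unfolding A_def by (rule elem_avg_nonneg[OF S_meshD[OF that(1)] that(2)])
  have "\<exists>x\<in>S_mesh R N. \<exists>U. U 0 = 0 \<and> U N = 0 \<and> (\<forall>j\<in>{1..<N}. G x U j = 0) \<and>
    (\<forall>i\<in>{1..N}. \<rho> x U i * elem_len x i = (\<Sum>i=1..N. \<rho> x U i * elem_len x i) / real N)"
  proof (rule S_mesh_fixed_point[OF N R M])
    fix x U i assume "x \<in> S_mesh R N" "i \<in> {1..N}"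
    have "1 powr (1/3) \<le> (1 + (A x U i)\<^sup>2 / max (S x U) \<beta> ^ 3) powr (1/3)"
      using \<beta> by (intro powr_mono2) auto
    then show "1 \<le> \<rho> x U i \<and> \<rho> x U i \<le> R" using R by (auto simp: \<rho>_def)
  next
    fix x U assume x: "x \<in> S_mesh R N"
    let ?S = "max (S x U) \<beta>"
    have S: "0 < ?S" using \<beta> by simp
    \<comment> \<open>By subadditivity of the cube root, \<open>\<sigma> \<le> \<Sum> h i + (\<Sum> h i * A i powr (2/3)) / S\<close>.\<close>
    have "(\<Sum>i=1..N. \<rho> x U i * elem_len x i)
        \<le> (\<Sum>i=1..N. elem_len x i + elem_len x i * A x U i powr (2/3) / ?S)"
    proof (rule sum_mono)
      fix i assume i: "i \<in> {1..N}"
      have "\<rho> x U i \<le> 1 + A x U i powr (2/3) / ?S"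
        unfolding \<rho>_def using density_le[OF A0[OF x i] S, of U] by linarith
      then have "\<rho> x U i * elem_len x i \<le> (1 + A x U i powr (2/3) / ?S) * elem_len x i"
        using mesh_elem_len[OF S_meshD[OF x] i] by (intro mult_right_mono) auto
      then show "\<rho> x U i * elem_len x i \<le> elem_len x i + elem_len x i * A x U i powr (2/3) / ?S"
        by (simp add: algebra_simps)
    qed
    also have "\<dots> = (\<Sum>i=1..N. elem_len x i) + S x U / ?S"
      by (simp add: sum.distrib S_def sum_divide_distrib)
    also have "(\<Sum>i=1..N. elem_len x i) = 1"
      unfolding elem_len_def telescope using S_meshD[OF x] by (simp add: mesh_def)
    also have "S x U / ?S \<le> 1" using S by (simp add: divide_le_eq)
    finally show "(\<Sum>i=1..N. \<rho> x U i * elem_len x i) \<le> 2" by simp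
  next
    fix X V :: "nat \<Rightarrow> nat \<Rightarrow> real" and x U :: "nat \<Rightarrow> real" and i :: nat
    assume X: "\<And>k::nat. X k \<in> S_mesh R N" and x: "x \<in> S_mesh R N" and V: "\<And>k. V k 0 = 0 \<and> V k N = 0"
      and U: "U 0 = 0" "U N = 0" and Xx: "\<And>i. i \<le> N \<Longrightarrow> (\<lambda>k. X k i) \<longlonglongrightarrow> x i"
      and VU: "\<And>i. i \<le> N \<Longrightarrow> (\<lambda>k. V k i) \<longlonglongrightarrow> U i" and i: "i \<in> {1..N}"
    have At: "(\<lambda>k. A (X k) (V k) i) \<longlonglongrightarrow> A x U i" if "i \<in> {1..N}" for i
      unfolding A_def using V U(1) by (intro elem_avg_tendsto L' S_meshD X x Xx VU that) auto
    have "(\<lambda>k. S (X k) (V k)) \<longlonglongrightarrow> S x U"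
      unfolding S_def
    proof (intro tendsto_sum tendsto_mult)
      fix i assume i: "i \<in> {1..N}"
      show "(\<lambda>k. elem_len (X k) i) \<longlonglongrightarrow> elem_len x i"
        unfolding elem_len_def by (intro tendsto_diff Xx) (use i in auto)
      show "(\<lambda>k. A (X k) (V k) i powr (2/3)) \<longlonglongrightarrow> A x U i powr (2/3)"
        by (rule tendsto_powr2[OF At[OF i] tendsto_const]) (use A0[OF X i] in auto)
    qed
    then show "(\<lambda>k. \<rho> (X k) (V k) i) \<longlonglongrightarrow> \<rho> x U i"
      unfolding \<rho>_def
    proof (intro tendsto_min tendsto_const tendsto_powr tendsto_add tendsto_divide tendsto_power tendsto_max At[OF i])
      have "0 \<le> (A x U i)\<^sup>2 / max (S x U) \<beta> ^ 3" using \<beta> by (intro divide_nonneg_nonneg) auto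
      then show "1 + (A x U i)\<^sup>2 / max (S x U) \<beta> ^ 3 \<noteq> 0" by linarith
      show "max (S x U) \<beta> ^ 3 \<noteq> 0" using \<beta> by (simp add: max_def)
    qed
  next
    fix X V :: "nat \<Rightarrow> nat \<Rightarrow> real" and x U :: "nat \<Rightarrow> real" and i :: nat
    assume X: "\<And>k::nat. X k \<in> S_mesh R N" and x: "x \<in> S_mesh R N"
      and Xx: "\<And>i. i \<le> N \<Longrightarrow> (\<lambda>k. X k i) \<longlonglongrightarrow> x i"
      and VU: "\<And>i. i \<le> N \<Longrightarrow> (\<lambda>k. V k i) \<longlonglongrightarrow> U i"
    show "(\<lambda>k. G (X k) (V k) i) \<longlonglongrightarrow> G x U i"
      unfolding G_def by (intro galerkin_tendsto L S_meshD X x Xx VU)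
  next
    fix x U j assume x: "x \<in> S_mesh R N" and U: "U 0 = 0" "U N = 0" and j: "j \<in> {1..<N}"
      and le: "(\<Sum>j\<in>{1..<N}. U j * G x U j) \<le> 0"
    have "galerkin a b c f N x U U \<le> 0"
      using le galerkin_lincomb[where W = U and U = U and x = x, OF L U] by (simp add: G_def)
    then have "\<bar>U j\<bar> \<le> Linf_norm f / a0"
      using j by (intro galerkin_bounded[where U = U, OF aL c_Linf f_Linf b_W1inf a0_pos a_ge coercive S_meshD[OF x] U]) auto
    then show "\<bar>U j\<bar> < M" by (simp add: M_def)
  qed
  then obtain x U where x: "x \<in> S_mesh R N" and U: "U 0 = 0" "U N = 0"
    and G: "\<And>j. j \<in> {1..<N} \<Longrightarrow> G x U j = 0"
    and eq: "\<And>i. i \<in> {1..N} \<Longrightarrow> \<rho> x U i * elem_len x i = (\<Sum>i=1..N. \<rho> x U i * elem_len x i) / real N"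
    by blast
  \<comment> \<open>Since \<open>U\<close> now solves the discrete problem, both truncations turn out to be inactive.\<close>
  note mx = S_meshD[OF x]
  let ?uh = "interp N x U" and ?rh = "fe_resid a b c f (interp N x U)"
  have sol: "fe_solution a b c f N x ?uh"
    by (rule galerkin_fe_solution[OF L mx U]) (use G in \<open>simp add: G_def\<close>)
  have \<alpha>: "alpha_h N x ?rh = S x U ^ 3" by (simp add: alpha_h_def S_def A_def)
  have S0: "0 \<le> S x U"
    unfolding S_def using mesh_elem_len[OF mx] by (intro sum_nonneg mult_nonneg_nonneg) (auto intro: less_imp_le)
  have S\<beta>: "\<beta> \<le> S x U"
    using N0[OF NN _ sol] x cube_powr_third[OF S0] unfolding \<alpha> by (simp add: R_def r_def \<beta>_def P_def)
  let ?K = "L * (1 + C1 * sqrt (R + 1) + C2)"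
  have "AE t in leb\<Omega>. \<bar>f t + wderiv a t * interp_deriv N x U t
       - b t * interp_deriv N x U t - c t * ?uh t\<bar> \<le> ?K"
  proof -
    have err: "Linf_norm (\<lambda>t. b t - wderiv a t) * Linf_norm (wderiv (\<lambda>t. u t - ?uh t))
            \<le> C1 * sqrt (R + 1) * Lp_norm 2 r / sqrt (real N)"
      "Linf_norm c * Linf_norm (\<lambda>t. u t - ?uh t) \<le> C2 * Lp_norm 2 r / real N"
    proof -
      have 1: "1 \<le> N" "1 \<le> R" using N R by auto
      have h: "\<forall>i\<in>{1..N}. 1 / (R * real N) \<le> elem_len x i \<and> elem_len x i \<le> 2 / real N"
        using x by (simp add: S_mesh_def)
      note C1_C2[unfolded error_constants_def, THEN conjunct2, THEN conjunct2, rule_format,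
        OF 1 f_L2 u_sol mx bspec[OF h] sol]
      then show "Linf_norm (\<lambda>t. b t - wderiv a t) * Linf_norm (wderiv (\<lambda>t. u t - ?uh t))
            \<le> C1 * sqrt (R + 1) * Lp_norm 2 r / sqrt (real N)"
        "Linf_norm c * Linf_norm (\<lambda>t. u t - ?uh t) \<le> C2 * Lp_norm 2 r / real N"
        unfolding r_def by blast+
    qed
    have n2: "0 \<le> Lp_norm 2 r" "Lp_norm 2 r \<le> L"
      unfolding L_def by (simp add: Lp_norm_def) (rule Lp2_norm_le_Linf_norm[OF rL])
    have "C1 * sqrt (R + 1) * Lp_norm 2 r / sqrt (real N) \<le> C1 * sqrt (R + 1) * L / 1"
      using C R N n2 by (intro frac_le mult_left_mono mult_nonneg_nonneg) auto
    moreover have "C2 * Lp_norm 2 r / real N \<le> C2 * L / 1"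
      using C N n2 by (intro frac_le mult_left_mono mult_nonneg_nonneg) auto
    ultimately have K: "Linf_norm r + Linf_norm (\<lambda>t. b t - wderiv a t) * Linf_norm (wderiv (\<lambda>t. u t - ?uh t))
       + Linf_norm c * Linf_norm (\<lambda>t. u t - ?uh t) \<le> ?K"
      using err by (simp add: L_def algebra_simps)
    show ?thesis
      using fe_resid_bound[where U = U, OF a_W1inf bL c_Linf f_Linf u_H2 mx U(1)]
    proof eventually_elim
      case (elim t)
      then show ?case using K unfolding r_def by (rule order_trans)
    qed
  qed
  then have AK: "A x U i \<le> ?K" if "i \<in> {1..N}" for i
    unfolding A_def using Lpos C R by (intro elem_avg_le[where U = U, OF mx U(1) that _ L']) auto
  have \<rho>_eq: "\<rho> x U i = rho N x ?rh i" if i: "i \<in> {1..N}" for i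
  proof -
    have "(1 + (A x U i)\<^sup>2 / S x U ^ 3) powr (1/3) \<le> R"
      by (rule density_le_rho0[OF C Lpos Ppos R_eq A0[OF x i] AK[OF i]]) (use S\<beta> in \<open>simp add: \<beta>_def\<close>)
    then show ?thesis using S\<beta> by (simp add: \<rho>_def rho_def \<alpha> A_def)
  qed
  have "equidistributing N x ?rh"
    unfolding equidistributing_def
  proof (intro conjI ballI)
    show "0 < alpha_h N x ?rh" unfolding \<alpha> using S\<beta> \<beta> by simp
    have "(\<Sum>i=1..N. \<rho> x U i * elem_len x i) = sigma_h N x ?rh"
      unfolding sigma_h_def by (rule sum.cong) (simp_all add: \<rho>_eq)
    then show "rho N x ?rh i * elem_len x i = sigma_h N x ?rh / real N" if "i \<in> {1..N}" for i
      using eq[OF that] \<rho>_eq[OF that] by simp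
  qed
  then show "\<exists>x uh. mesh N x \<and> fe_solution a b c f N x uh \<and> equidistributing N x (fe_resid a b c f uh)"
    using mx sol by blast
qed

end
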